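(* Let $m,n\ge 1$ be integers, let $0<p_1,\dots,p_m<\infty$ and $p=(1/p_1+\cdots+1/p_m)^{-1}$, and let $1<r<\infty$ and $s>0$ be fixed. Suppose that there is a constant $C$ such that $$\|T_\sigma\|_{L^{p_1}(\mathbb R^n)\times\cdots\times L^{p_m}(\mathbb R^n)\to L^p(\mathbb R^n)}\le C\sup_{j\in\mathbb Z}\|\sigma(2^j\cdot)\,\widehat\Psi\,\|_{L^r_s(\mathbb R^{mn})}$$ for all bounded functions $\sigma$ on $\mathbb R^{mn}$ for which $\sup_{j\in\mathbb Z}\|\sigma(2^j\cdot)\,\widehat\Psi\,\|_{L^r_s(\mathbb R^{mn})}<\infty$. Then $$s\ge \max\{(m-1)n/2,\; mn/r\}.$$
   Context: The Fourier transform is $\widehat f(\xi)=\int_{\mathbb R^n} f(x)e^{-2\pi i x\cdot\xi}\,dx$. For a bounded (complex-valued, measurable) function $\sigma$ on $\mathbb R^{mn}=\mathbb R^n\times\cdots\times\mathbb R^n$, the $m$-linear multiplier operator $T_\sigma$ is defined on $m$-tuples of Schwartz functions on $\mathbb R^n$ by $$T_\sigma(f_1,\dots,f_m)(x)=\int_{\mathbb R^{mn}}\sigma(\xi_1,\dots,\xi_m)\widehat f_1(\xi_1)\cdots\widehat f_m(\xi_m)e^{2\pi i x\cdot(\xi_1+\cdots+\xi_m)}\,d\xi_1\cdots d\xi_m,$$ and $\|T_\sigma\|_{L^{p_1}\times\cdots\times L^{p_m}\to L^p}$ is the smallest constant $K\in[0,\infty]$ such that $\|T_\sigma(f_1,\dots,f_m)\|_{L^p}\le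 K\prod_{i=1}^m\|f_i\|_{L^{p_i}}$ for all Schwartz functions $f_1,\dots,f_m$ (for exponents less than $1$, $\|\cdot\|_{L^q}$ is the usual quasi-norm). The function $\widehat\Psi\in\mathcal C_0^\infty(\mathbb R^{mn})$ is fixed, nonnegative, supported in the annulus $\{\vec\xi\in\mathbb R^{mn}:1/2\le|\vec\xi|\le 2\}$, and satisfies $\sum_{j\in\mathbb Z}\widehat\Psi(2^{-j}\vec\xi)=1$ for all $\vec\xi\ne 0$. For $1<r<\infty$ and $s>0$, $L^r_s(\mathbb R^d)$ is the Sobolev space of all $h$ with $(I-\Delta)^{s/2}h\in L^r(\mathbb R^d)$, where $\Delta$ is the Laplacian, with norm $\|h\|_{L^r_s(\mathbb R^d)}=\|(I-\Delta)^{s/2}h\|_{L^r(\mathbb R^d)}$. *)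

theory Defs
  imports "HOL-Analysis.Analysis"
begin

section \<open>Smooth functions and Schwartz functions\<close>

fun iter_deriv :: "'a::real_normed_vector list \<Rightarrow> ('a \<Rightarrow> 'b::real_normed_vector) \<Rightarrow> 'a \<Rightarrow> 'b" where
  "iter_deriv [] f = f"
| "iter_deriv (v # vs) f = (\<lambda>x. frechet_derivative (iter_deriv vs f) (at x) v)"

text \<open>The partial derivatives are those in the coordinate directions. Every iterated one is
  required to be (Frechet) differentiable everywhere, so none of the derivatives in
  \<^const>\<open>iter_deriv\<close> is a junk value.\<close>

definition smooth :: "('a::euclidean_space \<Rightarrow> 'b::real_normed_vector) \<Rightarrow> bool" where
  "smooth f \<longleftrightarrow> (\<forall>vs. set vs \<subseteq> Basis \<longrightarrow> (\<forall>x. iter_deriv vs f differentiable (at x)))"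

definition schwartz :: "('a::euclidean_space \<Rightarrow> complex) \<Rightarrow> bool" where
  "schwartz f \<longleftrightarrow> smooth f \<and>
     (\<forall>k::nat. \<forall>vs. set vs \<subseteq> Basis \<longrightarrow> bounded (range (\<lambda>x. norm x ^ k *\<^sub>R iter_deriv vs f x)))"

definition support :: "('a::topological_space \<Rightarrow> 'b::zero) \<Rightarrow> 'a set" where
  "support f = closure {x. f x \<noteq> 0}"

section \<open>Lebesgue (quasi-)norms and the Fourier transform\<close>

text \<open>Measurability and integrals refer to \<^const>\<open>lebesgue\<close> throughout: a Lebesgue measurable
  function need not be measurable for \<^const>\<open>lborel\<close>, where its integral would be junk.\<close>

definition Lp_norm :: "real \<Rightarrow> ('a::euclidean_space \<Rightarrow> complex) \<Rightarrow> ennreal" where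
  "Lp_norm p f =
     (let I = (\<integral>\<^sup>+x. ennreal (norm (f x) powr p) \<partial>lebesgue)
      in if I = \<infinity> then \<infinity> else ennreal (enn2real I powr (1 / p)))"

definition Lp_space :: "real \<Rightarrow> ('a::euclidean_space \<Rightarrow> complex) set" where
  "Lp_space p = {f \<in> borel_measurable lebesgue. Lp_norm p f < \<infinity>}"

definition fourier :: "('a::euclidean_space \<Rightarrow> complex) \<Rightarrow> 'a \<Rightarrow> complex" where
  "fourier f \<xi> = (LINT x|lebesgue. f x * cis (- 2 * pi * (x \<bullet> \<xi>)))"

section \<open>Sobolev norms\<close>

text \<open>On a Schwartz function, \<open>(I - \<Delta>)\<^bsup>s/2\<^esup>\<close> is the Fourier multiplier with symbol
  \<open>(1 + 4 \<pi>\<^sup>2 |\<xi>|\<^sup>2)\<^bsup>s/2\<^esup>\<close>, since \<open>-\<Delta>\<close> has symbol \<open>4 \<pi>\<^sup>2 |\<xi>|\<^sup>2\<close> for the normalisation of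
  \<^const>\<open>fourier\<close>.\<close>

definition bessel_op :: "real \<Rightarrow> ('a::euclidean_space \<Rightarrow> complex) \<Rightarrow> 'a \<Rightarrow> complex" where
  "bessel_op s \<phi> x =
     (LINT \<xi>|lebesgue. complex_of_real ((1 + 4 * pi\<^sup>2 * (norm \<xi>)\<^sup>2) powr (s / 2)) *
        fourier \<phi> \<xi> * cis (2 * pi * (x \<bullet> \<xi>)))"

text \<open>Functions that act on all Schwartz functions by integration, i.e. that are
  tempered distributions.\<close>

definition tempered :: "('a::euclidean_space \<Rightarrow> complex) \<Rightarrow> bool" where
  "tempered h \<longleftrightarrow> (\<forall>\<phi>. schwartz \<phi> \<longrightarrow> integrable lebesgue (\<lambda>x. h x * \<phi> x))"

text \<open>\<open>(I - \<Delta>)\<^bsup>s/2\<^esup> h = g\<close> as tempered distributions. The operator extends to distributions by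
  duality; it is its own transpose for the bilinear pairing because its symbol is even.\<close>

definition bessel_image :: "real \<Rightarrow> ('a::euclidean_space \<Rightarrow> complex) \<Rightarrow> ('a \<Rightarrow> complex) \<Rightarrow> bool" where
  "bessel_image s h g \<longleftrightarrow> tempered h \<and> tempered g \<and>
     (\<forall>\<phi>. schwartz \<phi> \<longrightarrow>
        (LINT x|lebesgue. g x * \<phi> x) = (LINT x|lebesgue. h x * bessel_op s \<phi> x))"

text \<open>The \<open>g\<close> below is unique up to null sets, so the infimum is over at most one value;
  it is \<open>\<infinity>\<close> exactly if \<open>h\<close> does not belong to the Sobolev space.\<close>

definition sobolev_norm :: "real \<Rightarrow> real \<Rightarrow> ('a::euclidean_space \<Rightarrow> complex) \<Rightarrow> ennreal" where
  "sobolev_norm r s h = (INF g \<in> {g \<in> Lp_space r. bessel_image s h g}. Lp_norm r g)"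

section \<open>Multilinear multiplier operators\<close>

text \<open>A point of \<open>(\<real>\<^sup>n)\<^sup>m\<close> is a vector \<open>\<xi> :: real^'n^'m\<close> whose \<open>i\<close>-th entry \<open>\<xi> $ i :: real^'n\<close> is
  the \<open>i\<close>-th frequency variable; its norm is the Euclidean norm of \<open>\<real>\<^bsup>mn\<^esup>\<close>.\<close>

definition multiplier_op ::
  "(real^'n^'m \<Rightarrow> complex) \<Rightarrow> ('m \<Rightarrow> real^'n \<Rightarrow> complex) \<Rightarrow> real^'n \<Rightarrow> complex" where
  "multiplier_op \<sigma> f x =
     (LINT \<xi>|lebesgue. \<sigma> \<xi> * (\<Prod>i\<in>UNIV. fourier (f i) (\<xi> $ i)) *
        cis (2 * pi * (x \<bullet> (\<Sum>i\<in>UNIV. \<xi> $ i))))"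

definition multiplier_norm ::
  "('m \<Rightarrow> real) \<Rightarrow> real \<Rightarrow> (real^'n^'m \<Rightarrow> complex) \<Rightarrow> ennreal" where
  "multiplier_norm ps p \<sigma> =
     Inf {K. \<forall>f. (\<forall>i. schwartz (f i)) \<longrightarrow>
               Lp_norm p (multiplier_op \<sigma> f) \<le> K * (\<Prod>i\<in>UNIV. Lp_norm (ps i) (f i))}"

definition dyadic_piece ::
  "(real^'n^'m \<Rightarrow> real) \<Rightarrow> (real^'n^'m \<Rightarrow> complex) \<Rightarrow> int \<Rightarrow> real^'n^'m \<Rightarrow> complex" where
  "dyadic_piece \<Psi> \<sigma> j \<xi> = \<sigma> ((2 powi j) *\<^sub>R \<xi>) * complex_of_real (\<Psi> \<xi>)"

definition sobolev_sup ::
  "(real^'n^'m \<Rightarrow> real) \<Rightarrow> real \<Rightarrow> real \<Rightarrow> (real^'n^'m \<Rightarrow> complex) \<Rightarrow> ennreal" where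
  "sobolev_sup \<Psi> r s \<sigma> = (SUP j::int. sobolev_norm r s (dyadic_piece \<Psi> \<sigma> j))"

end

theory Submission
  imports Defs "HOL-Probability.Sinc_Integral"
begin

text \<open>Both conditions are tested by one family of multipliers. Write \<open>d = m n\<close> and, on \<open>\<real>\<^sup>d\<close>,
\<open>q(\<eta>) = |\<eta>|\<^sup>2 - |\<eta>\<^sub>1 + \<dots> + \<eta>\<^sub>m|\<^sup>2\<close>. The chirp \<open>\<Gamma>(\<eta>) = exp (- \<pi> |\<eta>|\<^sup>2 + i \<pi> N q(\<eta>))\<close> is transplanted
to scale \<open>\<epsilon>\<close> around a point \<open>a\<close> of norm 1, which gives \<open>\<sigma>(\<xi>) = \<Gamma>((\<xi> - a) / \<epsilon>)\<close> with \<open>N \<ge> 1\<close> and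
\<open>0 < \<epsilon> \<le> 1\<close>.

\<^emph>\<open>Sobolev side.\<close> Each derivative of \<open>\<sigma>\<close> costs a factor \<open>N / \<epsilon>\<close>, and \<open>\<sigma>\<close> lives in a ball of radius
about \<open>\<epsilon>\<close>, so that all dyadic pieces have Sobolev norm at most \<open>C (N / \<epsilon>)\<^sup>s \<epsilon>\<^bsup>d/r\<^esup>\<close>
(\<open>dyadic_chirp_sobolev\<close>). Integer powers of \<open>L = I - \<Delta>\<close> are read off from the form of the
derivatives, polynomial times exponential. Fractional powers come from subordination to the heat
semigroup, \<open>L\<^sup>\<theta> H = c \<integral> t\<^bsup>-1-\<theta>\<^esup> (H - e\<^bsup>-tL\<^esup> H) dt\<close> over \<open>t > 0\<close>: the difference is at most \<open>2 |H|\<close> and at most \<open>t |L H|\<close>, in the supremum norm and in \<open>L\<^sup>1\<close>, and the two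
norms together control \<open>L\<^sup>r\<close> (\<open>bessel_op_interpolation\<close>, \<open>sobolev_norm_upper_bound\<close>).

\<^emph>\<open>Operator side.\<close> The input \<open>f\<^sub>i\<close> has Fourier transform a multiple of
\<open>exp (- \<pi> (1 + i N) |\<xi>\<^sub>i - a\<^sub>i|\<^sup>2 / \<epsilon>\<^sup>2)\<close>. The phase of \<open>\<sigma>\<close> cancels the phases of the \<open>f\<^sub>i\<close> and leaves one
quadratic phase in the sum of the frequencies, so the output is again a Gaussian chirp. Inputs and
output all spread over \<open>|x| \<lesssim> N / \<epsilon>\<close>; because \<open>1/p\<close> is the sum of the \<open>1/p\<^sub>i\<close>, the volume factors
balance and no power of \<open>\<epsilon>\<close> survives. But dispersion has cost each of the \<open>m\<close> inputs a factor
\<open>N\<^bsup>-n/2\<^esup>\<close> of its height, and the output only one such factor: the multiplier norm is at least a constant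
times \<open>N\<^bsup>(m-1)n/2\<^esup>\<close> (\<open>multiplier_norm_chirp_lower_bound\<close>).

Hence \<open>N\<^bsup>(m-1)n/2\<^esup> \<le> C (N / \<epsilon>)\<^sup>s \<epsilon>\<^bsup>d/r\<^esup>\<close>, uniformly in \<open>N\<close> and \<open>\<epsilon>\<close>. Letting
\<open>N \<rightarrow> \<infinity>\<close> with \<open>\<epsilon> = 1\<close> bounds \<open>s\<close> below by \<open>(m-1)n/2\<close>, and \<open>\<epsilon> \<rightarrow> 0\<close> with \<open>N = 1\<close> bounds it below by
\<open>mn/r\<close>.\<close>

section \<open>Integration on Euclidean space\<close>

lemma Fubini_lborel:
  fixes f :: "'a::euclidean_space \<Rightarrow> 'b::euclidean_space \<Rightarrow> complex"
  assumes [measurable]: "(\<lambda>(x, y). f x y) \<in> borel_measurable (lborel \<Otimes>\<^sub>M lborel)"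
    and fin: "(\<integral>\<^sup>+x. \<integral>\<^sup>+y. ennreal (norm (f x y)) \<partial>lborel \<partial>lborel) < \<infinity>"
  shows "(LINT x|lborel. LINT y|lborel. f x y) = (LINT y|lborel. LINT x|lborel. f x y)"
proof -
  have "integrable (lborel \<Otimes>\<^sub>M lborel) (\<lambda>(x, y). f x y)"
  proof (rule integrableI_bounded)
    have "(\<integral>\<^sup>+z. ennreal (norm (case z of (x, y) \<Rightarrow> f x y)) \<partial>(lborel \<Otimes>\<^sub>M lborel)) =
        (\<integral>\<^sup>+x. \<integral>\<^sup>+y. ennreal (norm (f x y)) \<partial>lborel \<partial>lborel)"
      by (subst lborel.nn_integral_fst[symmetric]) (auto simp: case_prod_beta)
    then show "(\<integral>\<^sup>+z. ennreal (norm (case z of (x, y) \<Rightarrow> f x y)) \<partial>(lborel \<Otimes>\<^sub>M lborel)) < \<infinity>"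
      using fin by simp
  qed simp
  then show ?thesis by (rule lborel_pair.Fubini_integral[symmetric])
qed

lemma measurable_pair_continuous:
  fixes f :: "'a::euclidean_space \<Rightarrow> 'b::euclidean_space \<Rightarrow> 'c::topological_space"
  assumes "continuous_on UNIV (\<lambda>z. f (fst z) (snd z))"
  shows "(\<lambda>(x, y). f x y) \<in> borel_measurable (lborel \<Otimes>\<^sub>M lborel)"
proof -
  have "(\<lambda>(x, y). f x y) \<in> borel_measurable borel"
    using borel_measurable_continuous_onI[OF assms] by (simp add: case_prod_beta')
  then show ?thesis by (simp add: lborel_prod)
qed

lemma nn_integral_lborel_affine:
  fixes f :: "'a::euclidean_space \<Rightarrow> ennreal" and t :: 'a
  assumes [measurable]: "f \<in> borel_measurable borel" and "c > 0"
  shows "(\<integral>\<^sup>+x. f x \<partial>lborel) = ennreal (c ^ DIM('a)) * (\<integral>\<^sup>+x. f (t + c *\<^sub>R x) \<partial>lborel)"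
  using assms
  by (subst lborel_affine[of c t])
    (auto simp: nn_integral_density nn_integral_distr nn_integral_cmult)

lemma integral_lborel_affine:
  fixes f :: "'a::euclidean_space \<Rightarrow> complex" and t :: 'a
  assumes [measurable]: "f \<in> borel_measurable borel" and "c > 0"
  shows "(LINT x|lborel. f x) = complex_of_real (c ^ DIM('a)) * (LINT x|lborel. f (t + c *\<^sub>R x))"
  using assms
  by (subst lborel_affine[of c t])
    (auto simp: integral_density integral_distr scaleR_conv_of_real)

lemma nn_integral_lborel_translate:
  fixes f :: "'a::euclidean_space \<Rightarrow> ennreal" and t :: 'a
  assumes "f \<in> borel_measurable borel"
  shows "(\<integral>\<^sup>+x. f (x + t) \<partial>lborel) = (\<integral>\<^sup>+x. f x \<partial>lborel)"
  using nn_integral_lborel_affine[OF assms, of 1 t] by (simp add: add.commute)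

lemma integral_lborel_translate:
  fixes f :: "'a::euclidean_space \<Rightarrow> complex" and t :: 'a
  assumes "f \<in> borel_measurable borel"
  shows "(LINT x|lborel. f (x + t)) = (LINT x|lborel. f x)"
  using integral_lborel_affine[OF assms, of 1 t] by (simp add: add.commute)

lemma lborel_reflect:
  "distr lborel borel uminus = (lborel :: 'a::euclidean_space measure)"
  using lborel_affine[of "-1" "0::'a"] by (simp add: density_1)

lemma nn_integral_lborel_reflect:
  fixes f :: "'a::euclidean_space \<Rightarrow> ennreal" and t :: 'a
  assumes [measurable]: "f \<in> borel_measurable borel"
  shows "(\<integral>\<^sup>+x. f (t - x) \<partial>lborel) = (\<integral>\<^sup>+x. f x \<partial>lborel)"
proof -
  have "(\<integral>\<^sup>+x. f (t - x) \<partial>lborel) = (\<integral>\<^sup>+x. f (t - x) \<partial>distr lborel borel uminus)"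
    by (simp add: lborel_reflect)
  also have "\<dots> = (\<integral>\<^sup>+x. f (x + t) \<partial>lborel)"
    by (subst nn_integral_distr) (auto simp: add.commute)
  finally show ?thesis by (simp add: nn_integral_lborel_translate)
qed

lemma integral_lborel_reflect:
  fixes f :: "'a::euclidean_space \<Rightarrow> complex" and t :: 'a
  assumes [measurable]: "f \<in> borel_measurable borel"
  shows "(LINT x|lborel. f (t - x)) = (LINT x|lborel. f x)"
proof -
  have "(LINT x|lborel. f (t - x)) = (LINT x|distr lborel borel uminus. f (t - x))"
    by (simp add: lborel_reflect)
  also have "\<dots> = (LINT x|lborel. f (x + t))"
    by (subst integral_distr) (auto simp: add.commute)
  finally show ?thesis by (simp add: integral_lborel_translate)
qed

text \<open>Dominated convergence: one integrable majorant for all parameters makes the integral continuous.\<close>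

lemma continuous_on_integral_param:
  fixes g :: "'a::euclidean_space \<Rightarrow> 'b::metric_space \<Rightarrow> complex"
  assumes cont: "\<And>x. continuous_on UNIV (g x)"
    and meas: "\<And>y. (\<lambda>x. g x y) \<in> borel_measurable lborel"
    and w: "integrable lborel w" and bound: "\<And>x y. norm (g x y) \<le> w x"
  shows "continuous_on UNIV (\<lambda>y. LINT x|lborel. g x y)"
proof (rule continuous_on_sequentiallyI)
  fix u :: "nat \<Rightarrow> 'b" and a assume "u \<longlonglongrightarrow> a"
  show "(\<lambda>n. LINT x|lborel. g x (u n)) \<longlonglongrightarrow> (LINT x|lborel. g x a)"
  proof (rule integral_dominated_convergence[where w = w])
    show "AE x in lborel. (\<lambda>n. g x (u n)) \<longlonglongrightarrow> g x a"
      by (intro AE_I2 continuous_on_tendsto_compose[OF cont \<open>u \<longlonglongrightarrow> a\<close>]) auto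
  qed (use meas w bound in auto)
qed

text \<open>The fundamental theorem of calculus in \<open>s\<close> followed by Fubini. It takes the place of differentiation
under the integral sign.\<close>

lemma integral_param_FTC:
  fixes F F' :: "real \<Rightarrow> 'a::euclidean_space \<Rightarrow> complex"
  assumes deriv: "\<And>s x. s \<in> {0..1} \<Longrightarrow> ((\<lambda>s. F s x) has_vector_derivative F' s x) (at s)"
    and cont: "continuous_on UNIV (\<lambda>z. F' (fst z) (snd z))"
    and bound: "\<And>s. s \<in> {0..1} \<Longrightarrow> (\<integral>\<^sup>+x. ennreal (norm (F' s x)) \<partial>lborel) \<le> ennreal B"
    and const: "\<And>s. s \<in> {0..1} \<Longrightarrow> (LINT x|lborel. F' s x) = c"
    and int: "integrable lborel (F 0)" "integrable lborel (F 1)"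
  shows "(LINT x|lborel. F 1 x) - (LINT x|lborel. F 0 x) = c"
proof -
  let ?f = "\<lambda>s x. indicator {0..1::real} s *\<^sub>R F' s x"
  have [measurable]: "(\<lambda>(s, x). F' s x) \<in> borel_measurable (lborel \<Otimes>\<^sub>M lborel)"
    by (rule measurable_pair_continuous[OF cont])
  have eq: "F 1 x - F 0 x = (LINT s|lborel. ?f s x)" for x
  proof -
    have "continuous_on UNIV (\<lambda>s. F' s x)"
      using continuous_on_compose2[OF cont, of UNIV "\<lambda>s. (s, x)"]
      by (simp add: continuous_on_Pair)
    then have "continuous_on {0..1} (\<lambda>s. F' s x)" by (rule continuous_on_subset) simp
    then have "has_bochner_integral lborel (\<lambda>s. ?f s x) (F 1 x - F 0 x)"
      by (intro has_bochner_integral_FTC_Icc)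
        (auto intro: has_vector_derivative_at_within[OF deriv])
    then show ?thesis by (simp add: has_bochner_integral_integral_eq)
  qed
  have "(\<integral>\<^sup>+s. \<integral>\<^sup>+x. ennreal (norm (?f s x)) \<partial>lborel \<partial>lborel) \<le>
      (\<integral>\<^sup>+s. ennreal B * indicator {0..1::real} s \<partial>lborel)"
    using bound by (intro nn_integral_mono) (auto split: split_indicator)
  also have "\<dots> < \<infinity>" by (simp add: nn_integral_cmult)
  finally have fin: "(\<integral>\<^sup>+s. \<integral>\<^sup>+x. ennreal (norm (?f s x)) \<partial>lborel \<partial>lborel) < \<infinity>" .
  have "(LINT x|lborel. F 1 x) - (LINT x|lborel. F 0 x) = (LINT x|lborel. LINT s|lborel. ?f s x)"
    using int by (simp flip: eq)
  also have "\<dots> = (LINT s|lborel. LINT x|lborel. ?f s x)"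
    by (rule Fubini_lborel[OF _ fin, symmetric]) measurable
  also have "\<dots> = (LINT s|lborel. indicator {0..1::real} s *\<^sub>R c)"
    by (intro Bochner_Integration.integral_cong) (auto simp: const split: split_indicator)
  also have "\<dots> = c" by simp
  finally show ?thesis .
qed

text \<open>Integration by parts, from translation invariance: moving \<open>F\<close> along \<open>s v\<close> does not change its
integral, while the derivative of the moved function in \<open>s\<close> has the constant integral of the
directional derivative.\<close>

lemma integral_directional_derivative:
  fixes F :: "'a::euclidean_space \<Rightarrow> complex"
  assumes deriv: "\<And>x. (F has_derivative F' x) (at x)"
    and cont: "continuous_on UNIV (\<lambda>x. F' x v)"
    and int: "integrable lborel F" "integrable lborel (\<lambda>x. F' x v)"
  shows "(LINT x|lborel. F' x v) = 0"
proof -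
  let ?F = "\<lambda>s x. F (x + s *\<^sub>R v)" and ?F' = "\<lambda>s x. F' (x + s *\<^sub>R v) v"
  have [measurable]: "F \<in> borel_measurable borel" "(\<lambda>x. F' x v) \<in> borel_measurable borel"
    using int by (auto dest: borel_measurable_integrable)
  have "(LINT x|lborel. ?F 1 x) - (LINT x|lborel. ?F 0 x) = (LINT x|lborel. F' x v)"
  proof (rule integral_param_FTC[where B = "enn2real (\<integral>\<^sup>+x. norm (F' x v) \<partial>lborel)"])
    fix s :: real and x :: 'a
    interpret bounded_linear "F' (x + s *\<^sub>R v)" by (rule has_derivative_bounded_linear[OF deriv])
    have "((\<lambda>s. F (x + s *\<^sub>R v)) has_derivative (\<lambda>h. F' (x + s *\<^sub>R v) (h *\<^sub>R v))) (at s)"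
      by (rule has_derivative_compose[OF _ deriv]) (auto intro!: derivative_eq_intros)
    then show "((\<lambda>s. ?F s x) has_vector_derivative ?F' s x) (at s)"
      unfolding has_vector_derivative_def by (simp add: scaleR)
    show "(\<integral>\<^sup>+x. ennreal (norm (?F' s x)) \<partial>lborel) \<le> ennreal (enn2real (\<integral>\<^sup>+x. norm (F' x v) \<partial>lborel))"
      using int(2) nn_integral_lborel_translate[of "\<lambda>x. ennreal (norm (F' x v))" "s *\<^sub>R v"]
      by (simp add: integrable_iff_bounded)
    show "(LINT x|lborel. ?F' s x) = (LINT x|lborel. F' x v)"
      by (rule integral_lborel_translate) simp
  next
    show "continuous_on UNIV (\<lambda>z. ?F' (fst z) (snd z))"
      by (rule continuous_on_compose2[OF cont]) (auto intro!: continuous_intros)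
    show "integrable lborel (?F 0)" using int by simp
    show "integrable lborel (?F 1)"
    proof (rule integrableI_bounded)
      show "(\<integral>\<^sup>+x. ennreal (norm (?F 1 x)) \<partial>lborel) < \<infinity>"
        using int(1) nn_integral_lborel_translate[of "\<lambda>x. ennreal (norm (F x))" v]
        by (simp add: integrable_iff_bounded)
    qed simp
  qed
  moreover have "(LINT x|lborel. ?F 1 x) = (LINT x|lborel. ?F 0 x)"
    by (simp add: integral_lborel_translate)
  ultimately show ?thesis by simp
qed

text \<open>An integrable majorant for rapidly decreasing functions. The product form reduces its
integrability to dimension one.\<close>

definition japanese_prod :: "'a::euclidean_space \<Rightarrow> real" where
  "japanese_prod x = (\<Prod>b\<in>Basis. inverse (1 + (x \<bullet> b)\<^sup>2))"

lemma integrable_japanese_prod: "integrable lborel japanese_prod"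
proof (rule integrableI_bounded)
  show "japanese_prod \<in> borel_measurable lborel" unfolding japanese_prod_def by measurable
  have nn: "0 \<le> inverse (1 + t\<^sup>2)" for t :: real
    by (simp add: add_nonneg_nonneg)
  have "integrable lborel (\<lambda>t::real. inverse (1 + t\<^sup>2))"
    using integrable_inverse_1_plus_square by (simp add: set_integrable_def einterval_def)
  then have fin: "(\<integral>\<^sup>+t. ennreal (inverse (1 + t\<^sup>2)) \<partial>(lborel :: real measure)) < \<infinity>"
    using nn by (simp add: integrable_iff_bounded abs_of_nonneg)
  have "(\<integral>\<^sup>+x. ennreal (norm (japanese_prod (x :: 'a))) \<partial>lborel) =
      (\<integral>\<^sup>+x. (\<Prod>b\<in>Basis. ennreal (inverse (1 + ((x :: 'a) \<bullet> b)\<^sup>2))) \<partial>lborel)"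
    unfolding japanese_prod_def using nn
    by (subst prod_ennreal) (auto simp: abs_of_nonneg prod_nonneg)
  also have "\<dots> = (\<Prod>b\<in>(Basis::'a set). (\<integral>\<^sup>+t. ennreal (inverse (1 + t\<^sup>2)) \<partial>lborel))"
    by (rule nn_integral_lborel_prod) auto
  also have "\<dots> < \<infinity>" using fin by (simp add: power_less_top_ennreal)
  finally show "(\<integral>\<^sup>+x. ennreal (norm (japanese_prod (x :: 'a))) \<partial>lborel) < \<infinity>" .
qed

lemma japanese_prod_pos: "japanese_prod x > 0"
  unfolding japanese_prod_def by (intro prod_pos) (auto intro: add_pos_nonneg)

lemma inverse_japanese_prod_le: "inverse (japanese_prod x) \<le> (1 + (norm x)\<^sup>2) ^ DIM('a)"
  for x :: "'a::euclidean_space"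
proof -
  have "inverse (japanese_prod x) = (\<Prod>b\<in>Basis. 1 + (x \<bullet> b)\<^sup>2)"
    unfolding japanese_prod_def by (simp add: prod_inversef[symmetric] o_def)
  also have "\<dots> \<le> (\<Prod>b\<in>(Basis::'a set). 1 + (norm x)\<^sup>2)"
    by (intro prod_mono) (auto simp: abs_le_square_iff[symmetric] Basis_le_norm)
  finally show ?thesis by simp
qed

lemma integrable_rapid_decay:
  fixes f :: "'a::euclidean_space \<Rightarrow> complex"
  assumes "f \<in> borel_measurable borel" "\<And>x. norm (f x) * (1 + (norm x)\<^sup>2) ^ DIM('a) \<le> C"
  shows "integrable lborel f"
proof (rule Bochner_Integration.integrable_bound)
  show "integrable lborel (\<lambda>x::'a. C * japanese_prod x)"
    by (intro integrable_mult_right integrable_japanese_prod)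
  show "AE x in lborel. norm (f x) \<le> norm (C * japanese_prod x)"
  proof (rule AE_I2)
    fix x
    have "norm (f x) * inverse (japanese_prod x) \<le> norm (f x) * (1 + (norm x)\<^sup>2) ^ DIM('a)"
      by (intro mult_left_mono inverse_japanese_prod_le) auto
    also have "\<dots> \<le> C" by (rule assms)
    finally have "norm (f x) \<le> C * japanese_prod x"
      using japanese_prod_pos[of x] by (simp add: field_simps)
    then show "norm (f x) \<le> norm (C * japanese_prod x)" by simp
  qed
qed (use assms in auto)

section \<open>Schwartz functions and their Fourier transforms\<close>

lemma iter_deriv_append: "iter_deriv (us @ vs) f = iter_deriv us (iter_deriv vs f)"
  by (induction us) auto

lemma smooth_has_derivative:
  assumes "smooth f" "set vs \<subseteq> Basis"
  shows "(iter_deriv vs f has_derivative frechet_derivative (iter_deriv vs f) (at x)) (at x)"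
  using assms unfolding smooth_def frechet_derivative_works by blast

lemma smooth_continuous:
  assumes "smooth f" "set vs \<subseteq> Basis"
  shows "continuous_on UNIV (iter_deriv vs f)"
  using smooth_has_derivative[OF assms]
  by (intro continuous_at_imp_continuous_on) (auto intro: has_derivative_continuous)

lemma smooth_iter_deriv:
  assumes "smooth f" "set vs \<subseteq> Basis"
  shows "smooth (iter_deriv vs f)"
  using assms by (auto simp: smooth_def iter_deriv_append[symmetric])

lemma schwartz_iter_deriv:
  assumes "schwartz f" "set vs \<subseteq> Basis"
  shows "schwartz (iter_deriv vs f)"
  using assms by (auto simp: schwartz_def smooth_iter_deriv iter_deriv_append[symmetric])

lemma iter_deriv_diff:
  assumes "smooth f" "smooth g" "set vs \<subseteq> Basis"
  shows "iter_deriv vs (\<lambda>x. f x - g x) = (\<lambda>x. iter_deriv vs f x - iter_deriv vs g x)"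
  using assms(3)
proof (induction vs)
  case (Cons v vs)
  then have IH: "iter_deriv vs (\<lambda>x. f x - g x) = (\<lambda>x. iter_deriv vs f x - iter_deriv vs g x)" by simp
  from Cons have d: "((\<lambda>x. iter_deriv vs f x - iter_deriv vs g x) has_derivative
      (\<lambda>h. frechet_derivative (iter_deriv vs f) (at x) h -
           frechet_derivative (iter_deriv vs g) (at x) h)) (at x)" for x
    by (intro has_derivative_diff smooth_has_derivative assms) auto
  show ?case by (simp add: IH frechet_derivative_at[OF d, symmetric])
qed simp

lemma schwartz_bounded:
  assumes "schwartz f" "set vs \<subseteq> Basis"
  shows "\<exists>C. \<forall>x. norm x ^ k * norm (iter_deriv vs f x) \<le> C"
proof -
  have "bounded (range (\<lambda>x. norm x ^ k *\<^sub>R iter_deriv vs f x))"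
    using assms by (auto simp: schwartz_def)
  then obtain C where "\<forall>y\<in>range (\<lambda>x. norm x ^ k *\<^sub>R iter_deriv vs f x). norm y \<le> C"
    by (auto simp: bounded_iff)
  then show ?thesis by (intro exI[of _ C]) auto
qed

lemma schwartz_diff:
  assumes "schwartz f" "schwartz g"
  shows "schwartz (\<lambda>x. f x - g x)"
  unfolding schwartz_def smooth_def
proof safe
  note sm = assms[unfolded schwartz_def, THEN conjunct1]
  fix vs :: "'a list" and x
  assume vs: "set vs \<subseteq> Basis"
  show "iter_deriv vs (\<lambda>x. f x - g x) differentiable at x"
    using sm vs by (simp add: iter_deriv_diff smooth_def differentiable_diff)
  fix k
  show "bounded (range (\<lambda>x. norm x ^ k *\<^sub>R iter_deriv vs (\<lambda>x. f x - g x) x))"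
  proof -
    obtain C where C: "\<And>x. norm x ^ k * norm (iter_deriv vs f x) \<le> C"
      using schwartz_bounded[OF assms(1) vs] by blast
    obtain D where D: "\<And>x. norm x ^ k * norm (iter_deriv vs g x) \<le> D"
      using schwartz_bounded[OF assms(2) vs] by blast
    show ?thesis unfolding bounded_iff
    proof (intro exI[of _ "C + D"] ballI, elim rangeE, simp add: iter_deriv_diff sm vs)
      fix x
      have "norm x ^ k * norm (iter_deriv vs f x - iter_deriv vs g x) \<le>
          norm x ^ k * (norm (iter_deriv vs f x) + norm (iter_deriv vs g x))"
        by (intro mult_left_mono norm_triangle_ineq4) auto
      then show "norm x ^ k * norm (iter_deriv vs f x - iter_deriv vs g x) \<le> C + D"
        using C[of x] D[of x] by (simp add: distrib_left)
    qed
  qed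
qed

text \<open>Closure under differences already gives sums, since \<open>x + y = x - ((y - y) - y)\<close>.\<close>

lemma schwartz_sum:
  fixes f :: "'i \<Rightarrow> 'a::euclidean_space \<Rightarrow> complex"
  assumes "finite I" "\<And>i. i \<in> I \<Longrightarrow> schwartz (f i)"
  shows "schwartz (\<lambda>x. \<Sum>i\<in>I. f i x)"
  using assms
proof (induction I rule: finite_induct)
  case empty
  have "iter_deriv vs (\<lambda>x::'a. 0 :: complex) = (\<lambda>x. 0)" for vs :: "'a list"
    by (induction vs) auto
  then show ?case by (auto simp: schwartz_def smooth_def)
next
  case (insert i I)
  have "schwartz (\<lambda>x. f i x - ((\<Sum>i\<in>I. f i x) - (\<Sum>i\<in>I. f i x) - (\<Sum>i\<in>I. f i x)))"
    using insert by (intro schwartz_diff) auto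
  then show ?case using insert by simp
qed

lemma schwartz_continuous: "schwartz f \<Longrightarrow> continuous_on UNIV f"
  using smooth_continuous[of f "[]"] by (auto simp: schwartz_def)

lemma schwartz_measurable [measurable_dest]: "schwartz f \<Longrightarrow> f \<in> borel_measurable borel"
  by (intro borel_measurable_continuous_onI schwartz_continuous)

text \<open>The weight \<open>(1 + |x|\<^sup>2)\<^sup>k\<close> is at most \<open>2\<^sup>k (1 + |x|\<^bsup>2k\<^esup>)\<close>, so the two powers \<open>0\<close> and
\<open>2k\<close> of the norm in the definition suffice.\<close>

lemma schwartz_decay:
  assumes "schwartz f"
  shows "\<exists>C. \<forall>x. norm (f x) * (1 + (norm x)\<^sup>2) ^ k \<le> C"
proof -
  obtain C where C: "\<And>x. norm x ^ 0 * norm (iter_deriv [] f x) \<le> C"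
    using schwartz_bounded[OF assms, of "[]" 0] by auto
  obtain D where D: "\<And>x. norm x ^ (2 * k) * norm (iter_deriv [] f x) \<le> D"
    using schwartz_bounded[OF assms, of "[]" "2 * k"] by auto
  show ?thesis
  proof (intro exI[of _ "2 ^ k * (C + D)"] allI)
    fix x
    have le: "(1 + a) ^ k \<le> 2 ^ k * (1 + a ^ k)" if "a \<ge> 0" for a :: real
    proof (cases "a \<le> 1")
      case True
      then have "(1 + a) ^ k \<le> 2 ^ k" using that by (intro power_mono) auto
      also have "\<dots> \<le> 2 ^ k * (1 + a ^ k)" using that by simp
      finally show ?thesis .
    next
      case False
      then have "(1 + a) ^ k \<le> (2 * a) ^ k" by (intro power_mono) auto
      also have "\<dots> \<le> 2 ^ k * (1 + a ^ k)" by (simp add: power_mult_distrib)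
      finally show ?thesis .
    qed
    have "norm (f x) * (1 + (norm x)\<^sup>2) ^ k \<le> norm (f x) * (2 ^ k * (1 + ((norm x)\<^sup>2) ^ k))"
      by (intro mult_left_mono le) auto
    also have "\<dots> = 2 ^ k * (norm (f x) + norm x ^ (2 * k) * norm (f x))"
      by (simp only: power_mult) (simp add: algebra_simps)
    also have "\<dots> \<le> 2 ^ k * (C + D)"
      using C[of x] D[of x] by (intro mult_left_mono add_mono) auto
    finally show "norm (f x) * (1 + (norm x)\<^sup>2) ^ k \<le> 2 ^ k * (C + D)" .
  qed
qed

lemma schwartz_integrable:
  fixes f :: "'a::euclidean_space \<Rightarrow> complex"
  shows "schwartz f \<Longrightarrow> integrable lborel f"
  using schwartz_decay[of f "DIM('a)"] schwartz_measurable[of f]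
  by (auto intro: integrable_rapid_decay)

lemma measurable_cis [measurable]: "cis \<in> borel_measurable borel"
  by (intro borel_measurable_continuous_onI continuous_intros)

lemma fourier_lborel:
  assumes [measurable]: "f \<in> borel_measurable borel"
  shows "fourier f \<xi> = (LINT x|lborel. f x * cis (- 2 * pi * (x \<bullet> \<xi>)))"
  unfolding fourier_def by (rule integral_completion) measurable

lemma norm_fourier_le:
  assumes "integrable lborel f"
  shows "norm (fourier f \<xi>) \<le> (LINT x|lborel. norm (f x))"
proof -
  have [measurable]: "f \<in> borel_measurable borel" using assms by (auto dest: borel_measurable_integrable)
  show ?thesis using integral_norm_bound[of lborel "\<lambda>x. f x * cis (- 2 * pi * (x \<bullet> \<xi>))"]
    by (simp add: fourier_lborel norm_mult)
qed

lemma continuous_fourier: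
  assumes "integrable lborel f"
  shows "continuous_on UNIV (fourier f)"
proof -
  have [measurable]: "f \<in> borel_measurable borel" using assms by (auto dest: borel_measurable_integrable)
  have "continuous_on UNIV (\<lambda>\<xi>. LINT x|lborel. f x * cis (- 2 * pi * (x \<bullet> \<xi>)))"
    by (rule continuous_on_integral_param[where w = "\<lambda>x. norm (f x)"])
      (use assms in \<open>auto intro!: continuous_intros simp: norm_mult\<close>)
  moreover have "fourier f = (\<lambda>\<xi>. LINT x|lborel. f x * cis (- 2 * pi * (x \<bullet> \<xi>)))"
    by (rule ext, rule fourier_lborel) measurable
  ultimately show ?thesis by (simp only:)
qed

lemma has_derivative_exp_complex:
  fixes g :: "'a::real_normed_vector \<Rightarrow> complex"
  assumes "(g has_derivative g') (at x)"
  shows "((\<lambda>x. exp (g x)) has_derivative (\<lambda>h. exp (g x) * g' h)) (at x)"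
  using has_derivative_compose[OF assms, of exp "(*) (exp (g x))"] DERIV_exp[of "g x"]
  by (simp add: has_field_derivative_def)

lemma has_derivative_cis_inner:
  "((\<lambda>x. cis (a * (x \<bullet> \<xi>))) has_derivative (\<lambda>h. cis (a * (x \<bullet> \<xi>)) * (\<i> * of_real (a * (h \<bullet> \<xi>))))) (at x)"
  unfolding cis_conv_exp
  by (intro has_derivative_exp_complex has_derivative_mult_right has_derivative_of_real
      has_derivative_inner_left has_derivative_ident)

text \<open>Integrate the derivative of the product of \<open>f\<close> with the character.\<close>

lemma fourier_partial_derivative:
  assumes "schwartz f" "b \<in> Basis"
  shows "fourier (iter_deriv [b] f) \<xi> = 2 * pi * \<i> * (\<xi> \<bullet> b) * fourier f \<xi>"
proof -
  let ?e = "\<lambda>x. cis (- 2 * pi * (x \<bullet> \<xi>))"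
  let ?D = "\<lambda>x h. f x * (?e x * (- \<i> * (2 * pi * (h \<bullet> \<xi>)))) + frechet_derivative f (at x) h * ?e x"
  have sm: "smooth f" using assms by (simp add: schwartz_def)
  note s' = schwartz_iter_deriv[OF assms(1), of "[b]"] 
  have s1: "schwartz (\<lambda>x. frechet_derivative f (at x) b)" using s' assms by simp
  note [measurable] = schwartz_measurable[OF assms(1)] schwartz_measurable[OF s1]
  have i0: "integrable lborel (\<lambda>x. f x * ?e x)"
    by (rule Bochner_Integration.integrable_bound[OF schwartz_integrable[OF assms(1)]])
      (auto simp: norm_mult)
  have i1: "integrable lborel (\<lambda>x. frechet_derivative f (at x) b * ?e x)"
    by (rule Bochner_Integration.integrable_bound[OF schwartz_integrable[OF s1]])
      (auto simp: norm_mult)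
  have eq: "?D x b = (- \<i> * (2 * pi * (b \<bullet> \<xi>))) * (f x * ?e x) + frechet_derivative f (at x) b * ?e x" for x
    by (simp add: algebra_simps)
  have i2: "integrable lborel (\<lambda>x. ?D x b)"
    unfolding eq using i0 i1 by (intro Bochner_Integration.integrable_add integrable_mult_right)
  have e: "(?e has_derivative (\<lambda>h. ?e x * (- \<i> * (2 * pi * (h \<bullet> \<xi>))))) (at x)" for x
    using has_derivative_cis_inner[of "- 2 * pi" \<xi> x] by simp
  have "(LINT x|lborel. ?D x b) = 0"
  proof (rule integral_directional_derivative[where F = "\<lambda>x. f x * ?e x" and F' = ?D and v = b, OF _ _ i0 i2])
    show "((\<lambda>x. f x * ?e x) has_derivative ?D x) (at x)" for x
      using has_derivative_mult[OF smooth_has_derivative[OF sm, of "[]"] e] by simp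
    show "continuous_on UNIV (\<lambda>x. ?D x b)"
      using schwartz_continuous[OF assms(1)] schwartz_continuous[OF s1]
      by (auto intro!: continuous_intros)
  qed
  also have "(LINT x|lborel. ?D x b) = (- \<i> * (2 * pi * (b \<bullet> \<xi>))) * (LINT x|lborel. f x * ?e x) +
      (LINT x|lborel. frechet_derivative f (at x) b * ?e x)"
    unfolding eq using i0 i1 by (subst Bochner_Integration.integral_add) auto
  finally show ?thesis by (simp add: fourier_lborel inner_commute algebra_simps)
qed

text \<open>The Fourier symbol of \<open>I - \<Delta>\<close>; its power \<open>s/2\<close> is the symbol in \<^const>\<open>bessel_op\<close>.\<close>

definition bessel_symbol :: "'a::euclidean_space \<Rightarrow> real" where
  "bessel_symbol \<xi> = 1 + 4 * pi\<^sup>2 * (norm \<xi>)\<^sup>2"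

text \<open>The operator \<open>I - \<Delta>\<close> on smooth functions.\<close>

definition helmholtz :: "('a::euclidean_space \<Rightarrow> complex) \<Rightarrow> 'a \<Rightarrow> complex" where
  "helmholtz f x = f x - (\<Sum>b\<in>Basis. iter_deriv [b, b] f x)"

lemma bessel_symbol_ge: "1 + (norm \<xi>)\<^sup>2 \<le> bessel_symbol \<xi>"
proof -
  have "1 \<le> 4 * pi\<^sup>2" using pi_gt3 power_mono[of 3 pi 2] by simp
  then show ?thesis by (simp add: bessel_symbol_def mult_left_le_one_le mult_le_cancel_right1)
qed

lemma bessel_symbol_ge1: "1 \<le> bessel_symbol \<xi>"
  by (simp add: bessel_symbol_def)

lemma bessel_symbol_pos: "0 < bessel_symbol \<xi>"
  using bessel_symbol_ge1[of \<xi>] by linarith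

lemma bessel_symbol_nonzero [simp]: "bessel_symbol \<xi> \<noteq> 0"
  using bessel_symbol_pos[of \<xi>] by linarith

lemma continuous_bessel_symbol: "continuous_on A bessel_symbol"
  unfolding bessel_symbol_def[abs_def] by (intro continuous_intros)

lemma schwartz_helmholtz:
  assumes "schwartz f" shows "schwartz (helmholtz f)"
  unfolding helmholtz_def[abs_def]
  by (intro schwartz_diff schwartz_sum schwartz_iter_deriv assms) auto

lemma schwartz_helmholtz_pow: "schwartz f \<Longrightarrow> schwartz ((helmholtz ^^ k) f)"
  by (induction k) (auto intro: schwartz_helmholtz)

lemma fourier_helmholtz:
  assumes "schwartz f"
  shows "fourier (helmholtz f) \<xi> = bessel_symbol \<xi> * fourier f \<xi>"
proof -
  let ?e = "\<lambda>x. cis (- 2 * pi * (x \<bullet> \<xi>))"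
  have int: "integrable lborel (\<lambda>x. g x * ?e x)" if "schwartz g" for g
    using schwartz_measurable[OF that]
    by (intro Bochner_Integration.integrable_bound[OF schwartz_integrable[OF that]])
      (auto simp: norm_mult)
  have bb: "fourier (iter_deriv [b, b] f) \<xi> = - 4 * pi\<^sup>2 * (\<xi> \<bullet> b)\<^sup>2 * fourier f \<xi>"
    if "b \<in> Basis" for b
  proof -
    have "fourier (iter_deriv [b] (iter_deriv [b] f)) \<xi> =
        2 * pi * \<i> * (\<xi> \<bullet> b) * (2 * pi * \<i> * (\<xi> \<bullet> b) * fourier f \<xi>)"
      using that assms by (simp only: fourier_partial_derivative schwartz_iter_deriv list.set
          insert_subset empty_subsetI simp_thms)
    also have "\<dots> = \<i> * \<i> * (4 * pi\<^sup>2 * (\<xi> \<bullet> b)\<^sup>2 * fourier f \<xi>)"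
      by (simp add: power2_eq_square algebra_simps del: i_squared)
    finally show ?thesis by simp
  qed
  have sb: "schwartz (iter_deriv [b, b] f)" if "b \<in> Basis" for b
    using that assms by (intro schwartz_iter_deriv) auto
  have "fourier (helmholtz f) \<xi> = (LINT x|lborel. f x * ?e x - (\<Sum>b\<in>Basis. iter_deriv [b, b] f x * ?e x))"
    by (simp add: fourier_lborel schwartz_measurable[OF schwartz_helmholtz[OF assms]] helmholtz_def
        left_diff_distrib sum_distrib_right)
  also have "\<dots> = (LINT x|lborel. f x * ?e x) - (\<Sum>b\<in>Basis. LINT x|lborel. iter_deriv [b, b] f x * ?e x)"
    using int sb assms
    by (subst Bochner_Integration.integral_diff)
      (auto simp del: iter_deriv.simps intro!: Bochner_Integration.integrable_sum)
  also have "\<dots> = fourier f \<xi> - (\<Sum>b\<in>Basis. fourier (iter_deriv [b, b] f) \<xi>)"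
    using assms sb by (simp add: fourier_lborel schwartz_measurable del: iter_deriv.simps)
  also have "\<dots> = fourier f \<xi> + complex_of_real (4 * pi\<^sup>2) * (\<Sum>b\<in>Basis. complex_of_real ((\<xi> \<bullet> b)\<^sup>2)) * fourier f \<xi>"
    by (simp add: bb sum_negf sum_distrib_left sum_distrib_right algebra_simps del: iter_deriv.simps)
  also have "(\<Sum>b\<in>Basis. complex_of_real ((\<xi> \<bullet> b)\<^sup>2)) = of_real ((norm \<xi>)\<^sup>2)"
    using euclidean_inner[of \<xi> \<xi>]
    by (simp only: of_real_sum[symmetric] power2_norm_eq_inner power2_eq_square)
      (simp add: power2_eq_square[symmetric] power2_norm_eq_inner)
  finally show ?thesis by (simp add: bessel_symbol_def algebra_simps)
qed

lemma fourier_helmholtz_pow: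
  "schwartz f \<Longrightarrow> fourier ((helmholtz ^^ k) f) \<xi> = bessel_symbol \<xi> ^ k * fourier f \<xi>"
  by (induction k) (auto simp: fourier_helmholtz schwartz_helmholtz_pow)

text \<open>The product on the left is the Fourier transform of a power of \<^const>\<open>helmholtz\<close> applied to \<open>f\<close>, which is
integrable.\<close>

lemma fourier_decay:
  assumes "schwartz f"
  shows "\<exists>C. \<forall>\<xi>. bessel_symbol \<xi> ^ k * norm (fourier f \<xi>) \<le> C"
proof -
  have "bessel_symbol \<xi> ^ k * norm (fourier f \<xi>) = norm (fourier ((helmholtz ^^ k) f) \<xi>)" for \<xi>
    using bessel_symbol_ge1[of \<xi>] assms by (simp add: fourier_helmholtz_pow norm_mult norm_power)
  then show ?thesis
    using norm_fourier_le[OF schwartz_integrable[OF schwartz_helmholtz_pow[OF assms]], of k]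
    by auto
qed

lemma integrable_symbol_fourier:
  assumes "schwartz f"
  shows "integrable lborel (\<lambda>\<xi>. complex_of_real (bessel_symbol \<xi> powr a) * fourier f \<xi>)"
proof -
  define K where "K = nat \<lceil>\<bar>a\<bar>\<rceil> + DIM('a)"
  obtain C where C: "\<And>\<xi>. bessel_symbol \<xi> ^ K * norm (fourier f \<xi>) \<le> C"
    using fourier_decay[OF assms] by blast
  have [measurable]: "fourier f \<in> borel_measurable borel"
    by (intro borel_measurable_continuous_onI continuous_fourier schwartz_integrable assms)
  have [measurable]: "(bessel_symbol :: 'a \<Rightarrow> real) \<in> borel_measurable borel"
    by (intro borel_measurable_continuous_onI continuous_bessel_symbol)
  show ?thesis
  proof (rule integrable_rapid_decay)
    fix \<xi> :: 'a
    note ge1 = bessel_symbol_ge1[of \<xi>]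
    have "bessel_symbol \<xi> powr a \<le> bessel_symbol \<xi> powr real (nat \<lceil>\<bar>a\<bar>\<rceil>)"
      using ge1 by (intro powr_mono) linarith+
    also have "\<dots> = bessel_symbol \<xi> ^ nat \<lceil>\<bar>a\<bar>\<rceil>" using ge1 by (subst powr_realpow) auto
    finally have 1: "bessel_symbol \<xi> powr a \<le> bessel_symbol \<xi> ^ nat \<lceil>\<bar>a\<bar>\<rceil>" .
    have "norm (complex_of_real (bessel_symbol \<xi> powr a) * fourier f \<xi>) * (1 + (norm \<xi>)\<^sup>2) ^ DIM('a) \<le>
        (bessel_symbol \<xi> ^ nat \<lceil>\<bar>a\<bar>\<rceil> * norm (fourier f \<xi>)) * bessel_symbol \<xi> ^ DIM('a)"
      unfolding norm_mult using ge1 1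
      by (intro mult_mono mult_right_mono power_mono bessel_symbol_ge) auto
    also have "\<dots> = bessel_symbol \<xi> ^ K * norm (fourier f \<xi>)"
      by (simp add: K_def power_add mult_ac)
    finally show "norm (complex_of_real (bessel_symbol \<xi> powr a) * fourier f \<xi>) * (1 + (norm \<xi>)\<^sup>2) ^ DIM('a) \<le> C"
      using C[of \<xi>] by linarith
  qed measurable
qed

lemma integrable_fourier: "schwartz f \<Longrightarrow> integrable lborel (fourier f)"
  using integrable_symbol_fourier[of f 0] by simp

section \<open>Gaussians, the heat kernel and Fourier inversion\<close>

text \<open>A power of the inequality \<open>m (1 + t) \<le> 1 + c' t \<le> exp (c' t)\<close>.\<close>

lemma polynomial_exp_bounded:
  fixes c :: real
  assumes "c > 0"
  shows "\<exists>C. \<forall>t\<ge>0. (1 + t) ^ k * exp (- c * t) \<le> C"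
proof -
  define c' where "c' = c / Suc k"
  define m where "m = min 1 c'"
  have "m > 0" using assms by (simp add: m_def c'_def)
  show ?thesis
  proof (intro exI[of _ "1 / m ^ Suc k"] allI impI)
    fix t :: real assume "t \<ge> 0"
    have "m * (1 + t) = m + m * t" by (simp add: algebra_simps)
    also have "\<dots> \<le> 1 + c' * t"
      using \<open>t \<ge> 0\<close> by (intro add_mono mult_right_mono) (auto simp: m_def)
    also have "\<dots> \<le> exp (c' * t)" by (rule exp_ge_add_one_self)
    finally have "(m * (1 + t)) ^ Suc k \<le> exp (c' * t) ^ Suc k"
      using \<open>m > 0\<close> \<open>t \<ge> 0\<close> by (intro power_mono) auto
    also have "\<dots> = exp (c * t)"
      by (simp only: exp_of_nat_mult[symmetric] c'_def) simp
    finally have 1: "m ^ Suc k * (1 + t) ^ Suc k \<le> exp (c * t)" by (simp only: power_mult_distrib)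
    have "(1 + t) ^ k \<le> (1 + t) ^ Suc k" using \<open>t \<ge> 0\<close> by (intro power_increasing) auto
    then have "m ^ Suc k * (1 + t) ^ k \<le> exp (c * t)"
      using 1 \<open>m > 0\<close> by (meson mult_left_mono order_trans zero_le_power less_imp_le)
    then show "(1 + t) ^ k * exp (- c * t) \<le> 1 / m ^ Suc k"
      using \<open>m > 0\<close> by (simp add: exp_minus field_simps)
  qed
qed

text \<open>The parameter \<open>w\<close> is complex: its imaginary part is a quadratic phase. The real parameters
give the heat kernel, the complex ones the test functions for the lower bound.\<close>

definition gaussian :: "complex \<Rightarrow> 'a::euclidean_space \<Rightarrow> complex" where
  "gaussian w x = exp (- (of_real pi * w * of_real (x \<bullet> x)))"

lemma norm_gaussian: "norm (gaussian w x) = exp (- (pi * Re w * (norm x)\<^sup>2))"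
  by (simp add: gaussian_def power2_norm_eq_inner)

lemma continuous_gaussian: "continuous_on A (gaussian w)"
  unfolding gaussian_def[abs_def] by (intro continuous_intros)

lemma measurable_gaussian [measurable]: "gaussian w \<in> borel_measurable borel"
  by (intro borel_measurable_continuous_onI continuous_gaussian)

lemma integrable_gaussian_bound:
  fixes g :: "'a::euclidean_space \<Rightarrow> complex"
  assumes "c > 0" and g: "g \<in> borel_measurable borel"
    and "\<And>x. norm (g x) \<le> C * (1 + (norm x)\<^sup>2) ^ k * exp (- c * (norm x)\<^sup>2)"
  shows "integrable lborel g"
proof -
  obtain D where D: "\<And>t. t \<ge> 0 \<Longrightarrow> (1 + t) ^ (k + DIM('a)) * exp (- c * t) \<le> D"
    using polynomial_exp_bounded[OF assms(1), of "k + DIM('a)"] by blast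
  show ?thesis
  proof (rule integrable_rapid_decay[OF g])
    fix x
    have "norm (g x) * (1 + (norm x)\<^sup>2) ^ DIM('a) \<le>
        (C * (1 + (norm x)\<^sup>2) ^ k * exp (- c * (norm x)\<^sup>2)) * (1 + (norm x)\<^sup>2) ^ DIM('a)"
      by (intro mult_right_mono assms) auto
    also have "\<dots> \<le> (\<bar>C\<bar> * (1 + (norm x)\<^sup>2) ^ k * exp (- c * (norm x)\<^sup>2)) * (1 + (norm x)\<^sup>2) ^ DIM('a)"
      by (intro mult_right_mono) auto
    also have "\<dots> = \<bar>C\<bar> * ((1 + (norm x)\<^sup>2) ^ (k + DIM('a)) * exp (- c * (norm x)\<^sup>2))"
      by (simp add: power_add)
    also have "\<dots> \<le> \<bar>C\<bar> * D" by (intro mult_left_mono D) auto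
    finally show "norm (g x) * (1 + (norm x)\<^sup>2) ^ DIM('a) \<le> \<bar>C\<bar> * D" .
  qed
qed

lemma integrable_gaussian:
  assumes "Re w > 0"
  shows "integrable lborel (gaussian w)"
  by (rule integrable_gaussian_bound[of "pi * Re w" _ 1 0]) (use assms in \<open>auto simp: norm_gaussian\<close>)

lemma norm_le_one_plus_power2: "norm x \<le> 1 + (norm x)\<^sup>2"
  using zero_le_power2[of "norm x - 1"] by (simp add: power2_diff algebra_simps) (smt (verit) norm_ge_zero)

text \<open>The contour shift. For real \<open>\<xi>\<close> the integrand of the Fourier transform at \<open>\<xi>\<close> is, up to a constant
factor, the Gaussian moved by the complex vector \<open>(i / w) \<xi>\<close>. Along the path \<open>s (i / w) \<xi>\<close> the
\<open>s\<close>-derivative of the integrand is \<open>i / w\<close> times its derivative in the real direction \<open>\<xi>\<close>, whose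
integral vanishes; so the integral is the same at both ends.\<close>

lemma fourier_gaussian:
  fixes \<xi> :: "'a::euclidean_space"
  assumes w: "Re w > 0"
  shows "fourier (gaussian w) \<xi> = (LINT x|lborel. gaussian w (x :: 'a)) * gaussian (1 / w) \<xi>"
proof -
  define q where "q = Re (1 / w) * (pi * (\<xi> \<bullet> \<xi>))"
  have "w \<noteq> 0" using w by auto
  \<comment> \<open>\<open>F s\<close> is the Gaussian at the complex point \<open>x + s (i / w) \<xi>\<close>; \<open>P\<close> and \<open>Q\<close> are its logarithmic
derivatives in \<open>s\<close> and in \<open>x\<close>.\<close>
  define F where "F s x = exp (- (of_real pi * w * of_real (x \<bullet> x)) - 2 * pi * \<i> * of_real (s * (x \<bullet> \<xi>))
      + of_real (s\<^sup>2) * (of_real (pi * (\<xi> \<bullet> \<xi>)) / w))" for s :: real and x :: 'a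
  define P where "P s x = - 2 * pi * \<i> * of_real (x \<bullet> \<xi>) + 2 * of_real s * (of_real (pi * (\<xi> \<bullet> \<xi>)) / w)"
    for s :: real and x :: 'a
  define Q where "Q s x h = - (of_real pi * w * of_real (2 * (x \<bullet> h))) - 2 * pi * \<i> * of_real (s * (h \<bullet> \<xi>))"
    for s :: real and x h :: 'a
  have PQ: "P s x = \<i> / w * Q s x \<xi>" for s x
    using \<open>w \<noteq> 0\<close> by (simp add: P_def Q_def field_simps)
  have contF: "continuous_on UNIV (\<lambda>z. F (fst z) (snd z))"
    unfolding F_def by (intro continuous_intros \<open>w \<noteq> 0\<close>)
  have contFs: "continuous_on UNIV (F s)" for s
    unfolding F_def[abs_def] by (intro continuous_intros \<open>w \<noteq> 0\<close>)
  have normF: "norm (F s x) \<le> exp \<bar>q\<bar> * exp (- (pi * Re w) * (norm x)\<^sup>2)" if "s \<in> {0..1}" for s x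
  proof -
    have "norm (F s x) = exp (s\<^sup>2 * q) * exp (- (pi * Re w) * (norm x)\<^sup>2)"
      by (simp add: F_def q_def exp_add[symmetric] power2_norm_eq_inner Re_divide_of_real
          divide_inverse mult_ac)
    moreover have "s\<^sup>2 * q \<le> \<bar>q\<bar>"
    proof -
      have "s\<^sup>2 * q \<le> s\<^sup>2 * \<bar>q\<bar>" by (intro mult_left_mono) auto
      also have "\<dots> \<le> 1 * \<bar>q\<bar>" using that by (intro mult_right_mono) (auto simp: power_le_one)
      finally show ?thesis by simp
    qed
    ultimately show ?thesis by simp
  qed
  have normP: "norm (P s x) \<le> norm (1 / w) * 2 * pi * ((norm \<xi>)\<^sup>2 + norm \<xi> * norm w) * (1 + (norm x)\<^sup>2)"
    if "s \<in> {0..1}" for s x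
  proof -
    have "norm (P s x) \<le> 2 * pi * \<bar>x \<bullet> \<xi>\<bar> + 2 * s * (pi * (norm \<xi>)\<^sup>2 / norm w)"
      unfolding P_def using that
      by (intro order_trans[OF norm_triangle_ineq] add_mono)
        (auto simp: norm_mult norm_divide power2_norm_eq_inner)
    also have "\<dots> \<le> 2 * pi * ((1 + (norm x)\<^sup>2) * norm \<xi>) + 2 * 1 * (pi * (norm \<xi>)\<^sup>2 / norm w) * (1 + (norm x)\<^sup>2)"
    proof (intro add_mono mult_left_mono)
      show "\<bar>x \<bullet> \<xi>\<bar> \<le> (1 + (norm x)\<^sup>2) * norm \<xi>"
        using Cauchy_Schwarz_ineq2[of x \<xi>] mult_right_mono[OF norm_le_one_plus_power2[of x] norm_ge_zero[of \<xi>]]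
        by linarith
      have "2 * s * (pi * (norm \<xi>)\<^sup>2 / norm w) * 1 \<le> 2 * 1 * (pi * (norm \<xi>)\<^sup>2 / norm w) * (1 + (norm x)\<^sup>2)"
        using that by (intro mult_mono) auto
      then show "2 * s * (pi * (norm \<xi>)\<^sup>2 / norm w) \<le> 2 * 1 * (pi * (norm \<xi>)\<^sup>2 / norm w) * (1 + (norm x)\<^sup>2)"
        by simp
    qed auto
    also have "\<dots> = norm (1 / w) * 2 * pi * ((norm \<xi>)\<^sup>2 + norm \<xi> * norm w) * (1 + (norm x)\<^sup>2)"
      using \<open>w \<noteq> 0\<close> by (simp add: norm_divide field_simps)
    finally show ?thesis .
  qed
  define K where "K = exp \<bar>q\<bar> * (norm (1 / w) * 2 * pi * ((norm \<xi>)\<^sup>2 + norm \<xi> * norm w))"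
  have normPF: "norm (P s x * F s x) \<le> K * (1 + (norm x)\<^sup>2) ^ 1 * exp (- (pi * Re w) * (norm x)\<^sup>2)"
    if "s \<in> {0..1}" for s x
    using mult_mono[OF normP[OF that, of x] normF[OF that, of x]]
    by (simp add: norm_mult K_def mult_ac)
  have contPF: "continuous_on UNIV (\<lambda>z. P (fst z) (snd z) * F (fst z) (snd z))"
    unfolding P_def by (intro continuous_intros contF \<open>w \<noteq> 0\<close>)
  have contPFs: "continuous_on UNIV (\<lambda>x. P s x * F s x)" for s
    unfolding P_def by (intro continuous_intros contFs \<open>w \<noteq> 0\<close>)
  have intF: "integrable lborel (F s)" if "s \<in> {0..1}" for s
    by (rule integrable_gaussian_bound[of "pi * Re w" _ "exp \<bar>q\<bar>" 0])
      (use w normF[OF that] in \<open>auto intro!: borel_measurable_continuous_onI contFs\<close>)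
  have intPF: "integrable lborel (\<lambda>x. P s x * F s x)" if "s \<in> {0..1}" for s
    by (rule integrable_gaussian_bound[OF _ borel_measurable_continuous_onI[OF contPFs] normPF[OF that]])
      (use w in auto)
  have intG: "integrable lborel (\<lambda>x::'a. K * (1 + (norm x)\<^sup>2) ^ 1 * exp (- (pi * Re w) * (norm x)\<^sup>2))"
  proof -
    have "integrable lborel (\<lambda>x::'a. complex_of_real (K * (1 + (norm x)\<^sup>2) ^ 1 * exp (- (pi * Re w) * (norm x)\<^sup>2)))"
    proof (rule integrable_gaussian_bound[of "pi * Re w" _ K 1])
      show "norm (complex_of_real (K * (1 + (norm x)\<^sup>2) ^ 1 * exp (- (pi * Re w) * (norm x)\<^sup>2))) \<le>
          K * (1 + (norm x)\<^sup>2) ^ 1 * exp (- (pi * Re w) * (norm x)\<^sup>2)" for x :: 'a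
        by (subst norm_of_real) (simp add: K_def)
    qed (use w in auto)
    then show ?thesis by (simp only: complex_of_real_integrable_eq)
  qed
  have "(LINT x|lborel. F 1 x) - (LINT x|lborel. F 0 x) = 0"
  proof (rule integral_param_FTC[where F' = "\<lambda>s x. P s x * F s x"])
    fix s :: real and x :: 'a
    assume s: "s \<in> {0..1}"
    have "((\<lambda>s. F s x) has_derivative (\<lambda>h. F s x * (- (2 * pi * \<i> * of_real (h * (x \<bullet> \<xi>)))
        + of_real (2 * s * h) * (of_real (pi * (\<xi> \<bullet> \<xi>)) / w)))) (at s)"
      unfolding F_def
      by (rule has_derivative_exp_complex)
        (auto intro!: derivative_eq_intros simp: \<open>w \<noteq> 0\<close> fun_eq_iff algebra_simps)
    then show "((\<lambda>s. F s x) has_vector_derivative P s x * F s x) (at s)"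
      unfolding has_vector_derivative_def
      by (rule has_derivative_eq_rhs) (simp add: P_def fun_eq_iff scaleR_conv_of_real algebra_simps)
    have "(\<integral>\<^sup>+x. ennreal (norm (P s x * F s x)) \<partial>lborel) \<le>
        (\<integral>\<^sup>+x. ennreal (K * (1 + (norm (x :: 'a))\<^sup>2) ^ 1 * exp (- (pi * Re w) * (norm x)\<^sup>2)) \<partial>lborel)"
      by (intro nn_integral_mono ennreal_leI normPF s)
    also have "\<dots> = ennreal (LINT x|lborel. K * (1 + (norm (x :: 'a))\<^sup>2) ^ 1 * exp (- (pi * Re w) * (norm x)\<^sup>2))"
      by (rule nn_integral_eq_integral[OF intG]) (auto simp: K_def)
    finally show "(\<integral>\<^sup>+x. ennreal (norm (P s x * F s x)) \<partial>lborel) \<le> \<dots>" .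
    have QP: "F s x * Q s x \<xi> = (w / \<i>) * (P s x * F s x)" for x
      using \<open>w \<noteq> 0\<close> by (simp add: PQ)
    have "(LINT x|lborel. F s x * Q s x \<xi>) = 0"
    proof (rule integral_directional_derivative[where F = "F s" and F' = "\<lambda>x h. F s x * Q s x h" and v = \<xi>])
      show "(F s has_derivative (\<lambda>h. F s x * Q s x h)) (at x)" for x
        unfolding F_def[abs_def] Q_def
        by (rule has_derivative_exp_complex)
          (auto intro!: derivative_eq_intros simp: \<open>w \<noteq> 0\<close> fun_eq_iff inner_commute algebra_simps)
      show "integrable lborel (F s)" by (rule intF[OF s])
      show "continuous_on UNIV (\<lambda>x. F s x * Q s x \<xi>)"
        unfolding QP by (rule continuous_on_mult_left[OF contPFs])
      show "integrable lborel (\<lambda>x. F s x * Q s x \<xi>)"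
        unfolding QP by (intro integrable_mult_right intPF s)
    qed
    then show "(LINT x|lborel. P s x * F s x) = 0"
      using \<open>w \<noteq> 0\<close> by (simp add: QP)
  qed (auto intro: contPF intF)
  moreover have "(LINT x|lborel. F 1 x) = fourier (gaussian w) \<xi> / gaussian (1 / w) \<xi>"
  proof -
    have "F 1 x = gaussian w x * cis (- 2 * pi * (x \<bullet> \<xi>)) / gaussian (1 / w) \<xi>" for x
      by (simp add: F_def gaussian_def cis_conv_exp exp_add[symmetric] exp_minus[symmetric]
          divide_inverse algebra_simps)
    then show ?thesis by (simp add: fourier_lborel)
  qed
  moreover have "F 0 = gaussian w" by (simp add: F_def gaussian_def fun_eq_iff)
  ultimately show ?thesis by (simp add: gaussian_def field_simps)
qed

text \<open>The Gaussian is a product of one-dimensional ones, and those are normal densities of variance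
\<open>1 / (2 \<pi> c)\<close>.\<close>

lemma nn_integral_gaussian:
  assumes c: "c > 0"
  shows "(\<integral>\<^sup>+x. ennreal (exp (- (pi * c * ((x :: 'a::euclidean_space) \<bullet> x)))) \<partial>lborel) =
      ennreal (c powr (- real DIM('a) / 2))" (is "?I = _")
proof -
  have 1: "(\<integral>\<^sup>+t. ennreal (exp (- (pi * c * t\<^sup>2))) \<partial>lborel) = ennreal (c powr (- (1 / 2)))"
  proof -
    define \<sigma> where "\<sigma> = 1 / sqrt (2 * pi * c)"
    have \<sigma>: "\<sigma> > 0" "\<sigma>\<^sup>2 = 1 / (2 * pi * c)"
      using c by (auto simp: \<sigma>_def power_divide)
    have "exp (- (pi * c * t\<^sup>2)) = c powr (- (1 / 2)) * normal_density 0 \<sigma> t" for t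
      using c by (simp add: normal_density_def \<sigma> powr_minus powr_half_sqrt real_sqrt_divide field_simps)
    then have "(\<integral>\<^sup>+t. ennreal (exp (- (pi * c * t\<^sup>2))) \<partial>lborel) =
        ennreal (c powr (- (1 / 2))) * (\<integral>\<^sup>+t. ennreal (normal_density 0 \<sigma> t) \<partial>lborel)"
      by (simp add: ennreal_mult nn_integral_cmult)
    also have "(\<integral>\<^sup>+t. ennreal (normal_density 0 \<sigma> t) \<partial>lborel) = ennreal (LINT t|lborel. normal_density 0 \<sigma> t)"
      by (intro nn_integral_eq_integral) (auto simp: \<sigma>)
    finally show ?thesis using \<sigma> by simp
  qed
  have "exp (- (pi * c * (x \<bullet> x))) = (\<Prod>b\<in>Basis. exp (- (pi * c * (x \<bullet> b)\<^sup>2)))" for x :: 'a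
    by (subst exp_sum[symmetric])
      (auto simp: euclidean_inner[of x x] sum_distrib_left sum_negf power2_eq_square)
  then have "?I = (\<integral>\<^sup>+x. (\<Prod>b\<in>Basis. ennreal (exp (- (pi * c * ((x::'a) \<bullet> b)\<^sup>2)))) \<partial>lborel)"
    by (simp add: prod_ennreal)
  also have "\<dots> = (\<Prod>b\<in>(Basis :: 'a set). \<integral>\<^sup>+t. ennreal (exp (- (pi * c * t\<^sup>2))) \<partial>lborel)"
    by (rule nn_integral_lborel_prod) auto
  also have "\<dots> = ennreal ((c powr (- (1 / 2))) ^ DIM('a))"
    by (simp add: 1 ennreal_power)
  also have "(c powr (- (1 / 2))) ^ DIM('a) = c powr (- real DIM('a) / 2)"
    using c by (simp add: powr_realpow[symmetric] powr_powr)
  finally show ?thesis .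
qed

lemma integral_gaussian_real:
  assumes "c > 0"
  shows "(LINT x|lborel. gaussian (of_real c) (x::'a::euclidean_space)) =
    complex_of_real (c powr (- real DIM('a) / 2))"
proof -
  have eq: "gaussian (of_real c) x = of_real (exp (- (pi * c * (x \<bullet> x))))" for x :: 'a
    by (simp add: gaussian_def exp_of_real[symmetric])
  have "(LINT x|lborel. exp (- (pi * c * ((x :: 'a) \<bullet> x)))) = c powr (- real DIM('a) / 2)"
    by (rule integral_eq_nn_integral[THEN trans]) (auto simp: nn_integral_gaussian assms)
  then show ?thesis unfolding eq integral_complex_of_real by simp
qed

text \<open>The convolution kernel of \<open>e\<^bsup>-t(I - \<Delta>)\<^esup>\<close>, that is, the heat kernel damped by \<open>e\<^bsup>-t\<^esup>\<close>.\<close>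

definition bessel_heat :: "real \<Rightarrow> 'a::euclidean_space \<Rightarrow> real" where
  "bessel_heat t y =
     exp (- t) * (4 * pi * t) powr (- real DIM('a) / 2) * exp (- ((y \<bullet> y) / (4 * t)))"

lemma bessel_heat_nonneg: "0 \<le> bessel_heat t y"
  by (simp add: bessel_heat_def)

lemma measurable_bessel_heat [measurable]: "bessel_heat t \<in> borel_measurable borel"
  unfolding bessel_heat_def[abs_def] by measurable

lemma nn_integral_bessel_heat:
  assumes "t > 0"
  shows "(\<integral>\<^sup>+y. ennreal (bessel_heat t (y :: 'a::euclidean_space)) \<partial>lborel) = ennreal (exp (- t))"
proof -
  define c where "c = 1 / (4 * pi * t)"
  have c: "c > 0" using assms by (simp add: c_def)
  have "bessel_heat t y = (exp (- t) * (4 * pi * t) powr (- real DIM('a) / 2)) * exp (- (pi * c * (y \<bullet> y)))" for y :: 'a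
    using assms by (simp add: bessel_heat_def c_def)
  then have "(\<integral>\<^sup>+y. ennreal (bessel_heat t (y :: 'a)) \<partial>lborel) =
      ennreal (exp (- t) * (4 * pi * t) powr (- real DIM('a) / 2)) *
      (\<integral>\<^sup>+y. ennreal (exp (- (pi * c * ((y :: 'a) \<bullet> y)))) \<partial>lborel)"
    by (simp add: ennreal_mult nn_integral_cmult)
  also have "\<dots> = ennreal (exp (- t) * (4 * pi * t) powr (- real DIM('a) / 2) * c powr (- real DIM('a) / 2))"
    using c by (simp add: nn_integral_gaussian ennreal_mult[symmetric])
  also have "exp (- t) * (4 * pi * t) powr (- real DIM('a) / 2) * c powr (- real DIM('a) / 2) = exp (- t)"
    using assms by (simp add: c_def mult.assoc powr_mult[symmetric])
  finally show ?thesis .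
qed

lemma integral_bessel_symbol_heat:
  fixes y :: "'a::euclidean_space"
  assumes "t > 0"
  shows "(LINT \<xi>|lborel. of_real (exp (- t * bessel_symbol \<xi>)) * cis (2 * pi * (y \<bullet> \<xi>))) =
    complex_of_real (bessel_heat t y)"
proof -
  define c where "c = 4 * pi * t"
  have c: "c > 0" using assms by (simp add: c_def)
  have eq: "of_real (exp (- t * bessel_symbol \<xi>)) * cis (2 * pi * (y \<bullet> \<xi>)) =
      of_real (exp (- t)) * (gaussian (of_real c) \<xi> * cis (- 2 * pi * (\<xi> \<bullet> (- y))))" for \<xi>
    by (simp add: bessel_symbol_def gaussian_def c_def exp_of_real[symmetric] exp_add[symmetric]
        power2_norm_eq_inner power2_eq_square[of pi] inner_commute algebra_simps)
  have "(LINT \<xi>|lborel. of_real (exp (- t * bessel_symbol \<xi>)) * cis (2 * pi * (y \<bullet> \<xi>))) =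
      of_real (exp (- t)) * fourier (gaussian (of_real c)) (- y)"
    unfolding eq by (simp add: fourier_lborel)
  also have "\<dots> = of_real (exp (- t)) * (of_real (c powr (- real DIM('a) / 2)) * gaussian (1 / of_real c) (- y))"
    using c by (simp add: fourier_gaussian integral_gaussian_real)
  also have "gaussian (1 / of_real c) (- y) = of_real (exp (- ((y \<bullet> y) / (4 * t))))"
    using assms by (simp add: gaussian_def exp_of_real[symmetric] c_def)
  finally show ?thesis by (simp add: bessel_heat_def c_def)
qed

lemma integrable_exp_bessel_symbol:
  assumes "t > 0"
  shows "integrable lborel (\<lambda>\<xi>::'a::euclidean_space. exp (- t * bessel_symbol \<xi>))"
proof -
  have "integrable lborel (\<lambda>\<xi>::'a. complex_of_real (exp (- t * bessel_symbol \<xi>)))"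
    by (rule integrable_gaussian_bound[of "4 * pi\<^sup>2 * t" _ 1 0])
      (use assms in \<open>auto simp: bessel_symbol_def exp_add[symmetric] algebra_simps\<close>)
  then show ?thesis by (simp only: complex_of_real_integrable_eq)
qed

text \<open>The heat semigroup is the Fourier multiplier with symbol \<open>exp (- t (1 + 4 \<pi>\<^sup>2 |\<xi>|\<^sup>2))\<close>. The
Gaussian factor makes the double integral absolutely convergent.\<close>

lemma heat_convolution_fourier:
  fixes f :: "'a::euclidean_space \<Rightarrow> complex"
  assumes "t > 0" and f: "integrable lborel f" and cont: "continuous_on UNIV f"
  shows "(LINT y|lborel. f y * of_real (bessel_heat t (x - y))) =
    (LINT \<xi>|lborel. of_real (exp (- t * bessel_symbol \<xi>)) * fourier f \<xi> * cis (2 * pi * (x \<bullet> \<xi>)))"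
proof -
  let ?E = "\<lambda>\<xi>::'a. exp (- t * bessel_symbol \<xi>)"
  let ?g = "\<lambda>y \<xi>. f y * (of_real (?E \<xi>) * cis (2 * pi * ((x - y) \<bullet> \<xi>)))"
  have [measurable]: "f \<in> borel_measurable borel" using f by (auto dest: borel_measurable_integrable)
  have "(\<integral>\<^sup>+y. \<integral>\<^sup>+\<xi>. ennreal (norm (?g y \<xi>)) \<partial>lborel \<partial>lborel) =
      (\<integral>\<^sup>+y. ennreal (norm (f y)) * (\<integral>\<^sup>+\<xi>. ennreal (?E \<xi>) \<partial>lborel) \<partial>lborel)"
    using integrable_exp_bessel_symbol[OF assms(1), where ?'a = 'a]
    by (simp add: norm_mult ennreal_mult nn_integral_cmult)
  also have "\<dots> = (\<integral>\<^sup>+y. ennreal (norm (f y)) \<partial>lborel) * (\<integral>\<^sup>+\<xi>. ennreal (?E \<xi>) \<partial>lborel)"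
    by (simp add: nn_integral_multc)
  also have "\<dots> < \<infinity>"
    using f integrable_exp_bessel_symbol[OF assms(1), where ?'a = 'a]
    by (auto simp: integrable_iff_bounded ennreal_mult_less_top)
  finally have fin: "(\<integral>\<^sup>+y. \<integral>\<^sup>+\<xi>. ennreal (norm (?g y \<xi>)) \<partial>lborel \<partial>lborel) < \<infinity>" .
  have "(LINT y|lborel. f y * of_real (bessel_heat t (x - y))) = (LINT y|lborel. LINT \<xi>|lborel. ?g y \<xi>)"
    by (simp add: integral_bessel_symbol_heat[OF assms(1), symmetric])
  also have "\<dots> = (LINT \<xi>|lborel. LINT y|lborel. ?g y \<xi>)"
  proof (rule Fubini_lborel[OF _ fin], rule measurable_pair_continuous)
    show "continuous_on UNIV (\<lambda>z. ?g (fst z) (snd z))"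
      by (intro continuous_intros continuous_on_compose2[OF cont]
          continuous_on_compose2[OF continuous_bessel_symbol[of UNIV]]) auto
  qed
  also have "\<dots> = (LINT \<xi>|lborel. of_real (?E \<xi>) * fourier f \<xi> * cis (2 * pi * (x \<bullet> \<xi>)))"
  proof (intro Bochner_Integration.integral_cong refl)
    fix \<xi> :: 'a
    have "?g y \<xi> = (of_real (?E \<xi>) * cis (2 * pi * (x \<bullet> \<xi>))) * (f y * cis (- 2 * pi * (y \<bullet> \<xi>)))" for y
      by (simp add: inner_diff_left cis_mult[symmetric] algebra_simps)
        (simp add: cis_mult algebra_simps)
    then show "(LINT y|lborel. ?g y \<xi>) = of_real (?E \<xi>) * fourier f \<xi> * cis (2 * pi * (x \<bullet> \<xi>))"
      by (simp only: integral_mult_right_zero) (simp add: fourier_lborel)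
  qed
  finally show ?thesis .
qed

text \<open>Let \<open>t \<rightarrow> 0\<close> in \<open>heat_convolution_fourier\<close>: the right-hand side tends to the inversion integral, and
on the left the heat kernel is an approximate identity.\<close>

theorem fourier_inversion:
  fixes f :: "'a::euclidean_space \<Rightarrow> complex"
  assumes f: "integrable lborel f" and cont: "continuous_on UNIV f" and bound: "\<And>x. norm (f x) \<le> B"
    and ff: "integrable lborel (fourier f)"
  shows "f x = (LINT \<xi>|lborel. fourier f \<xi> * cis (2 * pi * (x \<bullet> \<xi>)))"
proof -
  define t where "t n = inverse (real (Suc n))" for n
  have t: "t n > 0" for n by (simp add: t_def)
  have t0: "t \<longlonglongrightarrow> 0" unfolding t_def[abs_def] by (rule LIMSEQ_inverse_real_of_nat)
  have [measurable]: "f \<in> borel_measurable borel" "fourier f \<in> borel_measurable borel"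
    using f ff by (auto dest: borel_measurable_integrable)
  have [measurable]: "(bessel_symbol :: 'a \<Rightarrow> real) \<in> borel_measurable borel"
    by (intro borel_measurable_continuous_onI continuous_bessel_symbol)
  let ?R = "\<lambda>n. LINT \<xi>|lborel. of_real (exp (- t n * bessel_symbol \<xi>)) * fourier f \<xi> * cis (2 * pi * (x \<bullet> \<xi>))"
  have "?R \<longlonglongrightarrow> (LINT \<xi>|lborel. of_real (exp (- 0 * bessel_symbol \<xi>)) * fourier f \<xi> * cis (2 * pi * (x \<bullet> \<xi>)))"
  proof (rule integral_dominated_convergence[where w = "\<lambda>\<xi>. norm (fourier f \<xi>)"])
    show "AE \<xi> in lborel. (\<lambda>n. of_real (exp (- t n * bessel_symbol \<xi>)) * fourier f \<xi> * cis (2 * pi * (x \<bullet> \<xi>)))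
        \<longlonglongrightarrow> of_real (exp (- 0 * bessel_symbol \<xi>)) * fourier f \<xi> * cis (2 * pi * (x \<bullet> \<xi>))"
      by (intro AE_I2 tendsto_intros t0)
    show "AE \<xi> in lborel. norm (of_real (exp (- t n * bessel_symbol \<xi>)) * fourier f \<xi> * cis (2 * pi * (x \<bullet> \<xi>)))
        \<le> norm (fourier f \<xi>)" for n
      using t[of n] by (intro AE_I2) (auto simp: norm_mult intro!: mult_left_le_one_le mult_nonneg_nonneg less_imp_le[OF bessel_symbol_pos])
  qed (use ff in auto)
  moreover have "?R \<longlonglongrightarrow> f x"
  proof -
    \<comment> \<open>The substitution \<open>y = x - r v\<close> turns the heat kernel into the fixed Gaussian with \<open>w = 1\<close>.\<close>
    define r where "r n = sqrt (4 * pi * t n)" for n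
    have r: "r n > 0" "(r n)\<^sup>2 = 4 * pi * t n" for n using t[of n] by (auto simp: r_def)
    have r0: "r \<longlonglongrightarrow> 0" using tendsto_real_sqrt[OF tendsto_mult_left[OF t0, of "4 * pi"]]
      by (simp add: r_def[abs_def])
    have "?R n = of_real (exp (- t n)) * (LINT v|lborel. f (x - r n *\<^sub>R v) * gaussian 1 v)" for n
    proof -
      have heat: "bessel_heat (t n) (r n *\<^sub>R v) = exp (- t n) * inverse (r n ^ DIM('a)) * exp (- (pi * (v \<bullet> v)))" for v :: 'a
      proof -
        have "(4 * pi * t n) powr (- real DIM('a) / 2) = (r n) powr (2 * (- real DIM('a) / 2))"
          using r(1)[of n] by (simp only: r(2)[symmetric] powr_powr[symmetric]) simp
        also have "\<dots> = inverse (r n ^ DIM('a))"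
          using r(1)[of n] by (simp add: powr_minus powr_realpow)
        finally show ?thesis using r[of n] t[of n]
          by (simp add: bessel_heat_def power2_eq_square[symmetric] mult.assoc[symmetric])
      qed
      have "?R n = (LINT y|lborel. f y * of_real (bessel_heat (t n) (x - y)))"
        by (rule heat_convolution_fourier[OF t f cont, symmetric])
      also have "\<dots> = (LINT u|lborel. f (x - u) * of_real (bessel_heat (t n) u))"
        using integral_lborel_reflect[of "\<lambda>y. f y * of_real (bessel_heat (t n) (x - y))" x] by simp
      also have "\<dots> = of_real (r n ^ DIM('a)) *
          (LINT v|lborel. f (x - r n *\<^sub>R v) * of_real (bessel_heat (t n) (r n *\<^sub>R v)))"
        using integral_lborel_affine[OF _ r(1)[of n], of "\<lambda>u. f (x - u) * of_real (bessel_heat (t n) u)" 0]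
        by simp
      also have "\<dots> = of_real (r n ^ DIM('a)) * (LINT v|lborel. f (x - r n *\<^sub>R v) *
          of_real (exp (- t n) * inverse (r n ^ DIM('a)) * exp (- (pi * (v \<bullet> v)))))"
        by (simp only: heat)
      finally show ?thesis
        using r(1)[of n] by (simp add: gaussian_def exp_of_real[symmetric] mult_ac)
    qed
    moreover have "(\<lambda>n. of_real (exp (- t n)) * (LINT v|lborel. f (x - r n *\<^sub>R v) * gaussian 1 v))
        \<longlonglongrightarrow> of_real (exp (- 0)) * (LINT v|lborel. f (x - 0 *\<^sub>R v) * gaussian 1 v)"
    proof (intro tendsto_intros t0 integral_dominated_convergence[where w = "\<lambda>v. B * norm (gaussian 1 v)"])
      have "(\<lambda>n. x - r n *\<^sub>R v) \<longlonglongrightarrow> x - 0 *\<^sub>R v" for v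
        by (intro tendsto_intros r0)
      then have "(\<lambda>n. f (x - r n *\<^sub>R v)) \<longlonglongrightarrow> f (x - 0 *\<^sub>R v)" for v
        by (intro continuous_on_tendsto_compose[OF cont]) auto
      then show "AE v in lborel. (\<lambda>n. f (x - r n *\<^sub>R v) * gaussian 1 v) \<longlonglongrightarrow> f (x - 0 *\<^sub>R v) * gaussian 1 v"
        by (intro AE_I2 tendsto_intros)
      show "integrable lborel (\<lambda>v::'a. B * norm (gaussian 1 v))"
        by (intro integrable_mult_right integrable_norm integrable_gaussian) auto
      show "AE v in lborel. norm (f (x - r n *\<^sub>R v) * gaussian 1 v) \<le> B * norm (gaussian 1 v)" for n
        by (intro AE_I2) (auto simp: norm_mult intro!: mult_right_mono bound)
    qed measurable
    moreover have "integral\<^sup>L lborel (gaussian 1 :: 'a \<Rightarrow> complex) = 1"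
      using integral_gaussian_real[of 1, where ?'a = 'a] by simp
    ultimately show ?thesis by simp
  qed
  ultimately show ?thesis by (auto dest: LIMSEQ_unique)
qed

section \<open>Fractional powers of the Helmholtz operator\<close>

text \<open>The weight of the subordination formula
\<open>a\<^sup>\<theta> = c \<integral> t\<^bsup>-1-\<theta>\<^esup> (1 - e\<^bsup>-ta\<^esup>) dt\<close>. The indicator extends it by 0 to \<open>t \<le> 0\<close>, so that
integrals run over the whole line.\<close>

definition stable_kernel :: "real \<Rightarrow> real \<Rightarrow> real" where
  "stable_kernel \<theta> t = indicator {0<..} t * t powr (- 1 - \<theta>)"

lemma stable_kernel_nonneg [simp]: "0 \<le> stable_kernel \<theta> t"
  by (simp add: stable_kernel_def)

lemma measurable_stable_kernel [measurable]: "stable_kernel \<theta> \<in> borel_measurable borel"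
  unfolding stable_kernel_def[abs_def] by measurable

lemma stable_kernel_scaling:
  assumes [measurable]: "\<phi> \<in> borel_measurable borel" and "a > 0"
  shows "(\<integral>\<^sup>+t. ennreal (stable_kernel \<theta> t * \<phi> (t * a)) \<partial>lborel) =
    ennreal (a powr \<theta>) * (\<integral>\<^sup>+t. ennreal (stable_kernel \<theta> t * \<phi> t) \<partial>lborel)"
proof -
  have "(\<integral>\<^sup>+t. ennreal (stable_kernel \<theta> t * \<phi> (t * a)) \<partial>lborel) =
      ennreal (1 / a) * (\<integral>\<^sup>+t. ennreal (stable_kernel \<theta> (t / a) * \<phi> t) \<partial>lborel)"
    using nn_integral_lborel_affine[of "\<lambda>t. ennreal (stable_kernel \<theta> t * \<phi> (t * a))" "1 / a" 0] assms(2)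
    by simp
  also have "stable_kernel \<theta> (t / a) * \<phi> t = a powr (1 + \<theta>) * (stable_kernel \<theta> t * \<phi> t)" for t
    using assms(2)
    by (auto simp: stable_kernel_def indicator_def powr_divide powr_minus divide_simps zero_less_divide_iff
        simp flip: powr_add)
  then have "(\<integral>\<^sup>+t. ennreal (stable_kernel \<theta> (t / a) * \<phi> t) \<partial>lborel) =
      ennreal (a powr (1 + \<theta>)) * (\<integral>\<^sup>+t. ennreal (stable_kernel \<theta> t * \<phi> t) \<partial>lborel)"
    by (simp only: ennreal_mult'[OF powr_ge_zero]) (rule nn_integral_cmult, measurable)
  also have "ennreal (1 / a) * (ennreal (a powr (1 + \<theta>)) * (\<integral>\<^sup>+t. ennreal (stable_kernel \<theta> t * \<phi> t) \<partial>lborel)) =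
      ennreal (1 / a * a powr (1 + \<theta>)) * (\<integral>\<^sup>+t. ennreal (stable_kernel \<theta> t * \<phi> t) \<partial>lborel)"
    by (simp only: ennreal_mult''[OF powr_ge_zero] mult.assoc)
  also have "1 / a * a powr (1 + \<theta>) = a powr \<theta>"
    using assms(2) by (simp add: powr_add)
  finally show ?thesis .
qed

text \<open>The integrand is \<open>t\<^bsup>-\<theta>\<^esup>\<close> near 0, integrable as \<open>\<theta> < 1\<close>, and \<open>t\<^bsup>-1-\<theta>\<^esup>\<close> at infinity, integrable as \<open>\<theta> > 0\<close>.\<close>

lemma stable_kernel_min_finite:
  assumes "0 < \<theta>" "\<theta> < 1"
  shows "(\<integral>\<^sup>+t. ennreal (stable_kernel \<theta> t * min 1 t) \<partial>lborel) < \<infinity>"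
proof -
  have 1: "(\<integral>\<^sup>+t. ennreal (indicator {0..1::real} t * t powr (- \<theta>)) \<partial>lborel) < \<infinity>"
    using nn_integral_has_integral_lebesgue[OF _ has_integral_powr_from_0[of "- \<theta>" 1]] assms
    by (simp add: nn_integral_completion)
  have 2: "(\<integral>\<^sup>+t. ennreal (indicator {1::real..} t * t powr (- 1 - \<theta>)) \<partial>lborel) < \<infinity>"
    using nn_integral_has_integral_lebesgue[OF _ has_integral_powr_to_inf[of "- 1 - \<theta>" 1]] assms
    by (simp add: nn_integral_completion)
  have "stable_kernel \<theta> t * min 1 t \<le> indicator {0..1::real} t * t powr (- \<theta>) + indicator {1::real..} t * t powr (- 1 - \<theta>)" for t
  proof (cases "0 < t \<and> t \<le> 1")
    case True
    then have "t powr (- 1 - \<theta>) * t = t powr (- \<theta>)"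
      by (simp add: powr_diff powr_minus field_simps)
    then show ?thesis using True by (auto simp: stable_kernel_def min_def)
  next
    case False
    then show ?thesis by (auto simp: stable_kernel_def min_def indicator_def)
  qed
  then have "(\<integral>\<^sup>+t. ennreal (stable_kernel \<theta> t * min 1 t) \<partial>lborel) \<le>
      (\<integral>\<^sup>+t. ennreal (indicator {0..1::real} t * t powr (- \<theta>)) + ennreal (indicator {1::real..} t * t powr (- 1 - \<theta>)) \<partial>lborel)"
    by (intro nn_integral_mono) (auto simp: ennreal_plus[symmetric] simp del: ennreal_plus intro!: ennreal_leI)
  also have "\<dots> < \<infinity>" using 1 2 by (simp add: nn_integral_add)
  finally show ?thesis .
qed

definition stable_const :: "real \<Rightarrow> real" where
  "stable_const \<theta> = enn2real (\<integral>\<^sup>+t. ennreal (stable_kernel \<theta> t * (1 - exp (- t))) \<partial>lborel)"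

lemma
  assumes "0 < \<theta>" "\<theta> < 1"
  shows nn_integral_stable_kernel:
    "a > 0 \<Longrightarrow> (\<integral>\<^sup>+t. ennreal (stable_kernel \<theta> t * (1 - exp (- t * a))) \<partial>lborel) =
      ennreal (stable_const \<theta> * a powr \<theta>)"
    and stable_const_pos: "0 < stable_const \<theta>"
proof -
  let ?I = "\<integral>\<^sup>+t. ennreal (stable_kernel \<theta> t * (1 - exp (- t))) \<partial>lborel"
  have "stable_kernel \<theta> t * (1 - exp (- t)) \<le> stable_kernel \<theta> t * min 1 t" for t
    using exp_ge_add_one_self[of "- t"] by (intro mult_left_mono) auto
  then have "?I \<le> (\<integral>\<^sup>+t. ennreal (stable_kernel \<theta> t * min 1 t) \<partial>lborel)"
    by (intro nn_integral_mono ennreal_leI)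
  also have "\<dots> < \<infinity>" by (rule stable_kernel_min_finite[OF assms])
  finally have fin: "?I = ennreal (stable_const \<theta>)" by (simp add: stable_const_def)
  \<comment> \<open>On \<open>[1, 2]\<close> the integrand is bounded below, so the constant is not 0.\<close>
  have "ennreal (2 powr (- 1 - \<theta>) * (1 - exp (- 1))) = 
      (\<integral>\<^sup>+t. ennreal (2 powr (- 1 - \<theta>) * (1 - exp (- 1))) * indicator {1..2::real} t \<partial>lborel)"
    by (simp add: nn_integral_cmult)
  also have "\<dots> \<le> ?I"
  proof (intro nn_integral_mono)
    fix t :: real
    show "ennreal (2 powr (- 1 - \<theta>) * (1 - exp (- 1))) * indicator {1..2::real} t
        \<le> ennreal (stable_kernel \<theta> t * (1 - exp (- t)))"
      using assms
      by (auto split: split_indicator simp: stable_kernel_def intro!: ennreal_leI mult_mono powr_mono2')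
  qed
  finally have "0 < ?I" 
    by (rule less_le_trans[rotated]) simp
  then show "0 < stable_const \<theta>" by (simp add: fin)
  assume "a > 0"
  then show "(\<integral>\<^sup>+t. ennreal (stable_kernel \<theta> t * (1 - exp (- t * a))) \<partial>lborel) =
      ennreal (stable_const \<theta> * a powr \<theta>)"
    using stable_kernel_scaling[of "\<lambda>t. 1 - exp (- t)" a \<theta>]
    by (simp only: mult.commute[of "stable_const \<theta>"] ennreal_mult'[OF powr_ge_zero] fin mult_minus_left)
      simp
qed

definition heat_conv :: "('a::euclidean_space \<Rightarrow> complex) \<Rightarrow> real \<Rightarrow> 'a \<Rightarrow> complex" where
  "heat_conv f t x = (LINT y|lborel. f y * of_real (bessel_heat t (x - y)))"

lemma measurable_heat_conv [measurable]:
  assumes [measurable]: "f \<in> borel_measurable borel"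
  shows "(\<lambda>(t, x). heat_conv f t x) \<in> borel_measurable (lborel \<Otimes>\<^sub>M lborel)"
  unfolding heat_conv_def bessel_heat_def by measurable

text \<open>If the convolution integral diverges, its value is 0 by convention and the bound is trivial.\<close>

lemma norm_heat_conv_le:
  assumes "f \<in> borel_measurable borel"
  shows "ennreal (norm (heat_conv f t x)) \<le> (\<integral>\<^sup>+y. ennreal (norm (f y)) * ennreal (bessel_heat t (x - y)) \<partial>lborel)"
proof (cases "integrable lborel (\<lambda>y. f y * of_real (bessel_heat t (x - y)))")
  case True
  show ?thesis unfolding heat_conv_def
    by (rule order_trans[OF integral_norm_bound_ennreal[OF True]])
      (auto simp: norm_mult ennreal_mult bessel_heat_nonneg intro!: nn_integral_mono)
qed (simp add: heat_conv_def not_integrable_integral_eq)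

lemma heat_majorant_sup:
  fixes f :: "'a::euclidean_space \<Rightarrow> complex"
  assumes "t > 0" "\<And>y. norm (f y) \<le> A" "0 \<le> A"
  shows "(\<integral>\<^sup>+y. ennreal (norm (f y)) * ennreal (bessel_heat t (x - y)) \<partial>lborel) \<le> ennreal A"
proof -
  have "(\<integral>\<^sup>+y. ennreal (norm (f y)) * ennreal (bessel_heat t (x - y)) \<partial>lborel) \<le>
      (\<integral>\<^sup>+y. ennreal A * ennreal (bessel_heat t (x - y)) \<partial>lborel)"
    using assms by (intro nn_integral_mono mult_right_mono ennreal_leI) auto
  also have "\<dots> = ennreal A * ennreal (exp (- t))"
    using nn_integral_lborel_reflect[of "\<lambda>y. ennreal (bessel_heat t y)" x] nn_integral_bessel_heat[OF assms(1), where ?'a = 'a]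
    by (simp add: nn_integral_cmult)
  also have "\<dots> \<le> ennreal A * 1" using assms by (intro mult_left_mono) auto
  finally show ?thesis by simp
qed

lemma heat_majorant_L1:
  fixes f :: "'a::euclidean_space \<Rightarrow> complex"
  assumes "t > 0" and [measurable]: "f \<in> borel_measurable borel"
  shows "(\<integral>\<^sup>+x. \<integral>\<^sup>+y. ennreal (norm (f y)) * ennreal (bessel_heat t (x - y)) \<partial>lborel \<partial>lborel) \<le>
    (\<integral>\<^sup>+y. ennreal (norm (f y)) \<partial>lborel)"
proof -
  have "(\<integral>\<^sup>+x. \<integral>\<^sup>+y. ennreal (norm (f y)) * ennreal (bessel_heat t (x - y)) \<partial>lborel \<partial>lborel) =
      (\<integral>\<^sup>+y. \<integral>\<^sup>+x. ennreal (norm (f y)) * ennreal (bessel_heat t (x - y)) \<partial>lborel \<partial>lborel)"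
    by (rule lborel_pair.Fubini') measurable
  also have "\<dots> = (\<integral>\<^sup>+y. ennreal (norm (f y)) * ennreal (exp (- t)) \<partial>lborel)"
    using nn_integral_lborel_translate[of "\<lambda>x::'a. ennreal (bessel_heat t x)" "- y" for y] nn_integral_bessel_heat[OF assms(1), where ?'a = 'a]
    by (simp add: nn_integral_cmult)
  also have "\<dots> \<le> (\<integral>\<^sup>+y. ennreal (norm (f y)) * 1 \<partial>lborel)"
    using assms by (intro nn_integral_mono mult_left_mono) auto
  finally show ?thesis by simp
qed

lemma schwartz_bounded_by:
  assumes "schwartz f" obtains B where "\<And>x. norm (f x) \<le> B"
proof -
  obtain B where "\<forall>x. norm (f x) * (1 + (norm x)\<^sup>2) ^ 0 \<le> B" using schwartz_decay[OF assms] by blast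
  then show ?thesis by (intro that[of B]) simp
qed

lemma heat_conv_fourier:
  assumes "schwartz f" "t > 0"
  shows "heat_conv f t x =
    (LINT \<xi>|lborel. of_real (exp (- t * bessel_symbol \<xi>)) * fourier f \<xi> * cis (2 * pi * (x \<bullet> \<xi>)))"
  unfolding heat_conv_def
  by (intro heat_convolution_fourier schwartz_integrable schwartz_continuous assms)

lemma heat_difference_fourier:
  assumes "schwartz f" "t > 0"
  shows "f x - heat_conv f t x =
    (LINT \<xi>|lborel. of_real (1 - exp (- t * bessel_symbol \<xi>)) * fourier f \<xi> * cis (2 * pi * (x \<bullet> \<xi>)))"
proof -
  obtain B where B: "\<And>x. norm (f x) \<le> B" using schwartz_bounded_by[OF assms(1)] by blast
  note ff = integrable_fourier[OF assms(1)]
  have [measurable]: "fourier f \<in> borel_measurable borel"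
    using ff by (auto dest: borel_measurable_integrable)
  have [measurable]: "(bessel_symbol :: 'a \<Rightarrow> real) \<in> borel_measurable borel"
    by (intro borel_measurable_continuous_onI continuous_bessel_symbol)
  have i1: "integrable lborel (\<lambda>\<xi>. fourier f \<xi> * cis (2 * pi * (x \<bullet> \<xi>)))"
    by (rule Bochner_Integration.integrable_bound[OF ff]) (auto simp: norm_mult)
  have i2: "integrable lborel (\<lambda>\<xi>. of_real (exp (- t * bessel_symbol \<xi>)) * fourier f \<xi> * cis (2 * pi * (x \<bullet> \<xi>)))"
    using assms(2)
    by (intro Bochner_Integration.integrable_bound[OF ff])
      (auto simp: norm_mult intro!: AE_I2 mult_left_le_one_le mult_nonneg_nonneg less_imp_le[OF bessel_symbol_pos])
  have "f x = (LINT \<xi>|lborel. fourier f \<xi> * cis (2 * pi * (x \<bullet> \<xi>)))"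
    by (rule fourier_inversion[OF schwartz_integrable[OF assms(1)] schwartz_continuous[OF assms(1)] B ff])
  then have "f x - heat_conv f t x = (LINT \<xi>|lborel. fourier f \<xi> * cis (2 * pi * (x \<bullet> \<xi>)) -
      of_real (exp (- t * bessel_symbol \<xi>)) * fourier f \<xi> * cis (2 * pi * (x \<bullet> \<xi>)))"
    using heat_conv_fourier[OF assms, of x] by (simp only: Bochner_Integration.integral_diff[OF i1 i2])
  then show ?thesis by (simp add: algebra_simps)
qed

text \<open>With \<open>L = I - \<Delta>\<close>, the difference \<open>f - e\<^bsup>-tL\<^esup> f\<close> is the integral of \<open>e\<^bsup>-uL\<^esup> L f\<close> over \<open>0 < u \<le> t\<close>. On
the Fourier side this is the elementary integral of \<open>\<mu> e\<^bsup>-u\<mu>\<^esup>\<close>, where \<open>\<mu>\<close> is the symbol of \<open>L\<close>; the semigroup is then replaced by its positive kernel.\<close>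

lemma heat_difference_le:
  fixes f :: "'a::euclidean_space \<Rightarrow> complex"
  assumes f: "schwartz f" and t: "t > 0"
  shows "ennreal (norm (f x - heat_conv f t x)) \<le>
    (\<integral>\<^sup>+u. indicator {0<..t} u *
      (\<integral>\<^sup>+y. ennreal (norm (helmholtz f y)) * ennreal (bessel_heat u (x - y)) \<partial>lborel) \<partial>lborel)"
proof -
  note ff = integrable_fourier[OF f]
  have [measurable]: "fourier f \<in> borel_measurable borel"
    using ff by (auto dest: borel_measurable_integrable)
  have [measurable]: "(bessel_symbol :: 'a \<Rightarrow> real) \<in> borel_measurable borel"
    by (intro borel_measurable_continuous_onI continuous_bessel_symbol)
  note [measurable] = schwartz_measurable[OF schwartz_helmholtz[OF f]]
  let ?m = "bessel_symbol :: 'a \<Rightarrow> real"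
  let ?g = "\<lambda>\<xi> u. (indicator {0..t} u * (?m \<xi> * exp (- u * ?m \<xi>))) *\<^sub>R (fourier f \<xi> * cis (2 * pi * (x \<bullet> \<xi>)))"
  have hb: "has_bochner_integral lborel (\<lambda>u. indicator {0..t} u *\<^sub>R (?m \<xi> * exp (- u * ?m \<xi>))) (1 - exp (- t * ?m \<xi>))" for \<xi>
  proof -
    have "has_bochner_integral lborel (\<lambda>u. indicator {0..t} u *\<^sub>R (?m \<xi> * exp (- u * ?m \<xi>)))
        (- exp (- t * ?m \<xi>) - (- exp (- 0 * ?m \<xi>)))"
      using t by (intro has_bochner_integral_FTC_Icc)
        (auto intro!: continuous_intros derivative_eq_intros simp: has_real_derivative_iff_has_vector_derivative[symmetric])
    then show ?thesis by simp
  qed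
  have nn: "(\<integral>\<^sup>+u. ennreal (indicator {0..t} u * (?m \<xi> * exp (- u * ?m \<xi>))) \<partial>lborel) = ennreal (1 - exp (- t * ?m \<xi>))" for \<xi>
    using hb[of \<xi>] bessel_symbol_pos[of \<xi>]
    by (subst nn_integral_eq_integral) (auto simp: has_bochner_integral_iff less_imp_le)
  have "norm (?g \<xi> u) = (indicator {0..t} u * (?m \<xi> * exp (- u * ?m \<xi>))) * norm (fourier f \<xi>)" for \<xi> u
    using bessel_symbol_pos[of \<xi>] by (simp add: norm_mult abs_mult less_imp_le)
  then have "(\<integral>\<^sup>+u. ennreal (norm (?g \<xi> u)) \<partial>lborel) =
      ennreal (1 - exp (- t * ?m \<xi>)) * ennreal (norm (fourier f \<xi>))" for \<xi>
    by (simp only: ennreal_mult''[OF norm_ge_zero] nn[symmetric]) (rule nn_integral_multc, measurable)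
  then have "(\<integral>\<^sup>+\<xi>. \<integral>\<^sup>+u. ennreal (norm (?g \<xi> u)) \<partial>lborel \<partial>lborel) =
      (\<integral>\<^sup>+\<xi>. ennreal (1 - exp (- t * ?m \<xi>)) * ennreal (norm (fourier f \<xi>)) \<partial>lborel)"
    by (simp only:)
  also have "\<dots> \<le> (\<integral>\<^sup>+\<xi>. 1 * ennreal (norm (fourier f \<xi>)) \<partial>lborel)"
    by (intro nn_integral_mono mult_right_mono) auto
  also have "\<dots> < \<infinity>" using ff by (simp add: integrable_iff_bounded)
  finally have fin: "(\<integral>\<^sup>+\<xi>. \<integral>\<^sup>+u. ennreal (norm (?g \<xi> u)) \<partial>lborel \<partial>lborel) < \<infinity>" .
  have "f x - heat_conv f t x = (LINT \<xi>|lborel. LINT u|lborel. ?g \<xi> u)"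
    unfolding heat_difference_fourier[OF f t]
  proof (intro Bochner_Integration.integral_cong refl)
    fix \<xi> :: 'a
    have "(LINT u|lborel. ?g \<xi> u) = (LINT u|lborel. indicator {0..t} u *\<^sub>R (?m \<xi> * exp (- u * ?m \<xi>))) *\<^sub>R (fourier f \<xi> * cis (2 * pi * (x \<bullet> \<xi>)))"
      using hb[of \<xi>] by (subst integral_scaleR_left[symmetric]) (auto simp: has_bochner_integral_iff)
    also have "\<dots> = (1 - exp (- t * ?m \<xi>)) *\<^sub>R (fourier f \<xi> * cis (2 * pi * (x \<bullet> \<xi>)))"
      by (simp only: has_bochner_integral_integral_eq[OF hb])
    finally show "of_real (1 - exp (- t * ?m \<xi>)) * fourier f \<xi> * cis (2 * pi * (x \<bullet> \<xi>)) = (LINT u|lborel. ?g \<xi> u)"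
      by (simp only: scaleR_conv_of_real mult.assoc)
  qed
  also have "\<dots> = (LINT u|lborel. LINT \<xi>|lborel. ?g \<xi> u)"
    by (rule Fubini_lborel[OF _ fin]) measurable
  finally have "ennreal (norm (f x - heat_conv f t x)) \<le> (\<integral>\<^sup>+u. ennreal (norm (LINT \<xi>|lborel. ?g \<xi> u)) \<partial>lborel)"
    by (cases "integrable lborel (\<lambda>u. LINT \<xi>|lborel. ?g \<xi> u)")
      (auto simp: not_integrable_integral_eq intro: integral_norm_bound_ennreal)
  also have "\<dots> \<le> (\<integral>\<^sup>+u. indicator {0<..t} u *
      (\<integral>\<^sup>+y. ennreal (norm (helmholtz f y)) * ennreal (bessel_heat u (x - y)) \<partial>lborel) \<partial>lborel)"
  proof (rule nn_integral_mono_AE)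
    have "AE u in lborel. u \<noteq> (0::real)" by (rule AE_lborel_singleton)
    then show "AE u in lborel. ennreal (norm (LINT \<xi>|lborel. ?g \<xi> u)) \<le> indicator {0<..t} u *
      (\<integral>\<^sup>+y. ennreal (norm (helmholtz f y)) * ennreal (bessel_heat u (x - y)) \<partial>lborel)"
    proof eventually_elim
      fix u :: real assume "u \<noteq> 0"
      show "ennreal (norm (LINT \<xi>|lborel. ?g \<xi> u)) \<le> indicator {0<..t} u *
        (\<integral>\<^sup>+y. ennreal (norm (helmholtz f y)) * ennreal (bessel_heat u (x - y)) \<partial>lborel)"
      proof (cases "u \<in> {0<..t}")
        case True
        then have "?g \<xi> u = of_real (exp (- u * ?m \<xi>)) * fourier (helmholtz f) \<xi> * cis (2 * pi * (x \<bullet> \<xi>))" for \<xi>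
          by (simp add: fourier_helmholtz[OF f] scaleR_conv_of_real mult_ac)
        then have "(LINT \<xi>|lborel. ?g \<xi> u) = heat_conv (helmholtz f) u x"
          using True by (simp add: heat_conv_fourier[OF schwartz_helmholtz[OF f]])
        then show ?thesis using True norm_heat_conv_le[of "helmholtz f" u x] by simp
      next
        case False
        with \<open>u \<noteq> 0\<close> have "?g \<xi> u = 0" for \<xi> by (auto simp: indicator_def)
        then show ?thesis by (simp only:) simp
      qed
    qed
  qed
  finally show ?thesis .
qed

lemma bessel_op_eq:
  assumes "schwartz f"
  shows "bessel_op s f x =
    (LINT \<xi>|lborel. of_real (bessel_symbol \<xi> powr (s / 2)) * fourier f \<xi> * cis (2 * pi * (x \<bullet> \<xi>)))"
proof -
  have [measurable]: "fourier f \<in> borel_measurable borel"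
    using integrable_fourier[OF assms] by (auto dest: borel_measurable_integrable)
  have [measurable]: "(bessel_symbol :: 'a \<Rightarrow> real) \<in> borel_measurable borel"
    by (intro borel_measurable_continuous_onI continuous_bessel_symbol)
  show ?thesis
    unfolding bessel_op_def bessel_symbol_def[symmetric]
    by (rule integral_completion) measurable
qed

lemma continuous_bessel_op:
  assumes "schwartz f"
  shows "continuous_on UNIV (bessel_op s f)"
proof -
  note i = integrable_symbol_fourier[OF assms, of "s / 2"]
  have [measurable]: "(\<lambda>\<xi>. complex_of_real (bessel_symbol \<xi> powr (s / 2)) * fourier f \<xi>) \<in> borel_measurable borel"
    using i by (auto dest: borel_measurable_integrable)
  have "continuous_on UNIV (\<lambda>x. LINT \<xi>|lborel. of_real (bessel_symbol \<xi> powr (s / 2)) * fourier f \<xi> * cis (2 * pi * (x \<bullet> \<xi>)))"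
    by (rule continuous_on_integral_param[OF _ _ integrable_norm[OF i]])
      (auto intro!: continuous_intros simp: norm_mult)
  then show ?thesis by (simp only: bessel_op_eq[OF assms, abs_def])
qed

lemma norm_bessel_op_bounded:
  assumes "schwartz f"
  obtains B where "\<And>x. norm (bessel_op s f x) \<le> B"
proof -
  note i = integrable_symbol_fourier[OF assms, of "s / 2"]
  have "norm (bessel_op s f x) \<le> (LINT \<xi>|lborel. norm (of_real (bessel_symbol \<xi> powr (s / 2)) * fourier f \<xi>))" for x
    unfolding bessel_op_eq[OF assms]
    by (rule order_trans[OF integral_norm_bound]) (simp add: norm_mult)
  then show ?thesis by (rule that)
qed

text \<open>Fubini; the right-hand side is symmetric in \<open>f\<close> and \<open>g\<close> up to \<open>\<xi> \<mapsto> -\<xi>\<close>, and the symbol is even.\<close>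

lemma bessel_op_pairing:
  fixes f g :: "'a::euclidean_space \<Rightarrow> complex"
  assumes f: "schwartz f" and g: "schwartz g"
  shows "(LINT x|lborel. g x * bessel_op s f x) =
    (LINT \<xi>|lborel. of_real (bessel_symbol \<xi> powr (s / 2)) * fourier f \<xi> * fourier g (- \<xi>))"
proof -
  let ?M = "\<lambda>\<xi>. complex_of_real (bessel_symbol \<xi> powr (s / 2)) * fourier f \<xi>"
  note i = integrable_symbol_fourier[OF f, of "s / 2"]
  have [measurable]: "?M \<in> borel_measurable borel"
    using i by (auto dest: borel_measurable_integrable)
  note [measurable] = schwartz_measurable[OF g]
  let ?h = "\<lambda>x \<xi>. g x * (?M \<xi> * cis (2 * pi * (x \<bullet> \<xi>)))"
  have "(\<integral>\<^sup>+x. \<integral>\<^sup>+\<xi>. ennreal (norm (?h x \<xi>)) \<partial>lborel \<partial>lborel) =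
      (\<integral>\<^sup>+x. ennreal (norm (g x)) * (\<integral>\<^sup>+\<xi>. ennreal (norm (?M \<xi>)) \<partial>lborel) \<partial>lborel)"
  proof (intro nn_integral_cong)
    fix x :: 'a
    have "(\<integral>\<^sup>+\<xi>. ennreal (norm (?h x \<xi>)) \<partial>lborel) = (\<integral>\<^sup>+\<xi>. ennreal (norm (g x)) * ennreal (norm (?M \<xi>)) \<partial>lborel)"
      by (intro nn_integral_cong) (simp only: norm_mult norm_cis mult_1_right ennreal_mult'[OF norm_ge_zero])
    also have "\<dots> = ennreal (norm (g x)) * (\<integral>\<^sup>+\<xi>. ennreal (norm (?M \<xi>)) \<partial>lborel)"
      by (rule nn_integral_cmult) measurable
    finally show "(\<integral>\<^sup>+\<xi>. ennreal (norm (?h x \<xi>)) \<partial>lborel) = \<dots>" .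
  qed
  also have "\<dots> = (\<integral>\<^sup>+x. ennreal (norm (g x)) \<partial>lborel) * (\<integral>\<^sup>+\<xi>. ennreal (norm (?M \<xi>)) \<partial>lborel)"
    by (rule nn_integral_multc) measurable
  also have "\<dots> < \<infinity>"
    using i schwartz_integrable[OF g] unfolding integrable_iff_bounded infinity_ennreal_def
    by (intro ennreal_mult_less_top[THEN iffD2]) auto
  finally have fin: "(\<integral>\<^sup>+x. \<integral>\<^sup>+\<xi>. ennreal (norm (?h x \<xi>)) \<partial>lborel \<partial>lborel) < \<infinity>" .
  have "(LINT x|lborel. g x * bessel_op s f x) = (LINT x|lborel. LINT \<xi>|lborel. ?h x \<xi>)"
    by (simp add: bessel_op_eq[OF f])
  also have "\<dots> = (LINT \<xi>|lborel. LINT x|lborel. ?h x \<xi>)"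
    by (rule Fubini_lborel[OF _ fin]) measurable
  also have "\<dots> = (LINT \<xi>|lborel. ?M \<xi> * fourier g (- \<xi>))"
  proof (intro Bochner_Integration.integral_cong refl)
    fix \<xi> :: 'a
    have "?h x \<xi> = ?M \<xi> * (g x * cis (- 2 * pi * (x \<bullet> (- \<xi>))))" for x by simp
    then show "(LINT x|lborel. ?h x \<xi>) = ?M \<xi> * fourier g (- \<xi>)"
      by (simp only: integral_mult_right_zero fourier_lborel[OF schwartz_measurable[OF g]])
  qed
  finally show ?thesis .
qed

lemma tempered_bounded_continuous:
  fixes h :: "'a::euclidean_space \<Rightarrow> complex"
  assumes "continuous_on UNIV h" "\<And>x. norm (h x) \<le> B"
  shows "tempered h"
  unfolding tempered_def
proof safe
  fix \<phi> :: "'a \<Rightarrow> complex" assume \<phi>: "schwartz \<phi>"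
  note [measurable] = borel_measurable_continuous_onI[OF assms(1)] schwartz_measurable[OF \<phi>]
  have "integrable lborel (\<lambda>x. h x * \<phi> x)"
  proof (rule Bochner_Integration.integrable_bound)
    show "integrable lborel (\<lambda>x. of_real B * \<phi> x)"
      by (intro integrable_mult_right schwartz_integrable[OF \<phi>])
    show "AE x in lborel. norm (h x * \<phi> x) \<le> norm (of_real B * \<phi> x)"
      using assms(2) order_trans[OF assms(2) abs_ge_self]
      by (intro AE_I2) (auto simp: norm_mult intro!: mult_right_mono)
  qed measurable
  then show "integrable lebesgue (\<lambda>x. h x * \<phi> x)" by (subst integrable_completion) measurable
qed

lemma bessel_image_bessel_op:
  fixes f :: "'a::euclidean_space \<Rightarrow> complex"
  assumes f: "schwartz f"
  shows "bessel_image s f (bessel_op s f)"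
  unfolding bessel_image_def
proof (intro conjI allI impI)
  obtain B where "\<And>x. norm (f x) \<le> B" using schwartz_bounded_by[OF f] by blast
  then show "tempered f" by (rule tempered_bounded_continuous[OF schwartz_continuous[OF f]])
  obtain B where "\<And>x. norm (bessel_op s f x) \<le> B" using norm_bessel_op_bounded[OF f] by blast
  then show "tempered (bessel_op s f)" by (rule tempered_bounded_continuous[OF continuous_bessel_op[OF f]])
  fix \<phi> :: "'a \<Rightarrow> complex" assume \<phi>: "schwartz \<phi>"
  note [measurable] = borel_measurable_continuous_onI[OF continuous_bessel_op[OF f]]
    borel_measurable_continuous_onI[OF continuous_bessel_op[OF \<phi>]]
    schwartz_measurable[OF \<phi>] schwartz_measurable[OF f]
    borel_measurable_continuous_onI[OF continuous_fourier[OF schwartz_integrable[OF f]]]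
    borel_measurable_continuous_onI[OF continuous_fourier[OF schwartz_integrable[OF \<phi>]]]
    borel_measurable_continuous_onI[OF continuous_bessel_symbol]
  have "(LINT x|lebesgue. bessel_op s f x * \<phi> x) = (LINT x|lborel. \<phi> x * bessel_op s f x)"
    by (subst integral_completion) (auto simp: mult.commute)
  also have "\<dots> = (LINT \<xi>|lborel. of_real (bessel_symbol \<xi> powr (s / 2)) * fourier f \<xi> * fourier \<phi> (- \<xi>))"
    by (rule bessel_op_pairing[OF f \<phi>])
  also have "\<dots> = (LINT \<xi>|lborel. of_real (bessel_symbol \<xi> powr (s / 2)) * fourier \<phi> \<xi> * fourier f (- \<xi>))"
    using integral_lborel_reflect[of "\<lambda>\<xi>. of_real (bessel_symbol \<xi> powr (s / 2)) * fourier f \<xi> * fourier \<phi> (- \<xi>)" 0]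
    by (simp add: bessel_symbol_def mult_ac)
  also have "\<dots> = (LINT x|lborel. f x * bessel_op s \<phi> x)"
    by (rule bessel_op_pairing[OF \<phi> f, symmetric])
  also have "\<dots> = (LINT x|lebesgue. f x * bessel_op s \<phi> x)"
    by (subst integral_completion) auto
  finally show "(LINT x|lebesgue. bessel_op s f x * \<phi> x) = (LINT x|lebesgue. f x * bessel_op s \<phi> x)" .
qed

text \<open>The subordination formula with \<open>a\<close> the symbol of \<open>I - \<Delta>\<close>, integrated against the Fourier transform of
\<open>H\<close>. The integer part \<open>k\<close> of the exponent is absorbed in \<open>H\<close>.\<close>

lemma bessel_op_subordination:
  fixes h :: "'a::euclidean_space \<Rightarrow> complex" and k :: nat
  assumes h: "schwartz h" and \<theta>: "0 < \<theta>" "\<theta> < 1"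
  defines "H \<equiv> (helmholtz ^^ k) h"
  shows "ennreal (stable_const \<theta> * norm (bessel_op (2 * (real k + \<theta>)) h x)) \<le>
    (\<integral>\<^sup>+t. ennreal (stable_kernel \<theta> t) * ennreal (norm (H x - heat_conv H t x)) \<partial>lborel)"
proof -
  let ?m = "bessel_symbol :: 'a \<Rightarrow> real"
  let ?K = "stable_const \<theta>"
  have H: "schwartz H" unfolding H_def by (rule schwartz_helmholtz_pow[OF h])
  note K = stable_const_pos[OF \<theta>]
  have [measurable]: "fourier H \<in> borel_measurable borel" "?m \<in> borel_measurable borel"
    by (intro borel_measurable_continuous_onI continuous_bessel_symbol continuous_fourier schwartz_integrable H)+
  let ?e = "\<lambda>t \<xi>. stable_kernel \<theta> t * (1 - exp (- t * ?m \<xi>))"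
  have e_nonneg: "0 \<le> ?e t \<xi>" for t \<xi>
    using bessel_symbol_pos[of \<xi>] by (auto simp: stable_kernel_def indicator_def)
  let ?g = "\<lambda>\<xi> t. ?e t \<xi> *\<^sub>R (fourier H \<xi> * cis (2 * pi * (x \<bullet> \<xi>)))"
  have nn: "(\<integral>\<^sup>+t. ennreal (?e t \<xi>) \<partial>lborel) = ennreal (?K * ?m \<xi> powr \<theta>)" for \<xi>
    by (rule nn_integral_stable_kernel[OF \<theta> bessel_symbol_pos])
  have e_int: "integrable lborel (\<lambda>t. ?e t \<xi>)" for \<xi>
    by (rule integrableI_nonneg) (use e_nonneg nn in auto)
  have int_e: "(LINT t|lborel. ?e t \<xi>) = ?K * ?m \<xi> powr \<theta>" for \<xi>
    using nn_integral_eq_integral[OF e_int, of \<xi>] e_nonneg nn[of \<xi>] K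
    by (auto simp: ennreal_inj integral_nonneg_AE)
  have ng: "norm (?g \<xi> t) = ?e t \<xi> * norm (fourier H \<xi>)" for \<xi> t
    using e_nonneg[of t \<xi>] by (simp add: norm_mult)
  have "(\<integral>\<^sup>+t. ennreal (norm (?g \<xi> t)) \<partial>lborel) = ennreal (?K * ?m \<xi> powr \<theta>) * ennreal (norm (fourier H \<xi>))" for \<xi>
    unfolding ng nn[symmetric] by (simp only: ennreal_mult''[OF norm_ge_zero]) (rule nn_integral_multc, measurable)
  also have "ennreal (?K * ?m \<xi> powr \<theta>) * ennreal (norm (fourier H \<xi>)) =
      ennreal ?K * ennreal (norm (complex_of_real (?m \<xi> powr \<theta>) * fourier H \<xi>))" for \<xi>
    using K by (simp add: ennreal_mult'' norm_mult ennreal_mult' mult.assoc)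
  finally have "(\<integral>\<^sup>+\<xi>. \<integral>\<^sup>+t. ennreal (norm (?g \<xi> t)) \<partial>lborel \<partial>lborel) =
      ennreal ?K * (\<integral>\<^sup>+\<xi>. ennreal (norm (complex_of_real (?m \<xi> powr \<theta>) * fourier H \<xi>)) \<partial>lborel)"
    by (simp only:) (rule nn_integral_cmult, measurable)
  also have "\<dots> < \<infinity>"
    using integrable_symbol_fourier[OF H, of \<theta>] unfolding integrable_iff_bounded infinity_ennreal_def
    by (intro ennreal_mult_less_top[THEN iffD2]) auto
  finally have fin: "(\<integral>\<^sup>+\<xi>. \<integral>\<^sup>+t. ennreal (norm (?g \<xi> t)) \<partial>lborel \<partial>lborel) < \<infinity>" .
  have half: "2 * (real k + \<theta>) / 2 = real k + \<theta>" by simp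
  have "of_real ?K * bessel_op (2 * (real k + \<theta>)) h x =
      (LINT \<xi>|lborel. of_real ?K * (of_real (?m \<xi> powr (real k + \<theta>)) * fourier h \<xi> * cis (2 * pi * (x \<bullet> \<xi>))))"
    by (simp only: bessel_op_eq[OF h] half integral_mult_right_zero)
  also have "\<dots> = (LINT \<xi>|lborel. LINT t|lborel. ?g \<xi> t)"
  proof (intro Bochner_Integration.integral_cong refl)
    fix \<xi> :: 'a
    have "(LINT t|lborel. ?g \<xi> t) = (LINT t|lborel. ?e t \<xi>) *\<^sub>R (fourier H \<xi> * cis (2 * pi * (x \<bullet> \<xi>)))"
      using e_int by (subst integral_scaleR_left) auto
    also have "\<dots> = (?K * ?m \<xi> powr \<theta>) *\<^sub>R (fourier H \<xi> * cis (2 * pi * (x \<bullet> \<xi>)))"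
      by (simp only: int_e)
    also have "\<dots> = of_real ?K * (of_real (?m \<xi> powr (real k + \<theta>)) * fourier h \<xi> * cis (2 * pi * (x \<bullet> \<xi>)))"
      using bessel_symbol_pos[of \<xi>]
      by (simp add: H_def fourier_helmholtz_pow[OF h] scaleR_conv_of_real powr_add powr_realpow mult_ac)
    finally show "of_real ?K * (of_real (?m \<xi> powr (real k + \<theta>)) * fourier h \<xi> * cis (2 * pi * (x \<bullet> \<xi>))) =
        (LINT t|lborel. ?g \<xi> t)" by simp
  qed
  also have "\<dots> = (LINT t|lborel. LINT \<xi>|lborel. ?g \<xi> t)"
    by (rule Fubini_lborel[OF _ fin]) measurable
  finally have eq: "of_real ?K * bessel_op (2 * (real k + \<theta>)) h x = \<dots>" .
  have "ennreal (?K * norm (bessel_op (2 * (real k + \<theta>)) h x)) =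
      ennreal (norm (LINT t|lborel. LINT \<xi>|lborel. ?g \<xi> t))"
    using K by (simp only: eq[symmetric]) (simp add: norm_mult)
  also have "\<dots> \<le> (\<integral>\<^sup>+t. ennreal (norm (LINT \<xi>|lborel. ?g \<xi> t)) \<partial>lborel)"
    by (cases "integrable lborel (\<lambda>t. LINT \<xi>|lborel. ?g \<xi> t)")
      (auto simp: not_integrable_integral_eq intro: integral_norm_bound_ennreal)
  also have "\<dots> = (\<integral>\<^sup>+t. ennreal (stable_kernel \<theta> t) * ennreal (norm (H x - heat_conv H t x)) \<partial>lborel)"
  proof (intro nn_integral_cong)
    fix t :: real
    show "ennreal (norm (LINT \<xi>|lborel. ?g \<xi> t)) = ennreal (stable_kernel \<theta> t) * ennreal (norm (H x - heat_conv H t x))"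
    proof (cases "t > 0")
      case True
      have "?g \<xi> t = of_real (stable_kernel \<theta> t) *
          (of_real (1 - exp (- t * ?m \<xi>)) * fourier H \<xi> * cis (2 * pi * (x \<bullet> \<xi>)))" for \<xi>
        by (simp only: scaleR_conv_of_real of_real_mult mult.assoc)
      then have "(LINT \<xi>|lborel. ?g \<xi> t) = of_real (stable_kernel \<theta> t) * (H x - heat_conv H t x)"
        by (simp only: integral_mult_right_zero heat_difference_fourier[OF H True])
      then show ?thesis by (simp add: norm_mult ennreal_mult'')
    qed (simp add: stable_kernel_def)
  qed
  finally show ?thesis .
qed


text \<open>The bound \<open>2 A\<close> is the triangle inequality, as the semigroup contracts; the bound \<open>t A B\<close> is
\<open>heat_difference_le\<close>.\<close>

lemma heat_difference_sup:
  fixes H :: "'a::euclidean_space \<Rightarrow> complex"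
  assumes H: "schwartz H" and t: "0 < t" and "0 \<le> A" "0 \<le> B"
    and A: "\<And>x. norm (H x) \<le> A" and AB: "\<And>x. norm (helmholtz H x) \<le> A * B"
  shows "ennreal (norm (H x - heat_conv H t x)) \<le> ennreal (2 * A * min 1 (t * B))"
proof -
  note [measurable] = schwartz_measurable[OF H]
  have "ennreal (norm (H x - heat_conv H t x)) \<le> ennreal (norm (H x) + norm (heat_conv H t x))"
    by (intro ennreal_leI norm_triangle_ineq4)
  also have "\<dots> \<le> ennreal A + ennreal A"
  proof -
    have "ennreal (norm (heat_conv H t x)) \<le> ennreal A"
      by (rule order_trans[OF norm_heat_conv_le heat_majorant_sup[OF t A assms(3)]]) measurable
    then show ?thesis by (subst ennreal_plus) (auto intro!: add_mono ennreal_leI A)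
  qed
  also have "\<dots> = ennreal (2 * A)" using assms by (simp flip: ennreal_plus)
  finally have 1: "ennreal (norm (H x - heat_conv H t x)) \<le> ennreal (2 * A)" .
  have "ennreal (norm (H x - heat_conv H t x)) \<le>
    (\<integral>\<^sup>+u. indicator {0<..t} u *
      (\<integral>\<^sup>+y. ennreal (norm (helmholtz H y)) * ennreal (bessel_heat u (x - y)) \<partial>lborel) \<partial>lborel)"
    by (rule heat_difference_le[OF H t])
  also have "\<dots> \<le> (\<integral>\<^sup>+u. ennreal (A * B) * indicator {0<..t} u \<partial>lborel)"
    using heat_majorant_sup[of _ "helmholtz H" "A * B" x, OF _ AB] assms
    by (intro nn_integral_mono) (auto split: split_indicator)
  also have "\<dots> = ennreal (A * B * t)"
    using assms by (simp add: nn_integral_cmult ennreal_mult)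
  also have "\<dots> \<le> ennreal (2 * A * (t * B))"
    using assms by (intro ennreal_leI) (simp add: mult_ac)
  finally show ?thesis using 1 by (auto simp: min_def)
qed

lemma heat_difference_L1:
  fixes H :: "'a::euclidean_space \<Rightarrow> complex"
  assumes H: "schwartz H" and t: "0 < t" and "0 \<le> A" "0 \<le> B"
    and A: "(\<integral>\<^sup>+x. ennreal (norm (H x)) \<partial>lborel) \<le> ennreal A"
    and AB: "(\<integral>\<^sup>+x. ennreal (norm (helmholtz H x)) \<partial>lborel) \<le> ennreal (A * B)"
  shows "(\<integral>\<^sup>+x. ennreal (norm (H x - heat_conv H t x)) \<partial>lborel) \<le> ennreal (2 * A * min 1 (t * B))"
proof -
  note [measurable] = schwartz_measurable[OF H] schwartz_measurable[OF schwartz_helmholtz[OF H]]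
  have [measurable]: "heat_conv H t \<in> borel_measurable borel"
    using measurable_compose[OF _ measurable_heat_conv[OF schwartz_measurable[OF H]], of "Pair t" borel] by simp
  have "(\<integral>\<^sup>+x. ennreal (norm (H x - heat_conv H t x)) \<partial>lborel) \<le>
      (\<integral>\<^sup>+x. ennreal (norm (H x)) + ennreal (norm (heat_conv H t x)) \<partial>lborel)"
    by (intro nn_integral_mono) (auto simp flip: ennreal_plus intro!: ennreal_leI norm_triangle_ineq4)
  also have "\<dots> = (\<integral>\<^sup>+x. ennreal (norm (H x)) \<partial>lborel) + (\<integral>\<^sup>+x. ennreal (norm (heat_conv H t x)) \<partial>lborel)"
    by (rule nn_integral_add) measurable
  also have "\<dots> \<le> ennreal A + ennreal A"
    by (intro add_mono A order_trans[OF nn_integral_mono[OF norm_heat_conv_le]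
          order_trans[OF heat_majorant_L1[OF t] A]]) measurable
  also have "\<dots> = ennreal (2 * A)" using assms by (simp flip: ennreal_plus)
  finally have 1: "(\<integral>\<^sup>+x. ennreal (norm (H x - heat_conv H t x)) \<partial>lborel) \<le> ennreal (2 * A)" .
  have "(\<integral>\<^sup>+x. ennreal (norm (H x - heat_conv H t x)) \<partial>lborel) \<le>
    (\<integral>\<^sup>+x. \<integral>\<^sup>+u. indicator {0<..t} u *
      (\<integral>\<^sup>+y. ennreal (norm (helmholtz H y)) * ennreal (bessel_heat u (x - y)) \<partial>lborel) \<partial>lborel \<partial>lborel)"
    by (intro nn_integral_mono heat_difference_le[OF H t])
  also have "\<dots> = (\<integral>\<^sup>+u. \<integral>\<^sup>+x. indicator {0<..t} u *
      (\<integral>\<^sup>+y. ennreal (norm (helmholtz H y)) * ennreal (bessel_heat u (x - y)) \<partial>lborel) \<partial>lborel \<partial>lborel)"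
    unfolding bessel_heat_def by (rule lborel_pair.Fubini') measurable
  also have "\<dots> = (\<integral>\<^sup>+u. indicator {0<..t} u * (\<integral>\<^sup>+x.
      (\<integral>\<^sup>+y. ennreal (norm (helmholtz H y)) * ennreal (bessel_heat u (x - y)) \<partial>lborel) \<partial>lborel) \<partial>lborel)"
    unfolding bessel_heat_def by (intro nn_integral_cong nn_integral_cmult) measurable
  also have "\<dots> \<le> (\<integral>\<^sup>+u. ennreal (A * B) * indicator {0<..t} u \<partial>lborel)"
    using order_trans[OF heat_majorant_L1[of _ "helmholtz H"] AB]
    by (intro nn_integral_mono) (auto split: split_indicator)
  also have "\<dots> = ennreal (A * B * t)"
    using assms by (simp add: nn_integral_cmult ennreal_mult)
  also have "\<dots> \<le> ennreal (2 * A * (t * B))"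
    using assms by (intro ennreal_leI) (simp add: mult_ac)
  finally show ?thesis using 1 by (auto simp: min_def)
qed

lemma bessel_op_even:
  fixes h :: "'a::euclidean_space \<Rightarrow> complex"
  assumes h: "schwartz h"
  shows "bessel_op (2 * (real k + 0)) h x = (helmholtz ^^ k) h x"
proof -
  let ?H = "(helmholtz ^^ k) h"
  have H: "schwartz ?H" by (rule schwartz_helmholtz_pow[OF h])
  obtain B where B: "\<And>x. norm (?H x) \<le> B" using schwartz_bounded_by[OF H] by blast
  have "?H x = (LINT \<xi>|lborel. fourier ?H \<xi> * cis (2 * pi * (x \<bullet> \<xi>)))"
    by (rule fourier_inversion[OF schwartz_integrable[OF H] schwartz_continuous[OF H] B integrable_fourier[OF H]])
  then show ?thesis
    by (simp add: bessel_op_eq[OF h] fourier_helmholtz_pow[OF h] powr_realpow bessel_symbol_pos)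
qed

lemma stable_kernel_min_bound:
  assumes \<theta>: "0 < \<theta>" "\<theta> < 1" and "0 \<le> A" "0 < B"
  shows "(\<integral>\<^sup>+t. ennreal (stable_kernel \<theta> t) * ennreal (2 * A * min 1 (t * B)) \<partial>lborel) =
    ennreal (2 * A * B powr \<theta> * enn2real (\<integral>\<^sup>+t. ennreal (stable_kernel \<theta> t * min 1 t) \<partial>lborel))"
proof -
  let ?I = "\<integral>\<^sup>+t. ennreal (stable_kernel \<theta> t * min 1 t) \<partial>lborel"
  have I: "?I = ennreal (enn2real ?I)" using stable_kernel_min_finite[OF \<theta>] by simp
  have "ennreal (stable_kernel \<theta> t) * ennreal (2 * A * min 1 (t * B)) =
      ennreal (2 * A) * ennreal (stable_kernel \<theta> t * min 1 (t * B))" for t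
    using assms by (cases "t > 0") (auto simp: ennreal_mult'[symmetric] stable_kernel_def mult_ac)
  then have "(\<integral>\<^sup>+t. ennreal (stable_kernel \<theta> t) * ennreal (2 * A * min 1 (t * B)) \<partial>lborel) =
      ennreal (2 * A) * (\<integral>\<^sup>+t. ennreal (stable_kernel \<theta> t * min 1 (t * B)) \<partial>lborel)"
    by (simp only:) (rule nn_integral_cmult, measurable)
  also have "\<dots> = ennreal (2 * A) * (ennreal (B powr \<theta>) * ?I)"
    using stable_kernel_scaling[of "\<lambda>t. min 1 t" B \<theta>] assms by simp
  also have "\<dots> = ennreal (2 * A * B powr \<theta> * enn2real ?I)"
    using assms by (subst I) (simp add: ennreal_mult'[symmetric] mult.assoc)
  finally show ?thesis .
qed

text \<open>If \<open>H\<close> has size \<open>A\<close> and \<open>(I - \<Delta>) H\<close> has size \<open>A B\<close>, then \<open>(I - \<Delta>)\<^sup>\<theta> H\<close> has size \<open>A B\<^sup>\<theta>\<close>, in the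
supremum norm and in \<open>L\<^sup>1\<close>. Integrating \<open>2 A min 1 (t B)\<close> against the weight gives exactly this power
of \<open>B\<close> by scaling. For \<open>\<theta> = 0\<close> the weight is not integrable at infinity, but then there is nothing
to interpolate and the claim is Fourier inversion.\<close>

theorem bessel_op_interpolation:
  assumes \<theta>: "0 \<le> \<theta>" "\<theta> < 1"
  obtains C where "0 \<le> C"
    and "\<And>(h :: 'a::euclidean_space \<Rightarrow> complex) k A B x. schwartz h \<Longrightarrow> 0 \<le> A \<Longrightarrow> 0 < B \<Longrightarrow>
      (\<And>x. norm ((helmholtz ^^ k) h x) \<le> A) \<Longrightarrow> (\<And>x. norm ((helmholtz ^^ Suc k) h x) \<le> A * B) \<Longrightarrow>
      norm (bessel_op (2 * (real k + \<theta>)) h x) \<le> C * A * B powr \<theta>"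
    and "\<And>(h :: 'a::euclidean_space \<Rightarrow> complex) k A B. schwartz h \<Longrightarrow> 0 \<le> A \<Longrightarrow> 0 < B \<Longrightarrow>
      (\<integral>\<^sup>+x. ennreal (norm ((helmholtz ^^ k) h x)) \<partial>lborel) \<le> ennreal A \<Longrightarrow>
      (\<integral>\<^sup>+x. ennreal (norm ((helmholtz ^^ Suc k) h x)) \<partial>lborel) \<le> ennreal (A * B) \<Longrightarrow>
      (\<integral>\<^sup>+x. ennreal (norm (bessel_op (2 * (real k + \<theta>)) h x)) \<partial>lborel) \<le> ennreal (C * A * B powr \<theta>)"
proof (cases "\<theta> = 0")
  case True
  show ?thesis
    by (rule that[of 1]) (auto simp: True bessel_op_even[simplified])
next
  case False
  with \<theta> have \<theta>: "0 < \<theta>" "\<theta> < 1" by auto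
  let ?K = "stable_const \<theta>"
  let ?I = "enn2real (\<integral>\<^sup>+t. ennreal (stable_kernel \<theta> t * min 1 t) \<partial>lborel)"
  note K = stable_const_pos[OF \<theta>]
  show ?thesis
  proof (rule that[of "2 * ?I / ?K"])
    show "0 \<le> 2 * ?I / ?K" using K by simp
  next
    fix h :: "'a \<Rightarrow> complex" and k A B x
    assume h: "schwartz h" and AB: "0 \<le> A" "0 < B"
      and 1: "\<And>x. norm ((helmholtz ^^ k) h x) \<le> A" and 2: "\<And>x. norm ((helmholtz ^^ Suc k) h x) \<le> A * B"
    let ?H = "(helmholtz ^^ k) h"
    have H: "schwartz ?H" by (rule schwartz_helmholtz_pow[OF h])
    have "ennreal (?K * norm (bessel_op (2 * (real k + \<theta>)) h x)) \<le>
        (\<integral>\<^sup>+t. ennreal (stable_kernel \<theta> t) * ennreal (norm (?H x - heat_conv ?H t x)) \<partial>lborel)"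
      by (rule bessel_op_subordination[OF h \<theta>])
    also have "\<dots> \<le> (\<integral>\<^sup>+t. ennreal (stable_kernel \<theta> t) * ennreal (2 * A * min 1 (t * B)) \<partial>lborel)"
    proof (rule nn_integral_mono)
      fix t :: real
      show "ennreal (stable_kernel \<theta> t) * ennreal (norm (?H x - heat_conv ?H t x)) \<le>
          ennreal (stable_kernel \<theta> t) * ennreal (2 * A * min 1 (t * B))"
        using heat_difference_sup[OF H _ AB(1) less_imp_le[OF AB(2)] 1, of t x] 2
        by (cases "t > 0") (auto simp: stable_kernel_def intro!: mult_left_mono)
    qed
    also have "\<dots> = ennreal (2 * A * B powr \<theta> * ?I)" by (rule stable_kernel_min_bound[OF \<theta> AB])
    finally have "?K * norm (bessel_op (2 * (real k + \<theta>)) h x) \<le> 2 * A * B powr \<theta> * ?I"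
      using AB by (simp add: ennreal_le_iff)
    then show "norm (bessel_op (2 * (real k + \<theta>)) h x) \<le> 2 * ?I / ?K * A * B powr \<theta>"
      using K by (simp add: field_simps)
  next
    fix h :: "'a \<Rightarrow> complex" and k A B
    assume h: "schwartz h" and AB: "0 \<le> A" "0 < B"
      and 1: "(\<integral>\<^sup>+x. ennreal (norm ((helmholtz ^^ k) h x)) \<partial>lborel) \<le> ennreal A"
      and 2: "(\<integral>\<^sup>+x. ennreal (norm ((helmholtz ^^ Suc k) h x)) \<partial>lborel) \<le> ennreal (A * B)"
    let ?H = "(helmholtz ^^ k) h" and ?G = "bessel_op (2 * (real k + \<theta>)) h"
    have H: "schwartz ?H" by (rule schwartz_helmholtz_pow[OF h])
    note [measurable] = schwartz_measurable[OF H] borel_measurable_continuous_onI[OF continuous_bessel_op[OF h]]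
      measurable_heat_conv[OF schwartz_measurable[OF H]]
    have "ennreal ?K * (\<integral>\<^sup>+x. ennreal (norm (?G x)) \<partial>lborel) = (\<integral>\<^sup>+x. ennreal (?K * norm (?G x)) \<partial>lborel)"
      using K by (simp add: ennreal_mult' nn_integral_cmult)
    also have "\<dots> \<le> (\<integral>\<^sup>+x. \<integral>\<^sup>+t. ennreal (stable_kernel \<theta> t) * ennreal (norm (?H x - heat_conv ?H t x)) \<partial>lborel \<partial>lborel)"
      by (intro nn_integral_mono bessel_op_subordination[OF h \<theta>])
    also have "\<dots> = (\<integral>\<^sup>+t. \<integral>\<^sup>+x. ennreal (stable_kernel \<theta> t) * ennreal (norm (?H x - heat_conv ?H t x)) \<partial>lborel \<partial>lborel)"
      by (rule lborel_pair.Fubini') measurable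
    also have "\<dots> = (\<integral>\<^sup>+t. ennreal (stable_kernel \<theta> t) * (\<integral>\<^sup>+x. ennreal (norm (?H x - heat_conv ?H t x)) \<partial>lborel) \<partial>lborel)"
      by (intro nn_integral_cong nn_integral_cmult) measurable
    also have "\<dots> \<le> (\<integral>\<^sup>+t. ennreal (stable_kernel \<theta> t) * ennreal (2 * A * min 1 (t * B)) \<partial>lborel)"
    proof (rule nn_integral_mono)
      fix t :: real
      show "ennreal (stable_kernel \<theta> t) * (\<integral>\<^sup>+x. ennreal (norm (?H x - heat_conv ?H t x)) \<partial>lborel) \<le>
          ennreal (stable_kernel \<theta> t) * ennreal (2 * A * min 1 (t * B))"
        using heat_difference_L1[OF H _ AB(1) less_imp_le[OF AB(2)] 1, of t] 2
        by (cases "t > 0") (auto simp: stable_kernel_def intro!: mult_left_mono)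
    qed
    also have "\<dots> = ennreal (2 * A * B powr \<theta> * ?I)" by (rule stable_kernel_min_bound[OF \<theta> AB])
    finally have le: "ennreal ?K * (\<integral>\<^sup>+x. ennreal (norm (?G x)) \<partial>lborel) \<le> ennreal (2 * A * B powr \<theta> * ?I)" .
    have "(\<integral>\<^sup>+x. ennreal (norm (?G x)) \<partial>lborel) = ennreal (1 / ?K) * (ennreal ?K * (\<integral>\<^sup>+x. ennreal (norm (?G x)) \<partial>lborel))"
      using K by (simp add: mult.assoc[symmetric] ennreal_mult'[symmetric])
    also have "\<dots> \<le> ennreal (1 / ?K) * ennreal (2 * A * B powr \<theta> * ?I)"
      by (intro mult_left_mono le) auto
    also have "\<dots> = ennreal (2 * ?I / ?K * A * B powr \<theta>)"
      using K by (simp add: ennreal_mult'[symmetric] mult_ac)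
    finally show "(\<integral>\<^sup>+x. ennreal (norm (?G x)) \<partial>lborel) \<le> ennreal (2 * ?I / ?K * A * B powr \<theta>)" .
  qed
qed

section \<open>Upper bounds for Sobolev norms\<close>

lemma Lp_norm_interpolation:
  fixes g :: "'a::euclidean_space \<Rightarrow> complex"
  assumes "1 < r" "0 \<le> S" "0 \<le> T" "\<And>x. norm (g x) \<le> S"
    and [measurable]: "g \<in> borel_measurable borel"
    and T: "(\<integral>\<^sup>+x. ennreal (norm (g x)) \<partial>lborel) \<le> ennreal T"
  shows "Lp_norm r g \<le> ennreal (S powr (1 - 1 / r) * T powr (1 / r))"
proof -
  let ?I = "\<integral>\<^sup>+x. ennreal (norm (g x) powr r) \<partial>lebesgue"
  have "?I = (\<integral>\<^sup>+x. ennreal (norm (g x) powr r) \<partial>lborel)" by (simp add: nn_integral_completion)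
  also have "\<dots> \<le> (\<integral>\<^sup>+x. ennreal (S powr (r - 1)) * ennreal (norm (g x)) \<partial>lborel)"
  proof (rule nn_integral_mono)
    fix x
    have "norm (g x) powr r = norm (g x) powr (r - 1) * norm (g x)"
      by (simp add: powr_mult_base[symmetric] powr_diff)
    also have "\<dots> \<le> S powr (r - 1) * norm (g x)"
      using assms by (intro mult_right_mono powr_mono2) auto
    finally show "ennreal (norm (g x) powr r) \<le> ennreal (S powr (r - 1)) * ennreal (norm (g x))"
      by (simp add: ennreal_mult'[symmetric] ennreal_leI)
  qed
  also have "\<dots> = ennreal (S powr (r - 1)) * (\<integral>\<^sup>+x. ennreal (norm (g x)) \<partial>lborel)"
    by (rule nn_integral_cmult) measurable
  also have "\<dots> \<le> ennreal (S powr (r - 1)) * ennreal T" by (intro mult_left_mono T) auto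
  also have "\<dots> = ennreal (S powr (r - 1) * T)" by (simp add: ennreal_mult')
  finally have I: "?I \<le> ennreal (S powr (r - 1) * T)" .
  then have fin: "?I \<noteq> \<infinity>" by (auto simp: top_unique)
  have "enn2real ?I \<le> S powr (r - 1) * T"
    using I assms by (intro enn2real_leI) auto
  then have "enn2real ?I powr (1 / r) \<le> (S powr (r - 1) * T) powr (1 / r)"
    using assms by (intro powr_mono2) auto
  also have "\<dots> = S powr ((r - 1) * (1 / r)) * T powr (1 / r)"
    using assms by (simp add: powr_mult powr_powr)
  also have "(r - 1) * (1 / r) = 1 - 1 / r" using assms by (simp add: field_simps)
  finally show ?thesis using fin by (simp add: Lp_norm_def Let_def ennreal_leI)
qed

text \<open>The form in which the interpolation is applied: the number \<open>M\<close> is the price of one derivative, and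
\<open>A\<close> and \<open>A1\<close> measure the height and the mass. Only two consecutive powers of \<open>I - \<Delta>\<close> matter, those
on both sides of \<open>s/2\<close>.\<close>

theorem sobolev_norm_upper_bound:
  fixes r s :: real
  assumes r: "1 < r" and s: "0 < s"
  obtains C and k :: nat where "0 \<le> C"
    and "\<And>(h :: 'a::euclidean_space \<Rightarrow> complex) A A1 M. schwartz h \<Longrightarrow> 0 \<le> A \<Longrightarrow> 0 \<le> A1 \<Longrightarrow> 0 < M \<Longrightarrow>
      (\<And>j x. j \<in> {k, Suc k} \<Longrightarrow> norm ((helmholtz ^^ j) h x) \<le> A * M ^ (2 * j)) \<Longrightarrow>
      (\<And>j. j \<in> {k, Suc k} \<Longrightarrow> (\<integral>\<^sup>+x. ennreal (norm ((helmholtz ^^ j) h x)) \<partial>lborel) \<le> ennreal (A1 * M ^ (2 * j))) \<Longrightarrow>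
      sobolev_norm r s h \<le> ennreal (C * (A powr (1 - 1 / r) * A1 powr (1 / r)) * M powr s)"
proof -
  define k where "k = nat \<lfloor>s / 2\<rfloor>"
  define \<theta> where "\<theta> = s / 2 - real k"
  have \<theta>: "0 \<le> \<theta>" "\<theta> < 1" using s by (auto simp: \<theta>_def k_def) linarith+
  have s_eq: "2 * (real k + \<theta>) = s" by (simp add: \<theta>_def)
  obtain C where C: "0 \<le> C"
    and sup: "\<And>(h :: 'a \<Rightarrow> complex) k A B x. schwartz h \<Longrightarrow> 0 \<le> A \<Longrightarrow> 0 < B \<Longrightarrow>
      (\<And>x. norm ((helmholtz ^^ k) h x) \<le> A) \<Longrightarrow> (\<And>x. norm ((helmholtz ^^ Suc k) h x) \<le> A * B) \<Longrightarrow>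
      norm (bessel_op (2 * (real k + \<theta>)) h x) \<le> C * A * B powr \<theta>"
    and L1: "\<And>(h :: 'a \<Rightarrow> complex) k A B. schwartz h \<Longrightarrow> 0 \<le> A \<Longrightarrow> 0 < B \<Longrightarrow>
      (\<integral>\<^sup>+x. ennreal (norm ((helmholtz ^^ k) h x)) \<partial>lborel) \<le> ennreal A \<Longrightarrow>
      (\<integral>\<^sup>+x. ennreal (norm ((helmholtz ^^ Suc k) h x)) \<partial>lborel) \<le> ennreal (A * B) \<Longrightarrow>
      (\<integral>\<^sup>+x. ennreal (norm (bessel_op (2 * (real k + \<theta>)) h x)) \<partial>lborel) \<le> ennreal (C * A * B powr \<theta>)"
    using bessel_op_interpolation[OF \<theta>, where ?'a = 'a] by blast
  show thesis
  proof (rule that[OF C, of k])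
    fix h :: "'a \<Rightarrow> complex" and A A1 M :: real
    assume h: "schwartz h" and A: "0 \<le> A" "0 \<le> A1" and M: "0 < M"
      and 1: "\<And>j x. j \<in> {k, Suc k} \<Longrightarrow> norm ((helmholtz ^^ j) h x) \<le> A * M ^ (2 * j)"
      and 2: "\<And>j. j \<in> {k, Suc k} \<Longrightarrow> (\<integral>\<^sup>+x. ennreal (norm ((helmholtz ^^ j) h x)) \<partial>lborel) \<le> ennreal (A1 * M ^ (2 * j))"
    let ?G = "bessel_op s h"
    have pow: "D * M ^ (2 * Suc k) = D * M ^ (2 * k) * M\<^sup>2" for D
      by (simp add: power_add[symmetric] mult.assoc)
    have Ms: "M ^ (2 * k) * (M\<^sup>2) powr \<theta> = M powr s"
    proof -
      have "M ^ (2 * k) = M powr (2 * real k)" using M by (simp add: powr_realpow[symmetric])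
      moreover have "(M\<^sup>2) powr \<theta> = M powr (2 * \<theta>)" using M by (simp add: powr_powr flip: powr_numeral)
      ultimately show ?thesis by (simp add: powr_add[symmetric] flip: s_eq)
    qed
    have S: "norm (?G x) \<le> C * M powr s * A" for x
    proof -
      have "norm (?G x) \<le> C * (A * M ^ (2 * k)) * (M\<^sup>2) powr \<theta>"
        unfolding s_eq[symmetric] using 1[of k] 1[of "Suc k"] A M h
        by (intro sup) (auto simp only: pow insert_iff simp_thms zero_less_power mult_nonneg_nonneg zero_le_power less_imp_le)
      then show ?thesis by (simp add: Ms[symmetric] mult_ac)
    qed
    have T: "(\<integral>\<^sup>+x. ennreal (norm (?G x)) \<partial>lborel) \<le> ennreal (C * M powr s * A1)"
    proof -
      have "(\<integral>\<^sup>+x. ennreal (norm (?G x)) \<partial>lborel) \<le> ennreal (C * (A1 * M ^ (2 * k)) * (M\<^sup>2) powr \<theta>)"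
        unfolding s_eq[symmetric] using 2[of k] 2[of "Suc k"] A M h
        by (intro L1) (auto simp only: pow insert_iff simp_thms zero_less_power mult_nonneg_nonneg zero_le_power less_imp_le)
      then show ?thesis by (simp add: Ms[symmetric] mult_ac)
    qed
    have mG: "?G \<in> borel_measurable borel" by (rule borel_measurable_continuous_onI[OF continuous_bessel_op[OF h]])
    have "Lp_norm r ?G \<le> ennreal ((C * M powr s * A) powr (1 - 1 / r) * (C * M powr s * A1) powr (1 / r))"
      by (rule Lp_norm_interpolation[OF r _ _ S mG T]) (use C A in auto)
    also have "(C * M powr s * A) powr (1 - 1 / r) * (C * M powr s * A1) powr (1 / r) =
        (C * M powr s) powr ((1 - 1 / r) + 1 / r) * (A powr (1 - 1 / r) * A1 powr (1 / r))"
      using C A by (subst powr_add) (simp add: powr_mult mult_ac)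
    also have "\<dots> = C * (A powr (1 - 1 / r) * A1 powr (1 / r)) * M powr s"
      using C by (simp add: mult_ac)
    finally have Lp: "Lp_norm r ?G \<le> ennreal (C * (A powr (1 - 1 / r) * A1 powr (1 / r)) * M powr s)" .
    have "?G \<in> Lp_space r"
      unfolding Lp_space_def using Lp mG by (auto simp: measurable_completion intro: le_less_trans)
    then have "sobolev_norm r s h \<le> Lp_norm r ?G"
      unfolding sobolev_norm_def using bessel_image_bessel_op[OF h] by (intro INF_lower) auto
    with Lp show "sobolev_norm r s h \<le> ennreal (C * (A powr (1 - 1 / r) * A1 powr (1 / r)) * M powr s)"
      by (rule order_trans[rotated])
  qed
qed

section \<open>Derivatives of a polynomial times an exponential\<close>

text \<open>Families of functions of \<open>x\<close>, indexed by a parameter \<open>p\<close>, that are polynomials in the generators \<open>B\<close>.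
Treating families, and not single functions, is what makes the bounds below uniform in the parameter.\<close>

inductive_set fun_ring :: "('p \<Rightarrow> 'a \<Rightarrow> complex) set \<Rightarrow> ('p \<Rightarrow> 'a \<Rightarrow> complex) set"
  for B :: "('p \<Rightarrow> 'a \<Rightarrow> complex) set"
where
  base: "u \<in> B \<Longrightarrow> u \<in> fun_ring B"
| const: "(\<lambda>p x. c) \<in> fun_ring B"
| add: "u \<in> fun_ring B \<Longrightarrow> v \<in> fun_ring B \<Longrightarrow> (\<lambda>p x. u p x + v p x) \<in> fun_ring B"
| mult: "u \<in> fun_ring B \<Longrightarrow> v \<in> fun_ring B \<Longrightarrow> (\<lambda>p x. u p x * v p x) \<in> fun_ring B"

lemma fun_ring_diff:
  assumes "u \<in> fun_ring B" "v \<in> fun_ring B"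
  shows "(\<lambda>p x. u p x - v p x) \<in> fun_ring B"
  using fun_ring.add[OF assms(1) fun_ring.mult[OF fun_ring.const[of "-1"] assms(2)]] by simp

lemma fun_ring_sum:
  assumes "finite I" "\<And>i. i \<in> I \<Longrightarrow> u i \<in> fun_ring B"
  shows "(\<lambda>p x. \<Sum>i\<in>I. u i p x) \<in> fun_ring B"
  using assms by (induction I rule: finite_induct) (auto intro: fun_ring.intros)

lemma fun_ring_bound:
  fixes \<rho> :: "'p \<Rightarrow> 'a \<Rightarrow> real"
  assumes \<rho>: "\<And>p x. 0 \<le> \<rho> p x"
    and B: "\<And>u. u \<in> B \<Longrightarrow> \<exists>C l. \<forall>(p, x)\<in>S. norm (u p x) \<le> C * (1 + \<rho> p x) ^ l"
    and u: "u \<in> fun_ring B"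
  shows "\<exists>C\<ge>0. \<exists>l. \<forall>(p, x)\<in>S. norm (u p x) \<le> C * (1 + \<rho> p x) ^ l"
  using u
proof induction
  case (base u)
  then obtain C l where C: "\<forall>(p, x)\<in>S. norm (u p x) \<le> C * (1 + \<rho> p x) ^ l" using B by blast
  have "C * (1 + \<rho> p x) ^ l \<le> \<bar>C\<bar> * (1 + \<rho> p x) ^ l" for p x
    using \<rho>[of p x] by (intro mult_right_mono) auto
  with C show ?case by (intro exI[of _ "\<bar>C\<bar>"] conjI exI[of _ l]) (auto intro: order_trans)
next
  case (const c)
  show ?case by (intro exI[of _ "norm c"] conjI exI[of _ 0]) auto
next
  case (add u v)
  then obtain C l D k where C: "C \<ge> 0" "\<forall>(p, x)\<in>S. norm (u p x) \<le> C * (1 + \<rho> p x) ^ l"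
    and D: "D \<ge> 0" "\<forall>(p, x)\<in>S. norm (v p x) \<le> D * (1 + \<rho> p x) ^ k" by blast
  have "norm (u p x + v p x) \<le> (C + D) * (1 + \<rho> p x) ^ (l + k)" if "(p, x) \<in> S" for p x
  proof -
    have "norm (u p x + v p x) \<le> C * (1 + \<rho> p x) ^ l + D * (1 + \<rho> p x) ^ k"
      using C(2) D(2) that by (intro order_trans[OF norm_triangle_ineq] add_mono) auto
    also have "\<dots> \<le> C * (1 + \<rho> p x) ^ (l + k) + D * (1 + \<rho> p x) ^ (l + k)"
      using C D \<rho>[of p x] by (intro add_mono mult_left_mono power_increasing) auto
    finally show ?thesis by (simp add: distrib_right)
  qed
  then show ?case using C D by (intro exI[of _ "C + D"] conjI exI[of _ "l + k"]) auto
next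
  case (mult u v)
  then obtain C l D k where C: "C \<ge> 0" "\<forall>(p, x)\<in>S. norm (u p x) \<le> C * (1 + \<rho> p x) ^ l"
    and D: "D \<ge> 0" "\<forall>(p, x)\<in>S. norm (v p x) \<le> D * (1 + \<rho> p x) ^ k" by blast
  have "norm (u p x * v p x) \<le> (C * D) * (1 + \<rho> p x) ^ (l + k)" if "(p, x) \<in> S" for p x
  proof -
    have "norm (u p x * v p x) \<le> (C * (1 + \<rho> p x) ^ l) * (D * (1 + \<rho> p x) ^ k)"
      unfolding norm_mult using C D that \<rho>[of p x] by (intro mult_mono) auto
    then show ?thesis by (simp add: power_add mult_ac)
  qed
  then show ?case using C D by (intro exI[of _ "C * D"] conjI exI[of _ "l + k"]) auto
qed

text \<open>The derivative in direction \<open>v\<close> multiplied by \<open>c p\<close>. The factor is the reciprocal of the price of a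
derivative; with it the ring of families is closed under differentiation.\<close>

definition scaled_deriv ::
  "'p set \<Rightarrow> ('p \<Rightarrow> complex) \<Rightarrow> 'a::real_normed_vector \<Rightarrow> ('p \<Rightarrow> 'a \<Rightarrow> complex) \<Rightarrow> ('p \<Rightarrow> 'a \<Rightarrow> complex) \<Rightarrow> bool"
where
  "scaled_deriv P c v u u' \<longleftrightarrow>
     (\<forall>p\<in>P. \<forall>x. \<exists>D. (u p has_derivative D) (at x) \<and> c p * D v = u' p x)"

lemma fun_ring_deriv:
  assumes B: "\<And>u. u \<in> B \<Longrightarrow> \<exists>u'\<in>fun_ring B. scaled_deriv P c v u u'"
    and u: "u \<in> fun_ring B"
  shows "\<exists>u'\<in>fun_ring B. scaled_deriv P c v u u'"
  using u
proof induction
  case (base u)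
  then show ?case by (rule B)
next
  case (const a)
  have "scaled_deriv P c v (\<lambda>p x. a) (\<lambda>p x. 0)"
    unfolding scaled_deriv_def by (intro ballI allI exI[of _ "\<lambda>h. 0"] conjI) auto
  then show ?case using fun_ring.const[of 0] by blast
next
  case (add u w)
  then obtain u' w' where "u' \<in> fun_ring B" "w' \<in> fun_ring B" and d: "scaled_deriv P c v u u'" "scaled_deriv P c v w w'"
    by blast
  moreover have "scaled_deriv P c v (\<lambda>p x. u p x + w p x) (\<lambda>p x. u' p x + w' p x)"
    unfolding scaled_deriv_def
  proof (intro ballI allI)
    fix p x assume "p \<in> P"
    with d obtain D D' where "(u p has_derivative D) (at x)" "c p * D v = u' p x"
      "(w p has_derivative D') (at x)" "c p * D' v = w' p x" unfolding scaled_deriv_def by meson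
    then show "\<exists>D. ((\<lambda>x. u p x + w p x) has_derivative D) (at x) \<and> c p * D v = u' p x + w' p x"
      by (intro exI[of _ "\<lambda>h. D h + D' h"] conjI has_derivative_add) (auto simp: distrib_left)
  qed
  ultimately show ?case using fun_ring.add by blast
next
  case (mult u w)
  then obtain u' w' where u': "u' \<in> fun_ring B" "w' \<in> fun_ring B" and d: "scaled_deriv P c v u u'" "scaled_deriv P c v w w'"
    by blast
  have "scaled_deriv P c v (\<lambda>p x. u p x * w p x) (\<lambda>p x. u p x * w' p x + u' p x * w p x)"
    unfolding scaled_deriv_def
  proof (intro ballI allI)
    fix p x assume "p \<in> P"
    with d obtain D D' where D: "(u p has_derivative D) (at x)" "c p * D v = u' p x"
      "(w p has_derivative D') (at x)" "c p * D' v = w' p x" unfolding scaled_deriv_def by meson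
    have "c p * (u p x * D' v + D v * w p x) = u p x * (c p * D' v) + (c p * D v) * w p x"
      by (simp add: algebra_simps)
    then show "\<exists>D. ((\<lambda>x. u p x * w p x) has_derivative D) (at x) \<and> c p * D v = u p x * w' p x + u' p x * w p x"
      using D by (intro exI[of _ "\<lambda>h. u p x * D' h + D h * w p x"] conjI has_derivative_mult) auto
  qed
  moreover have "(\<lambda>p x. u p x * w' p x + u' p x * w p x) \<in> fun_ring B"
    using u' mult.hyps by (intro fun_ring.add fun_ring.mult)
  ultimately show ?case by blast
qed

text \<open>A ring of families that is closed under scaled differentiation and contains the scaled
derivatives of the exponent \<open>E\<close>. Then the products of its elements with \<open>exp E\<close> are closed under scaled
differentiation too, and so under scaled powers of \<^const>\<open>helmholtz\<close>.\<close>

locale exp_ring =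
  fixes B :: "('p \<Rightarrow> 'a::euclidean_space \<Rightarrow> complex) set" and P :: "'p set" and c :: "'p \<Rightarrow> complex"
    and E :: "'p \<Rightarrow> 'a \<Rightarrow> complex"
  assumes base_deriv: "\<And>u v. u \<in> B \<Longrightarrow> v \<in> Basis \<Longrightarrow> \<exists>u'\<in>fun_ring B. scaled_deriv P c v u u'"
    and exponent_deriv: "\<And>v. v \<in> Basis \<Longrightarrow> \<exists>u'\<in>fun_ring B. scaled_deriv P c v E u'"
    and scale_nonzero: "\<And>p. p \<in> P \<Longrightarrow> c p \<noteq> 0"
    and scale_in_ring: "(\<lambda>p x. c p) \<in> fun_ring B"
begin

lemma ring_exp_deriv:
  assumes "u \<in> fun_ring B" "v \<in> Basis"
  shows "\<exists>w\<in>fun_ring B. scaled_deriv P c v (\<lambda>p x. u p x * exp (E p x)) (\<lambda>p x. w p x * exp (E p x))"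
proof -
  obtain u' l where u': "u' \<in> fun_ring B" "scaled_deriv P c v u u'" and l: "l \<in> fun_ring B" "scaled_deriv P c v E l"
    using fun_ring_deriv[OF base_deriv assms(1)] assms(2) exponent_deriv by blast
  have "scaled_deriv P c v (\<lambda>p x. u p x * exp (E p x)) (\<lambda>p x. (u p x * l p x + u' p x) * exp (E p x))"
    unfolding scaled_deriv_def
  proof (intro ballI allI)
    fix p x assume "p \<in> P"
    with u' l obtain D D' where D: "(u p has_derivative D) (at x)" "c p * D v = u' p x"
      "(E p has_derivative D') (at x)" "c p * D' v = l p x" unfolding scaled_deriv_def by meson
    have "c p * (u p x * (exp (E p x) * D' v) + D v * exp (E p x)) =
        (u p x * (c p * D' v) + c p * D v) * exp (E p x)"
      by (simp add: algebra_simps)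
    then show "\<exists>D. ((\<lambda>x. u p x * exp (E p x)) has_derivative D) (at x) \<and>
        c p * D v = (u p x * l p x + u' p x) * exp (E p x)"
      using D by (intro exI[of _ "\<lambda>h. u p x * (exp (E p x) * D' h) + D h * exp (E p x)"] conjI
          has_derivative_mult has_derivative_exp_complex) auto
  qed
  moreover have "(\<lambda>p x. u p x * l p x + u' p x) \<in> fun_ring B"
    using assms u' l by (intro fun_ring.add fun_ring.mult)
  ultimately show ?thesis by (intro bexI[of _ "\<lambda>p x. u p x * l p x + u' p x"])
qed

lemma iter_deriv_ring_exp:
  assumes "u \<in> fun_ring B" "set vs \<subseteq> Basis"
  shows "\<exists>w\<in>fun_ring B. \<forall>p\<in>P. \<forall>x. c p ^ length vs * iter_deriv vs (\<lambda>x. u p x * exp (E p x)) x = w p x * exp (E p x)"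
  using assms(2)
proof (induction vs)
  case Nil
  then show ?case using assms(1) by auto
next
  case (Cons v vs)
  then obtain w where w: "w \<in> fun_ring B"
    and eq: "\<And>p x. p \<in> P \<Longrightarrow> c p ^ length vs * iter_deriv vs (\<lambda>x. u p x * exp (E p x)) x = w p x * exp (E p x)"
    by auto
  obtain w' where w': "w' \<in> fun_ring B" "scaled_deriv P c v (\<lambda>p x. w p x * exp (E p x)) (\<lambda>p x. w' p x * exp (E p x))"
    using ring_exp_deriv[OF w, of v] Cons by auto
  have "c p ^ length (v # vs) * iter_deriv (v # vs) (\<lambda>x. u p x * exp (E p x)) x = w' p x * exp (E p x)" if p: "p \<in> P" for p x
  proof -
    obtain D where D: "((\<lambda>x. w p x * exp (E p x)) has_derivative D) (at x)" "c p * D v = w' p x * exp (E p x)"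
      using w' p unfolding scaled_deriv_def by meson
    have "iter_deriv vs (\<lambda>x. u p x * exp (E p x)) = (\<lambda>x. inverse (c p ^ length vs) * (w p x * exp (E p x)))"
      using eq[OF p] scale_nonzero[OF p] by (auto simp: fun_eq_iff field_simps)
    then have "(iter_deriv vs (\<lambda>x. u p x * exp (E p x)) has_derivative (\<lambda>h. inverse (c p ^ length vs) * D h)) (at x)"
      using has_derivative_mult_right[OF D(1)] by simp
    from frechet_derivative_at[OF this, symmetric]
    have "iter_deriv (v # vs) (\<lambda>x. u p x * exp (E p x)) x = inverse (c p ^ length vs) * D v" by simp
    then show ?thesis using D(2) scale_nonzero[OF p] by (simp add: field_simps)
  qed
  then show ?case using w'(1) by blast
qed

lemma smooth_ring_exp:
  assumes "u \<in> fun_ring B" "p \<in> P"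
  shows "smooth (\<lambda>x. u p x * exp (E p x))"
  unfolding smooth_def
proof (intro allI impI)
  fix vs :: "'a list" and x assume vs: "set vs \<subseteq> Basis"
  then obtain w where w: "w \<in> fun_ring B"
    and eq: "\<And>x. c p ^ length vs * iter_deriv vs (\<lambda>x. u p x * exp (E p x)) x = w p x * exp (E p x)"
    using iter_deriv_ring_exp[OF assms(1)] assms(2) by blast
  obtain b :: 'a where "b \<in> Basis" using nonempty_Basis by blast
  then obtain w' where w': "scaled_deriv P c b (\<lambda>p x. w p x * exp (E p x)) (\<lambda>p x. w' p x * exp (E p x))"
    using ring_exp_deriv[OF w] by blast
  obtain D where D: "((\<lambda>x. w p x * exp (E p x)) has_derivative D) (at x)"
    using w' assms(2) unfolding scaled_deriv_def by meson
  have "iter_deriv vs (\<lambda>x. u p x * exp (E p x)) = (\<lambda>x. inverse (c p ^ length vs) * (w p x * exp (E p x)))"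
    using eq scale_nonzero[OF assms(2)] by (auto simp: fun_eq_iff field_simps)
  then show "iter_deriv vs (\<lambda>x. u p x * exp (E p x)) differentiable at x"
    using has_derivative_mult_right[OF D, of "inverse (c p ^ length vs)"] by (auto simp: differentiable_def)
qed

lemma helmholtz_ring_exp:
  assumes "u \<in> fun_ring B"
  shows "\<exists>w\<in>fun_ring B. \<forall>p\<in>P. \<forall>x. c p ^ (2 * k) * (helmholtz ^^ k) (\<lambda>x. u p x * exp (E p x)) x = w p x * exp (E p x)"
proof (induction k)
  case 0
  then show ?case using assms by auto
next
  case (Suc k)
  then obtain w where w: "w \<in> fun_ring B"
    and eq: "\<And>p x. p \<in> P \<Longrightarrow> c p ^ (2 * k) * (helmholtz ^^ k) (\<lambda>x. u p x * exp (E p x)) x = w p x * exp (E p x)"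
    by blast
  have "\<forall>b\<in>Basis. \<exists>W\<in>fun_ring B. \<forall>p\<in>P. \<forall>x. c p ^ 2 * iter_deriv [b, b] (\<lambda>x. w p x * exp (E p x)) x = W p x * exp (E p x)"
    using iter_deriv_ring_exp[OF w, of "[b, b]" for b] by (auto simp: numeral_2_eq_2 simp del: iter_deriv.simps)
  then obtain W where W: "\<And>b. b \<in> Basis \<Longrightarrow> W b \<in> fun_ring B"
    and Weq: "\<And>b p x. b \<in> Basis \<Longrightarrow> p \<in> P \<Longrightarrow> c p ^ 2 * iter_deriv [b, b] (\<lambda>x. w p x * exp (E p x)) x = W b p x * exp (E p x)"
    by metis
  let ?w = "\<lambda>p x. c p * c p * w p x - (\<Sum>b\<in>Basis. W b p x)"
  have "c p ^ (2 * Suc k) * (helmholtz ^^ Suc k) (\<lambda>x. u p x * exp (E p x)) x = ?w p x * exp (E p x)" if p: "p \<in> P" for p x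
  proof -
    let ?F = "\<lambda>x. w p x * exp (E p x)" and ?i = "inverse (c p ^ (2 * k))"
    have F: "smooth ?F" by (rule smooth_ring_exp[OF w p])
    have hk: "(helmholtz ^^ k) (\<lambda>x. u p x * exp (E p x)) = (\<lambda>x. ?i * ?F x)"
      using eq[OF p] scale_nonzero[OF p] by (auto simp: fun_eq_iff field_simps)
    have "iter_deriv vs (\<lambda>x. ?i * ?F x) = (\<lambda>x. ?i * iter_deriv vs ?F x)" if "set vs \<subseteq> Basis" for vs
      using that
    proof (induction vs)
      case (Cons v vs)
      then have d: "((\<lambda>x. ?i * iter_deriv vs ?F x) has_derivative (\<lambda>h. ?i * frechet_derivative (iter_deriv vs ?F) (at x) h)) (at x)" for x
        by (intro has_derivative_mult_right smooth_has_derivative[OF F]) auto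
      have IH: "iter_deriv vs (\<lambda>x. ?i * ?F x) = (\<lambda>x. ?i * iter_deriv vs ?F x)" using Cons by simp
      show ?case by (simp only: iter_deriv.simps IH frechet_derivative_at[OF d, symmetric])
    qed simp
    then have "helmholtz (\<lambda>x. ?i * ?F x) x = ?i * (?F x - (\<Sum>b\<in>Basis. iter_deriv [b, b] ?F x))"
      by (simp add: helmholtz_def right_diff_distrib sum_distrib_left del: iter_deriv.simps)
    then have "c p ^ (2 * Suc k) * (helmholtz ^^ Suc k) (\<lambda>x. u p x * exp (E p x)) x =
        (c p ^ (2 * Suc k) * ?i) * (?F x - (\<Sum>b\<in>Basis. iter_deriv [b, b] ?F x))"
      by (simp only: funpow.simps o_apply hk mult.assoc)
    also have "c p ^ (2 * Suc k) * ?i = (c p)\<^sup>2"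
      using scale_nonzero[OF p] by (simp add: power2_eq_square)
    finally have "c p ^ (2 * Suc k) * (helmholtz ^^ Suc k) (\<lambda>x. u p x * exp (E p x)) x =
        (c p)\<^sup>2 * (?F x - (\<Sum>b\<in>Basis. iter_deriv [b, b] ?F x))" .
    also have "\<dots> = c p * c p * ?F x - (\<Sum>b\<in>Basis. (c p)\<^sup>2 * iter_deriv [b, b] ?F x)"
      by (simp add: right_diff_distrib sum_distrib_left power2_eq_square del: iter_deriv.simps)
    also have "\<dots> = ?w p x * exp (E p x)"
      using Weq[OF _ p] by (simp add: left_diff_distrib sum_distrib_right mult.assoc del: iter_deriv.simps)
    finally show ?thesis .
  qed
  moreover have "?w \<in> fun_ring B"
    using w W scale_in_ring by (intro fun_ring_diff fun_ring.mult fun_ring_sum) auto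
  ultimately show ?case by (intro bexI[of _ ?w] ballI allI)
qed

end

lemma iter_deriv_zero_open:
  assumes "open U" "\<And>x. x \<in> U \<Longrightarrow> f x = 0" "x \<in> U"
  shows "iter_deriv vs f x = 0"
  using assms(3)
proof (induction vs arbitrary: x)
  case (Cons v vs)
  have "(iter_deriv vs f has_derivative (\<lambda>h. 0)) (at x)"
    by (rule has_derivative_transform_within_open[OF _ assms(1) Cons.prems])
      (use Cons.IH in auto)
  from frechet_derivative_at[OF this, symmetric] show ?case by simp
qed (use assms in auto)

lemma helmholtz_zero_open:
  assumes "open U" "\<And>x. x \<in> U \<Longrightarrow> f x = 0" "x \<in> U"
  shows "(helmholtz ^^ k) f x = 0"
  using assms(3)
proof (induction k arbitrary: x)
  case (Suc k)
  have "iter_deriv [b, b] ((helmholtz ^^ k) f) x = 0" for b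
    by (rule iter_deriv_zero_open[OF assms(1) Suc.IH Suc.prems])
  then have "helmholtz ((helmholtz ^^ k) f) x = 0"
    unfolding helmholtz_def[of "(helmholtz ^^ k) f"] using Suc by (simp del: iter_deriv.simps)
  then show ?case by simp
qed (use assms in auto)

lemma schwartz_compact_support:
  assumes "smooth f" "compact K" "\<And>x. x \<notin> K \<Longrightarrow> f x = 0"
  shows "schwartz f"
  unfolding schwartz_def
proof (intro conjI allI impI)
  fix k and vs :: "'a list" assume vs: "set vs \<subseteq> Basis"
  have "continuous_on K (\<lambda>x. norm x ^ k *\<^sub>R iter_deriv vs f x)"
    by (intro continuous_intros continuous_on_subset[OF smooth_continuous[OF assms(1) vs]]) auto
  from compact_imp_bounded[OF compact_continuous_image[OF this assms(2)]]
  have "bounded (insert 0 ((\<lambda>x. norm x ^ k *\<^sub>R iter_deriv vs f x) ` K))" by simp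
  then show "bounded (range (\<lambda>x. norm x ^ k *\<^sub>R iter_deriv vs f x))"
  proof (rule bounded_subset)
    have "iter_deriv vs f x = 0" if "x \<notin> K" for x
      by (rule iter_deriv_zero_open[of "- K"]) (use assms that compact_imp_closed in auto)
    then show "range (\<lambda>x. norm x ^ k *\<^sub>R iter_deriv vs f x) \<subseteq> insert 0 ((\<lambda>x. norm x ^ k *\<^sub>R iter_deriv vs f x) ` K)"
      by (intro image_subsetI) (metis (no_types, lifting) imageI insertCI scaleR_zero_right)
  qed
qed (rule assms)

lemma one_plus_le_power2: "1 + t \<le> 2 * (1 + t\<^sup>2)" for t :: real
proof -
  have "0 \<le> (t - 1 / 4)\<^sup>2" by simp
  also have "\<dots> = t\<^sup>2 - t / 2 + 1 / 16" by (simp add: power2_eq_square algebra_simps)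
  finally have "0 \<le> 2 * t\<^sup>2 - t + 1 / 8" by simp
  then have "t \<le> 2 * t\<^sup>2 + 1" using zero_le_power2[of t] by simp
  then show ?thesis by simp
qed

text \<open>The ring here is that of the polynomials in \<open>x\<close>, with the trivial parameter type and no scaling.\<close>

lemma schwartz_modulated_gaussian:
  fixes a :: "'a::euclidean_space"
  assumes w: "Re w > 0"
  shows "schwartz (\<lambda>x. gaussian w x * cis (2 * pi * (x \<bullet> a)))"
proof -
  define B where "B = range (\<lambda>b (_::unit) (x::'a). complex_of_real (x \<bullet> b))"
  define E where "E = (\<lambda>(_::unit) x. - (of_real pi * w * of_real (x \<bullet> x)) + 2 * pi * \<i> * of_real (x \<bullet> a))"
  interpret exp_ring B UNIV "\<lambda>_. 1" E
  proof
    show "\<exists>u'\<in>fun_ring B. scaled_deriv UNIV (\<lambda>_. 1) v u u'" if "u \<in> B" for u v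
    proof -
      from that obtain b where u: "u = (\<lambda>_ x. of_real (x \<bullet> b))" by (auto simp: B_def)
      have "scaled_deriv UNIV (\<lambda>_. 1) v u (\<lambda>_ x. of_real (v \<bullet> b))"
        unfolding scaled_deriv_def u
        by (intro ballI allI exI[of _ "\<lambda>h. of_real (h \<bullet> b)"] conjI has_derivative_of_real
            has_derivative_inner_left has_derivative_ident) simp
      then show ?thesis using fun_ring.const by blast
    qed
    show "\<exists>u'\<in>fun_ring B. scaled_deriv UNIV (\<lambda>_. 1) v E u'" for v
    proof -
      have "scaled_deriv UNIV (\<lambda>_. 1) v E (\<lambda>_ x. - (2 * of_real pi * w) * of_real (x \<bullet> v) + 2 * pi * \<i> * of_real (v \<bullet> a))"
        unfolding scaled_deriv_def
      proof (intro ballI allI)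
        fix p :: unit and x :: 'a
        have "(E p has_derivative (\<lambda>h. - (2 * of_real pi * w) * of_real (x \<bullet> h) + 2 * pi * \<i> * of_real (h \<bullet> a))) (at x)"
          unfolding E_def
          by (auto intro!: derivative_eq_intros simp: fun_eq_iff inner_commute algebra_simps)
        then show "\<exists>D. (E p has_derivative D) (at x) \<and>
            1 * D v = - (2 * of_real pi * w) * of_real (x \<bullet> v) + 2 * pi * \<i> * of_real (v \<bullet> a)"
          by (intro exI conjI) auto
      qed
      moreover have "(\<lambda>_ x. - (2 * of_real pi * w) * of_real (x \<bullet> v) + 2 * pi * \<i> * of_real (v \<bullet> a)) \<in> fun_ring B"
        by (intro fun_ring.add fun_ring.mult[OF fun_ring.const] fun_ring.const fun_ring.base) (auto simp: B_def)
      ultimately show ?thesis by blast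
    qed
  qed (auto intro: fun_ring.const)
  have f: "(\<lambda>x. gaussian w x * cis (2 * pi * (x \<bullet> a))) = (\<lambda>x. (\<lambda>_ _. 1) () x * exp (E () x))"
    by (simp add: fun_eq_iff E_def gaussian_def cis_conv_exp exp_add[symmetric] mult_ac)
  show ?thesis
    unfolding schwartz_def f
  proof (intro conjI allI impI)
    show "smooth (\<lambda>x. (\<lambda>_ _. 1) () x * exp (E () x))"
      by (rule smooth_ring_exp) (auto intro: fun_ring.const)
    fix k and vs :: "'a list" assume vs: "set vs \<subseteq> Basis"
    obtain u where u: "u \<in> fun_ring B"
      and eq: "\<And>x. iter_deriv vs (\<lambda>x. (\<lambda>_ _. 1) () x * exp (E () x)) x = u () x * exp (E () x)"
      using iter_deriv_ring_exp[OF fun_ring.const vs, of 1] by auto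
    have "\<exists>C\<ge>0. \<exists>l. \<forall>(p, x)\<in>UNIV. norm (u p x) \<le> C * (1 + norm x) ^ l"
    proof (rule fun_ring_bound[OF _ _ u])
      fix u assume "u \<in> B"
      then obtain b where ub: "u = (\<lambda>_ x. of_real (x \<bullet> b))" by (auto simp: B_def)
      have "norm (u p x) \<le> norm b * (1 + norm x) ^ 1" for p x
      proof -
        have "norm (u p x) \<le> norm x * norm b" unfolding ub by (simp add: Cauchy_Schwarz_ineq2)
        then show ?thesis using norm_ge_zero[of b] by (simp add: algebra_simps add_increasing)
      qed
      then show "\<exists>C l. \<forall>(p, x)\<in>UNIV. norm (u p x) \<le> C * (1 + norm x) ^ l" by blast
    qed auto
    then obtain C l where C: "C \<ge> 0" "\<And>x. norm (u () x) \<le> C * (1 + norm x) ^ l" by auto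
    obtain D where D: "\<And>t. t \<ge> 0 \<Longrightarrow> (1 + t) ^ (k + l) * exp (- (pi * Re w) * t) \<le> D"
      using polynomial_exp_bounded[of "pi * Re w"] w by auto
    have "norm (norm x ^ k *\<^sub>R iter_deriv vs (\<lambda>x. (\<lambda>_ _. 1) () x * exp (E () x)) x) \<le> 2 ^ (k + l) * (C * D)" for x
    proof -
      have le: "1 + norm x \<le> 2 * (1 + (norm x)\<^sup>2)" by (rule one_plus_le_power2)
      have nE: "norm (exp (E () x)) = exp (- (pi * Re w) * (norm x)\<^sup>2)"
        by (simp add: E_def power2_norm_eq_inner)
      have "norm (norm x ^ k *\<^sub>R iter_deriv vs (\<lambda>x. (\<lambda>_ _. 1) () x * exp (E () x)) x) =
          norm x ^ k * (norm (u () x) * exp (- (pi * Re w) * (norm x)\<^sup>2))"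
        by (simp only: eq norm_scaleR norm_mult nE) simp
      also have "\<dots> \<le> (1 + norm x) ^ k * ((C * (1 + norm x) ^ l) * exp (- (pi * Re w) * (norm x)\<^sup>2))"
        using C by (intro mult_mono power_mono) auto
      also have "\<dots> = C * ((1 + norm x) ^ (k + l) * exp (- (pi * Re w) * (norm x)\<^sup>2))"
        by (simp add: power_add)
      also have "\<dots> \<le> C * ((2 * (1 + (norm x)\<^sup>2)) ^ (k + l) * exp (- (pi * Re w) * (norm x)\<^sup>2))"
        using C le by (intro mult_left_mono mult_right_mono power_mono) auto
      also have "\<dots> = 2 ^ (k + l) * (C * ((1 + (norm x)\<^sup>2) ^ (k + l) * exp (- (pi * Re w) * (norm x)\<^sup>2)))"
        by (simp only: power_mult_distrib) simp
      also have "\<dots> \<le> 2 ^ (k + l) * (C * D)" using C D by (intro mult_left_mono) auto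
      finally show ?thesis .
    qed
    then show "bounded (range (\<lambda>x. norm x ^ k *\<^sub>R iter_deriv vs (\<lambda>x. (\<lambda>_ _. 1) () x * exp (E () x)) x))"
      unfolding bounded_iff by blast
  qed
qed

section \<open>Sobolev norms of the dyadic pieces of a chirp\<close>

text \<open>The Sobolev estimates hold for every symmetric \<open>Q\<close>; the lower bound for the multiplier norm depends
on the particular form \<open>off_diagonal\<close> below.\<close>

definition chirp :: "('a::euclidean_space \<Rightarrow> 'a) \<Rightarrow> real \<Rightarrow> 'a \<Rightarrow> complex" where
  "chirp Q N \<eta> = exp (of_real (- pi * (\<eta> \<bullet> \<eta>)) + \<i> * of_real (pi * N * (\<eta> \<bullet> Q \<eta>)))"

lemma norm_chirp: "norm (chirp Q N \<eta>) = exp (- pi * (norm \<eta>)\<^sup>2)"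
  by (simp add: chirp_def power2_norm_eq_inner)

text \<open>Majorant of the derivatives of a chirp: the polynomial factors that differentiation produces are
bounded by a power of \<open>1 + |\<eta>|\<close>.\<close>

definition gauss_weight :: "nat \<Rightarrow> 'a::euclidean_space \<Rightarrow> real" where
  "gauss_weight l \<eta> = (1 + norm \<eta>) ^ l * exp (- pi * (norm \<eta>)\<^sup>2)"

lemma gauss_weight_nonneg: "0 \<le> gauss_weight l \<eta>"
  by (simp add: gauss_weight_def)

lemma measurable_gauss_weight [measurable]: "gauss_weight l \<in> borel_measurable borel"
  unfolding gauss_weight_def[abs_def] by measurable

lemma gauss_weight_le: "gauss_weight l \<eta> \<le> 2 ^ l * (1 + (norm \<eta>)\<^sup>2) ^ l * exp (- pi * (norm \<eta>)\<^sup>2)"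
proof -
  have "1 + norm \<eta> \<le> 2 * (1 + (norm \<eta>)\<^sup>2)" by (rule one_plus_le_power2)
  then have "(1 + norm \<eta>) ^ l \<le> (2 * (1 + (norm \<eta>)\<^sup>2)) ^ l" by (intro power_mono) auto
  then show ?thesis by (simp only: gauss_weight_def power_mult_distrib) (intro mult_right_mono, auto)
qed

lemma gauss_weight_bounded: "\<exists>D\<ge>0. \<forall>\<eta>. gauss_weight l \<eta> \<le> D"
proof -
  obtain D where D: "\<And>t. t \<ge> 0 \<Longrightarrow> (1 + t) ^ l * exp (- pi * t) \<le> D"
    using polynomial_exp_bounded[of pi l] by auto
  have "gauss_weight l \<eta> \<le> 2 ^ l * D" for \<eta> :: 'a
  proof -
    have "2 ^ l * ((1 + (norm \<eta>)\<^sup>2) ^ l * exp (- pi * (norm \<eta>)\<^sup>2)) \<le> 2 ^ l * D"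
      by (intro mult_left_mono D) auto
    then show ?thesis by (intro order_trans[OF gauss_weight_le]) (simp only: mult.assoc)
  qed
  moreover have "0 \<le> 2 ^ l * D" using D[of 0] by (simp add: order_trans[OF zero_le_one])
  ultimately show ?thesis by blast
qed

text \<open>Uniformity in the dyadic scale \<open>\<tau>\<close>. For \<open>\<tau> \<ge> 1/4\<close> the variable \<open>\<eta>\<close> substitutes for \<open>x\<close> at the price
of \<open>(\<epsilon> / \<tau>)\<^sup>d\<close>. For smaller \<open>\<tau>\<close> the ball of radius 2 is mapped into the ball of radius \<open>1/2\<close>, away from \<open>a\<close>, so
that \<open>|\<eta>| \<ge> 1 / (2 \<epsilon>)\<close> and \<open>d\<close> powers of \<open>\<epsilon>\<close> are bought with \<open>d\<close> powers of \<open>|\<eta>|\<close>.\<close>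

lemma gauss_weight_L1:
  fixes a :: "'a::euclidean_space"
  assumes a: "norm a = 1"
  shows "\<exists>D\<ge>0. \<forall>\<epsilon> \<tau>. 0 < \<epsilon> \<longrightarrow> \<epsilon> \<le> 1 \<longrightarrow> 0 < \<tau> \<longrightarrow>
    (\<integral>\<^sup>+x. ennreal (gauss_weight l ((1 / \<epsilon>) *\<^sub>R (\<tau> *\<^sub>R x - a))) * indicator (cball 0 2) x \<partial>lborel) \<le> ennreal (D * \<epsilon> ^ DIM('a))"
proof -
  let ?d = "DIM('a)"
  have "integrable lborel (\<lambda>\<eta>::'a. complex_of_real (gauss_weight l \<eta>))"
  proof (rule integrable_gaussian_bound[of pi _ "2 ^ l" l])
    show "norm (complex_of_real (gauss_weight l x)) \<le> 2 ^ l * (1 + (norm x)\<^sup>2) ^ l * exp (- pi * (norm x)\<^sup>2)" for x :: 'a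
      by (simp only: norm_of_real abs_of_nonneg[OF gauss_weight_nonneg] gauss_weight_le)
  qed auto
  then have "integrable lborel (gauss_weight l :: 'a \<Rightarrow> real)" by (simp only: complex_of_real_integrable_eq)
  then have "(\<integral>\<^sup>+\<eta>. ennreal (gauss_weight l (\<eta> :: 'a)) \<partial>lborel) < \<infinity>"
    using gauss_weight_nonneg[of l, where ?'a = 'a] by (simp add: integrable_iff_bounded abs_of_nonneg)
  then obtain I where I: "I \<ge> 0" "(\<integral>\<^sup>+\<eta>. ennreal (gauss_weight l (\<eta> :: 'a)) \<partial>lborel) = ennreal I"
    by (cases "\<integral>\<^sup>+\<eta>. ennreal (gauss_weight l (\<eta> :: 'a)) \<partial>lborel") auto
  obtain D where D: "D \<ge> 0" "\<And>\<eta>::'a. gauss_weight (l + ?d) \<eta> \<le> D" using gauss_weight_bounded by blast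
  define V where "V = measure lborel (cball (0::'a) 2)"
  have V: "emeasure lborel (cball (0::'a) 2) = ennreal V" "V \<ge> 0"
    using emeasure_bounded_finite[OF bounded_cball[of "0::'a" 2]] unfolding V_def
    by (auto intro!: emeasure_eq_ennreal_measure)
  show ?thesis
  proof (intro exI[of _ "4 ^ ?d * I + 2 ^ ?d * D * V"] conjI allI impI)
    show "0 \<le> 4 ^ ?d * I + 2 ^ ?d * D * V" using I D V by simp
    fix \<epsilon> \<tau> :: real assume \<epsilon>: "0 < \<epsilon>" "\<epsilon> \<le> 1" and \<tau>: "0 < \<tau>"
    let ?\<eta> = "\<lambda>x. (1 / \<epsilon>) *\<^sub>R (\<tau> *\<^sub>R x - a)"
    let ?L = "\<integral>\<^sup>+x. ennreal (gauss_weight l (?\<eta> x)) * indicator (cball 0 2) x \<partial>lborel"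
    show "?L \<le> ennreal ((4 ^ ?d * I + 2 ^ ?d * D * V) * \<epsilon> ^ ?d)"
    proof (cases "\<tau> \<ge> 1 / 4")
      case True
      have "?L \<le> (\<integral>\<^sup>+x. ennreal (gauss_weight l (?\<eta> x)) \<partial>lborel)"
        by (intro nn_integral_mono) (auto split: split_indicator)
      also have "\<dots> = ennreal ((\<epsilon> / \<tau>) ^ ?d) * (\<integral>\<^sup>+x. ennreal (gauss_weight l (?\<eta> ((1 / \<tau>) *\<^sub>R a + (\<epsilon> / \<tau>) *\<^sub>R x))) \<partial>lborel)"
        by (rule nn_integral_lborel_affine) (use \<epsilon> \<tau> in auto)
      also have "?\<eta> ((1 / \<tau>) *\<^sub>R a + (\<epsilon> / \<tau>) *\<^sub>R x) = x" for x
        using \<epsilon> \<tau> by (simp add: scaleR_add_right)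
      then have "(\<integral>\<^sup>+x. ennreal (gauss_weight l (?\<eta> ((1 / \<tau>) *\<^sub>R a + (\<epsilon> / \<tau>) *\<^sub>R x))) \<partial>lborel) = ennreal I"
        by (simp only: I)
      also have "ennreal ((\<epsilon> / \<tau>) ^ ?d) * ennreal I = ennreal ((\<epsilon> / \<tau>) ^ ?d * I)"
        using I \<epsilon> \<tau> by (simp add: ennreal_mult)
      also have "\<dots> \<le> ennreal ((4 ^ ?d * I + 2 ^ ?d * D * V) * \<epsilon> ^ ?d)"
      proof (rule ennreal_leI)
        have "\<epsilon> / \<tau> \<le> 4 * \<epsilon>" using True \<epsilon> \<tau> by (simp add: field_simps)
        then have "(\<epsilon> / \<tau>) ^ ?d \<le> (4 * \<epsilon>) ^ ?d" using \<epsilon> \<tau> by (intro power_mono) auto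
        then have "(\<epsilon> / \<tau>) ^ ?d * I \<le> (4 * \<epsilon>) ^ ?d * I" using I by (intro mult_right_mono) auto
        also have "\<dots> \<le> (4 * \<epsilon>) ^ ?d * I + 2 ^ ?d * D * V * \<epsilon> ^ ?d" using D V \<epsilon> by simp
        finally show "(\<epsilon> / \<tau>) ^ ?d * I \<le> (4 ^ ?d * I + 2 ^ ?d * D * V) * \<epsilon> ^ ?d"
          by (simp only: power_mult_distrib) (simp add: algebra_simps)
      qed
      finally show ?thesis .
    next
      case False
      have le: "gauss_weight l (?\<eta> x) \<le> (2 * \<epsilon>) ^ ?d * D" if "x \<in> cball 0 2" for x
      proof -
        have "norm (\<tau> *\<^sub>R x) \<le> 1 / 2"
        proof -
          have "\<tau> * norm x \<le> (1 / 4) * 2" using False \<tau> that by (intro mult_mono) auto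
          then show ?thesis using \<tau> by simp
        qed
        then have "1 / 2 \<le> norm (\<tau> *\<^sub>R x - a)"
          using norm_triangle_ineq2[of a "\<tau> *\<^sub>R x"] a by (simp add: norm_minus_commute)
        then have "1 \<le> 2 * \<epsilon> * norm (?\<eta> x)" using \<epsilon> by simp
        also have "\<dots> \<le> 2 * \<epsilon> * (1 + norm (?\<eta> x))" using \<epsilon> by (intro mult_left_mono) auto
        finally have "1 \<le> (2 * \<epsilon> * (1 + norm (?\<eta> x))) ^ ?d" by (rule one_le_power)
        then have "1 * gauss_weight l (?\<eta> x) \<le> (2 * \<epsilon> * (1 + norm (?\<eta> x))) ^ ?d * gauss_weight l (?\<eta> x)"
          by (intro mult_right_mono gauss_weight_nonneg)
        also have "\<dots> = (2 * \<epsilon>) ^ ?d * gauss_weight (l + ?d) (?\<eta> x)"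
          by (simp only: gauss_weight_def power_mult_distrib power_add) (simp add: mult_ac)
        also have "\<dots> \<le> (2 * \<epsilon>) ^ ?d * D" using D \<epsilon> by (intro mult_left_mono) auto
        finally show ?thesis by simp
      qed
      have "?L \<le> (\<integral>\<^sup>+x. ennreal ((2 * \<epsilon>) ^ ?d * D) * indicator (cball (0::'a) 2) x \<partial>lborel)"
        using le by (intro nn_integral_mono) (auto split: split_indicator intro!: ennreal_leI)
      also have "\<dots> = ennreal ((2 * \<epsilon>) ^ ?d * D * V)"
        using V D \<epsilon> by (simp add: nn_integral_cmult_indicator ennreal_mult)
      also have "\<dots> \<le> ennreal ((4 ^ ?d * I + 2 ^ ?d * D * V) * \<epsilon> ^ ?d)"
      proof (rule ennreal_leI)
        have "(2 * \<epsilon>) ^ ?d * D * V \<le> 4 ^ ?d * I * \<epsilon> ^ ?d + (2 * \<epsilon>) ^ ?d * D * V" using I \<epsilon> by simp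
        then show "(2 * \<epsilon>) ^ ?d * D * V \<le> (4 ^ ?d * I + 2 ^ ?d * D * V) * \<epsilon> ^ ?d"
          by (simp only: power_mult_distrib) (simp add: algebra_simps)
      qed
      finally show ?thesis .
    qed
  qed
qed

text \<open>The parameters are \<open>\<nu> = 1/N\<close>, \<open>\<epsilon>\<close> and the dyadic scale \<open>\<tau>\<close>. With \<open>\<nu>\<close> in place of \<open>N\<close> the price of a
derivative is \<open>1 / (\<epsilon> \<nu>)\<close>, and scaled derivatives involve only nonnegative powers of the parameters.\<close>

definition chirp_params :: "(real \<times> real \<times> real) set" where
  "chirp_params = {(\<nu>, \<epsilon>, \<tau>). 0 < \<nu> \<and> \<nu> \<le> 1 \<and> 0 < \<epsilon> \<and> \<epsilon> \<le> 1 \<and> 0 < \<tau>}"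

text \<open>By \<open>exp_ring\<close>, a power \<open>k\<close> of \<open>I - \<Delta>\<close> turns a dyadic piece into \<open>(N / \<epsilon>)\<^bsup>2k\<^esup>\<close> times a
polynomial in \<open>\<nu>\<close>, \<open>\<epsilon>\<close>, \<open>\<tau>\<close>, \<open>\<eta>\<close> and the derivatives of \<open>\<Psi>\<close>, times the chirp. The only unbounded
parameter is \<open>\<tau>\<close>, and on the support of \<open>\<Psi>\<close> it satisfies \<open>\<tau> \<le> 2 (1 + |\<eta>|)\<close>, because \<open>|x| \<ge> 1/2\<close>
and \<open>\<tau> x = \<epsilon> \<eta> + a\<close>. So the polynomial is dominated by a power of \<open>1 + |\<eta>|\<close> and the Gaussian factor
absorbs it.\<close>

theorem dyadic_chirp_sobolev:
  fixes \<Psi> :: "'a::euclidean_space \<Rightarrow> real" and Q :: "'a \<Rightarrow> 'a" and a :: 'a and r s :: real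
  assumes smooth: "smooth \<Psi>" and comp: "compact (support \<Psi>)"
    and annulus: "support \<Psi> \<subseteq> {\<xi>. 1 / 2 \<le> norm \<xi> \<and> norm \<xi> \<le> 2}"
    and Q: "linear Q" and sym: "\<And>x y. x \<bullet> Q y = Q x \<bullet> y" and a: "norm a = 1"
    and r: "1 < r" and s: "0 < s"
  shows "\<exists>C\<ge>0. \<forall>N \<epsilon> \<tau>. 1 \<le> N \<longrightarrow> 0 < \<epsilon> \<longrightarrow> \<epsilon> \<le> 1 \<longrightarrow> 0 < \<tau> \<longrightarrow>
    sobolev_norm r s (\<lambda>\<xi>. chirp Q N ((1 / \<epsilon>) *\<^sub>R (\<tau> *\<^sub>R \<xi> - a)) * complex_of_real (\<Psi> \<xi>)) \<le>
      ennreal (C * (N / \<epsilon>) powr s * \<epsilon> powr (DIM('a) / r))"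
proof -
  define \<eta> where "\<eta> = (\<lambda>(p :: real \<times> real \<times> real) x. (1 / fst (snd p)) *\<^sub>R (snd (snd p) *\<^sub>R x - a) :: 'a)"
  define E where "E = (\<lambda>(p :: real \<times> real \<times> real) x. complex_of_real (- pi * (\<eta> p x \<bullet> \<eta> p x)) + \<i> * of_real (pi * (1 / fst p) * (\<eta> p x \<bullet> Q (\<eta> p x))))"
  define c where "c = (\<lambda>p :: real \<times> real \<times> real. complex_of_real (fst (snd p) * fst p))"
  define B where "B = {\<lambda>p x. complex_of_real (fst p), \<lambda>p x. complex_of_real (fst (snd p)), \<lambda>p x. complex_of_real (snd (snd p))}
    \<union> range (\<lambda>b p x. complex_of_real (\<eta> p x \<bullet> b)) \<union> (\<lambda>vs p x. complex_of_real (iter_deriv vs \<Psi> x)) ` {vs. set vs \<subseteq> Basis}"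
  have Bin: "(\<lambda>p x. complex_of_real (fst p)) \<in> fun_ring B" "(\<lambda>p x. complex_of_real (fst (snd p))) \<in> fun_ring B"
    "(\<lambda>p x. complex_of_real (snd (snd p))) \<in> fun_ring B" "(\<lambda>p x. complex_of_real (\<eta> p x \<bullet> b)) \<in> fun_ring B"
    "set vs \<subseteq> Basis \<Longrightarrow> (\<lambda>p x. complex_of_real (iter_deriv vs \<Psi> x)) \<in> fun_ring B" for b vs
    by (rule fun_ring.base; force simp: B_def)+
  have d\<eta>: "(\<eta> p has_derivative (\<lambda>h. (snd (snd p) / fst (snd p)) *\<^sub>R h)) (at x)" for p x
    unfolding \<eta>_def by (auto intro!: derivative_eq_intros simp: fun_eq_iff)
  interpret exp_ring B chirp_params c E
  proof
    show "c p \<noteq> 0" if "p \<in> chirp_params" for p using that by (auto simp: c_def chirp_params_def)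
    show "(\<lambda>p x. c p) \<in> fun_ring B"
      using fun_ring.mult[OF Bin(2) Bin(1)] by (simp add: c_def)
    show "\<exists>u'\<in>fun_ring B. scaled_deriv chirp_params c v u u'" if u: "u \<in> B" and v: "v \<in> Basis" for u v
    proof -
      have const: "\<exists>u'\<in>fun_ring B. scaled_deriv chirp_params c v (\<lambda>p x. g p) u'" for g
        by (intro bexI[of _ "\<lambda>p x. 0"] fun_ring.const)
          (auto simp: scaled_deriv_def intro!: exI[of _ "\<lambda>h. 0"])
      consider "u \<in> {\<lambda>p x. complex_of_real (fst p), \<lambda>p x. complex_of_real (fst (snd p)), \<lambda>p x. complex_of_real (snd (snd p))}"
        | b where "u = (\<lambda>p x. complex_of_real (\<eta> p x \<bullet> b))"
        | vs where "set vs \<subseteq> Basis" "u = (\<lambda>p x. complex_of_real (iter_deriv vs \<Psi> x))"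
        using u unfolding B_def by auto
      then show ?thesis
      proof cases
        case 1
        then show ?thesis using const by auto
      next
        case (2 b)
        let ?u = "\<lambda>p x. complex_of_real (fst p) * complex_of_real (snd (snd p)) * complex_of_real (v \<bullet> b)"
        have "scaled_deriv chirp_params c v u ?u"
          unfolding scaled_deriv_def
        proof (intro ballI allI)
          fix p x assume p: "p \<in> chirp_params"
          have "(u p has_derivative (\<lambda>h. of_real (((snd (snd p) / fst (snd p)) *\<^sub>R h) \<bullet> b))) (at x)"
            unfolding 2 by (intro has_derivative_of_real has_derivative_inner_left d\<eta>)
          moreover have "c p * of_real (((snd (snd p) / fst (snd p)) *\<^sub>R v) \<bullet> b) = ?u p x"
            using p by (auto simp: c_def chirp_params_def field_simps)
          ultimately show "\<exists>D. (u p has_derivative D) (at x) \<and> c p * D v = ?u p x" by blast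
        qed
        moreover have "?u \<in> fun_ring B" by (intro fun_ring.mult Bin fun_ring.const)
        ultimately show ?thesis by (intro bexI[of _ ?u])
      next
        case (3 vs)
        let ?u = "\<lambda>p x. complex_of_real (fst (snd p)) * complex_of_real (fst p) * complex_of_real (iter_deriv (v # vs) \<Psi> x)"
        have "scaled_deriv chirp_params c v u ?u"
          unfolding scaled_deriv_def
        proof (intro ballI allI)
          fix p x
          have "(u p has_derivative (\<lambda>h. of_real (frechet_derivative (iter_deriv vs \<Psi>) (at x) h))) (at x)"
            unfolding 3 by (intro has_derivative_of_real smooth_has_derivative[OF smooth 3(1)])
          moreover have "c p * of_real (frechet_derivative (iter_deriv vs \<Psi>) (at x) v) = ?u p x"
            by (simp add: c_def)
          ultimately show "\<exists>D. (u p has_derivative D) (at x) \<and> c p * D v = ?u p x" by blast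
        qed
        moreover have "?u \<in> fun_ring B" using 3 v by (intro fun_ring.mult Bin) auto
        ultimately show ?thesis by (intro bexI[of _ ?u])
      qed
    qed
    show "\<exists>u'\<in>fun_ring B. scaled_deriv chirp_params c v E u'" if "v \<in> Basis" for v
    proof -
      let ?l = "\<lambda>p x. of_real (- 2 * pi) * (complex_of_real (fst p) * (complex_of_real (snd (snd p)) * complex_of_real (\<eta> p x \<bullet> v))) +
        (\<i> * of_real (2 * pi)) * (complex_of_real (snd (snd p)) * complex_of_real (\<eta> p x \<bullet> Q v))"
      have "scaled_deriv chirp_params c v E ?l"
        unfolding scaled_deriv_def
      proof (intro ballI allI)
        fix p x assume p: "p \<in> chirp_params"
        let ?D = "\<lambda>h. (snd (snd p) / fst (snd p)) *\<^sub>R h"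
        have bQ: "bounded_linear Q" using Q by (rule linear_conv_bounded_linear[THEN iffD1])
        have 1: "((\<lambda>x. \<eta> p x \<bullet> \<eta> p x) has_derivative (\<lambda>h. \<eta> p x \<bullet> ?D h + ?D h \<bullet> \<eta> p x)) (at x)"
          by (intro has_derivative_inner d\<eta>)
        have 2: "((\<lambda>x. \<eta> p x \<bullet> Q (\<eta> p x)) has_derivative (\<lambda>h. \<eta> p x \<bullet> Q (?D h) + ?D h \<bullet> Q (\<eta> p x))) (at x)"
          by (intro has_derivative_inner d\<eta> bounded_linear.has_derivative[OF bQ])
        have "(E p has_derivative (\<lambda>h. of_real (- pi * (\<eta> p x \<bullet> ?D h + ?D h \<bullet> \<eta> p x)) +
            \<i> * of_real (pi * (1 / fst p) * (\<eta> p x \<bullet> Q (?D h) + ?D h \<bullet> Q (\<eta> p x))))) (at x)"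
          unfolding E_def
          by (intro has_derivative_add has_derivative_mult_right has_derivative_of_real 1 2)
        moreover have "c p * (of_real (- pi * (\<eta> p x \<bullet> ?D v + ?D v \<bullet> \<eta> p x)) +
            \<i> * of_real (pi * (1 / fst p) * (\<eta> p x \<bullet> Q (?D v) + ?D v \<bullet> Q (\<eta> p x)))) = ?l p x"
        proof -
          have e: "Q (?D v) = (snd (snd p) / fst (snd p)) *\<^sub>R Q v" using Q by (simp add: linear_cmul)
          show ?thesis using p
            by (auto simp: e c_def chirp_params_def inner_commute[of v] sym[symmetric] field_simps)
        qed
        ultimately show "\<exists>D. (E p has_derivative D) (at x) \<and> c p * D v = ?l p x" by blast
      qed
      moreover have "?l \<in> fun_ring B" by (intro fun_ring.add fun_ring.mult fun_ring.const Bin)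
      ultimately show ?thesis by (intro bexI[of _ ?l])
    qed
  qed
  define h where "h = (\<lambda>p x. complex_of_real (iter_deriv [] \<Psi> x) * exp (E p x))"
  have zero: "\<Psi> x = 0" if "x \<notin> support \<Psi>" for x
    using that closure_subset[of "{x. \<Psi> x \<noteq> 0}"] by (auto simp: support_def)
  have closed: "closed (support \<Psi>)" by (simp add: support_def)
  have u0: "(\<lambda>p x. complex_of_real (iter_deriv [] \<Psi> x)) \<in> fun_ring B" by (rule Bin(5)) simp
  have schwartz: "schwartz (h p)" if p: "p \<in> chirp_params" for p
    unfolding h_def
    by (rule schwartz_compact_support[OF smooth_ring_exp[OF u0 p] comp]) (simp add: zero)
  define \<rho> where "\<rho> = (\<lambda>p x. norm (\<eta> p x))"
  have nE: "norm (exp (E p x)) = exp (- pi * (norm (\<eta> p x))\<^sup>2)" for p x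
    by (simp add: E_def power2_norm_eq_inner)
  have pointwise: "\<exists>C\<ge>0. \<exists>l. \<forall>p\<in>chirp_params. \<forall>x.
    norm ((helmholtz ^^ k) (h p) x) \<le> C * (1 / (fst (snd p) * fst p)) ^ (2 * k) * gauss_weight l (\<eta> p x) * indicator (support \<Psi>) x" for k
  proof -
    obtain w where w: "w \<in> fun_ring B"
      and eq: "\<And>p x. p \<in> chirp_params \<Longrightarrow> c p ^ (2 * k) * (helmholtz ^^ k) (h p) x = w p x * exp (E p x)"
      using helmholtz_ring_exp[OF u0, of k] unfolding h_def by blast
    have "\<exists>C\<ge>0. \<exists>l. \<forall>(p, x)\<in>chirp_params \<times> support \<Psi>. norm (w p x) \<le> C * (1 + \<rho> p x) ^ l"
    proof (rule fun_ring_bound[OF _ _ w])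
      show "0 \<le> \<rho> p x" for p x by (simp add: \<rho>_def)
      fix u assume "u \<in> B"
      then consider "u = (\<lambda>p x. complex_of_real (fst p)) \<or> u = (\<lambda>p x. complex_of_real (fst (snd p)))"
        | "u = (\<lambda>p x. complex_of_real (snd (snd p)))"
        | b where "u = (\<lambda>p x. complex_of_real (\<eta> p x \<bullet> b))"
        | vs where "set vs \<subseteq> Basis" "u = (\<lambda>p x. complex_of_real (iter_deriv vs \<Psi> x))"
        unfolding B_def by auto
      then show "\<exists>C l. \<forall>(p, x)\<in>chirp_params \<times> support \<Psi>. norm (u p x) \<le> C * (1 + \<rho> p x) ^ l"
      proof cases
        case 1
        then have "\<forall>(p, x)\<in>chirp_params \<times> support \<Psi>. norm (u p x) \<le> 1 * (1 + \<rho> p x) ^ 0"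
          by (auto simp: chirp_params_def)
        then show ?thesis by blast
      next
        case 2
        have "norm (u p x) \<le> 2 * (1 + \<rho> p x) ^ 1" if p: "p \<in> chirp_params" and x: "x \<in> support \<Psi>" for p x
        proof -
          obtain \<nu> \<epsilon> \<tau> where pe: "p = (\<nu>, \<epsilon>, \<tau>)" by (cases p)
          have pp: "0 < \<epsilon>" "\<epsilon> \<le> 1" "0 < \<tau>" using p by (auto simp: pe chirp_params_def)
          have "\<tau> *\<^sub>R x = \<epsilon> *\<^sub>R \<eta> p x + a" using pp by (simp add: \<eta>_def pe)
          then have "\<tau> * norm x = norm (\<epsilon> *\<^sub>R \<eta> p x + a)" using pp by (metis abs_of_pos norm_scaleR)
          also have "\<dots> \<le> \<epsilon> * norm (\<eta> p x) + 1" using norm_triangle_ineq[of "\<epsilon> *\<^sub>R \<eta> p x" a] pp a by simp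
          also have "\<dots> \<le> 1 * norm (\<eta> p x) + 1" using pp by (intro add_mono mult_right_mono) auto
          finally have "\<tau> * norm x \<le> 1 + \<rho> p x" by (simp add: \<rho>_def)
          have "\<tau> * (1 / 2) \<le> \<tau> * norm x" using annulus x pp by (intro mult_left_mono) auto
          also have "\<dots> \<le> 1 + \<rho> p x" by fact
          finally have "\<tau> \<le> 2 * (1 + \<rho> p x)" by simp
          then show ?thesis using pp by (simp add: 2 pe)
        qed
        then show ?thesis by blast
      next
        case (3 b)
        have "norm (u p x) \<le> norm b * (1 + \<rho> p x) ^ 1" for p x
          using Cauchy_Schwarz_ineq2[of "\<eta> p x" b] norm_ge_zero[of b]
          unfolding 3 \<rho>_def norm_of_real power_one_right by (simp only: distrib_left mult_1_right mult.commute[of "norm b" "norm (\<eta> p x)"])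
        then show ?thesis by blast
      next
        case (4 vs)
        have "compact (iter_deriv vs \<Psi> ` support \<Psi>)"
          by (intro compact_continuous_image comp continuous_on_subset[OF smooth_continuous[OF smooth 4(1)]]) auto
        from compact_imp_bounded[OF this]
        obtain C where "\<forall>y\<in>iter_deriv vs \<Psi> ` support \<Psi>. norm y \<le> C" unfolding bounded_iff ..
        then have "\<forall>(p, x)\<in>chirp_params \<times> support \<Psi>. norm (u p x) \<le> C * (1 + \<rho> p x) ^ 0" by (auto simp: 4)
        then show ?thesis by blast
      qed
    qed
    then obtain C l where C: "C \<ge> 0" "\<And>p x. p \<in> chirp_params \<Longrightarrow> x \<in> support \<Psi> \<Longrightarrow> norm (w p x) \<le> C * (1 + \<rho> p x) ^ l"
      by auto
    have "norm ((helmholtz ^^ k) (h p) x) \<le> C * (1 / (fst (snd p) * fst p)) ^ (2 * k) * gauss_weight l (\<eta> p x) * indicator (support \<Psi>) x"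
      if p: "p \<in> chirp_params" for p x
    proof (cases "x \<in> support \<Psi>")
      case True
      let ?M = "fst (snd p) * fst p"
      have M: "?M > 0" using p by (auto simp: chirp_params_def)
      have "norm (c p ^ (2 * k) * (helmholtz ^^ k) (h p) x) = norm (w p x * exp (E p x))" by (simp only: eq[OF p])
      then have "?M ^ (2 * k) * norm ((helmholtz ^^ k) (h p) x) = norm (w p x) * exp (- pi * (norm (\<eta> p x))\<^sup>2)"
        using M unfolding norm_mult norm_power nE c_def norm_of_real by simp
      also have "\<dots> \<le> C * (1 + \<rho> p x) ^ l * exp (- pi * (norm (\<eta> p x))\<^sup>2)"
        by (intro mult_right_mono C p True) auto
      finally have "?M ^ (2 * k) * norm ((helmholtz ^^ k) (h p) x) \<le> C * gauss_weight l (\<eta> p x)"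
        by (simp add: gauss_weight_def \<rho>_def mult.assoc)
      then have "norm ((helmholtz ^^ k) (h p) x) \<le> C * gauss_weight l (\<eta> p x) / ?M ^ (2 * k)"
        using M by (simp add: pos_le_divide_eq mult.commute)
      then show ?thesis using True M by (simp add: power_divide field_simps)
    next
      case False
      have "(helmholtz ^^ k) (h p) x = 0"
        by (rule helmholtz_zero_open[of "- support \<Psi>"]) (use False closed zero in \<open>auto simp: h_def\<close>)
      then show ?thesis using False by simp
    qed
    then show ?thesis using C(1) by blast
  qed
  have [measurable]: "cball (0 :: 'a) 2 \<in> sets borel" by simp
  have bounds: "\<exists>A\<ge>0. \<forall>p\<in>chirp_params.
      (\<forall>x. norm ((helmholtz ^^ k) (h p) x) \<le> A * (1 / (fst (snd p) * fst p)) ^ (2 * k)) \<and>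
      (\<integral>\<^sup>+x. ennreal (norm ((helmholtz ^^ k) (h p) x)) \<partial>lborel) \<le> ennreal (A * fst (snd p) ^ DIM('a) * (1 / (fst (snd p) * fst p)) ^ (2 * k))" for k
  proof -
    obtain C l where C: "C \<ge> 0" and le: "\<And>p x. p \<in> chirp_params \<Longrightarrow>
      norm ((helmholtz ^^ k) (h p) x) \<le> C * (1 / (fst (snd p) * fst p)) ^ (2 * k) * gauss_weight l (\<eta> p x) * indicator (support \<Psi>) x"
      using pointwise by blast
    obtain D where D: "D \<ge> 0" "\<And>\<eta>::'a. gauss_weight l \<eta> \<le> D" using gauss_weight_bounded by blast
    obtain D1 where D1: "D1 \<ge> 0" "\<And>\<epsilon> \<tau>. 0 < \<epsilon> \<Longrightarrow> \<epsilon> \<le> 1 \<Longrightarrow> 0 < \<tau> \<Longrightarrow>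
      (\<integral>\<^sup>+x. ennreal (gauss_weight l ((1 / \<epsilon>) *\<^sub>R (\<tau> *\<^sub>R x - a))) * indicator (cball 0 2) x \<partial>lborel) \<le> ennreal (D1 * \<epsilon> ^ DIM('a))"
      using gauss_weight_L1[OF a, of l] by blast
    show ?thesis
    proof (intro exI[of _ "C * (D + D1)"] conjI ballI allI)
      show "0 \<le> C * (D + D1)" using C D D1 by simp
    next
      fix p x assume p: "p \<in> chirp_params"
      let ?M = "1 / (fst (snd p) * fst p)"
      have M: "?M > 0" using p by (auto simp: chirp_params_def)
      have "C * ?M ^ (2 * k) * gauss_weight l (\<eta> p x) * indicator (support \<Psi>) x \<le> C * ?M ^ (2 * k) * (D + D1) * 1"
        using C D D1 M gauss_weight_nonneg[of l "\<eta> p x"] order_trans[OF D(2)[of "\<eta> p x"], of "D + D1"]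
        by (intro mult_mono mult_nonneg_nonneg) (auto simp: indicator_def)
      then show "norm ((helmholtz ^^ k) (h p) x) \<le> C * (D + D1) * ?M ^ (2 * k)"
        using le[OF p, of x] by (simp add: mult_ac)
    next
      fix p assume p: "p \<in> chirp_params"
      let ?M = "1 / (fst (snd p) * fst p)" and ?\<epsilon> = "fst (snd p)"
      have M: "?M > 0" and \<epsilon>: "0 < ?\<epsilon>" "?\<epsilon> \<le> 1" "0 < snd (snd p)" using p by (auto simp: chirp_params_def)
      have "(\<integral>\<^sup>+x. ennreal (norm ((helmholtz ^^ k) (h p) x)) \<partial>lborel) \<le>
          (\<integral>\<^sup>+x. ennreal (C * ?M ^ (2 * k)) * (ennreal (gauss_weight l (\<eta> p x)) * indicator (cball 0 2) x) \<partial>lborel)"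
      proof (rule nn_integral_mono)
        fix x
        have "C * ?M ^ (2 * k) * gauss_weight l (\<eta> p x) * indicator (support \<Psi>) x \<le>
            C * ?M ^ (2 * k) * (gauss_weight l (\<eta> p x) * indicator (cball 0 2) x)"
          using C M gauss_weight_nonneg[of l "\<eta> p x"] annulus by (auto split: split_indicator)
        from order_trans[OF le[OF p] this]
        have "ennreal (norm ((helmholtz ^^ k) (h p) x)) \<le> ennreal (C * ?M ^ (2 * k) * (gauss_weight l (\<eta> p x) * indicator (cball 0 2) x))"
          by (rule ennreal_leI)
        also have "\<dots> = ennreal (C * ?M ^ (2 * k)) * (ennreal (gauss_weight l (\<eta> p x)) * indicator (cball 0 2) x)"
          using C M by (subst ennreal_mult') (auto split: split_indicator)
        finally show "ennreal (norm ((helmholtz ^^ k) (h p) x)) \<le> \<dots>" .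
      qed
      also have "\<dots> = ennreal (C * ?M ^ (2 * k)) * (\<integral>\<^sup>+x. ennreal (gauss_weight l (\<eta> p x)) * indicator (cball 0 2) x \<partial>lborel)"
        unfolding \<eta>_def by (rule nn_integral_cmult) measurable
      also have "\<dots> \<le> ennreal (C * ?M ^ (2 * k)) * ennreal (D1 * ?\<epsilon> ^ DIM('a))"
        unfolding \<eta>_def by (intro mult_left_mono D1 \<epsilon>) auto
      also have "\<dots> = ennreal (C * ?M ^ (2 * k) * (D1 * ?\<epsilon> ^ DIM('a)))"
        using C M by (intro ennreal_mult'[symmetric]) auto
      also have "\<dots> \<le> ennreal (C * (D + D1) * ?\<epsilon> ^ DIM('a) * ?M ^ (2 * k))"
      proof (rule ennreal_leI)
        have "C * ?M ^ (2 * k) * (D1 * ?\<epsilon> ^ DIM('a)) \<le> C * ?M ^ (2 * k) * ((D + D1) * ?\<epsilon> ^ DIM('a))"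
          using C M D \<epsilon> by (intro mult_left_mono mult_right_mono mult_nonneg_nonneg) auto
        then show "C * ?M ^ (2 * k) * (D1 * ?\<epsilon> ^ DIM('a)) \<le> C * (D + D1) * ?\<epsilon> ^ DIM('a) * ?M ^ (2 * k)"
          by (simp add: mult_ac)
      qed
      finally show "(\<integral>\<^sup>+x. ennreal (norm ((helmholtz ^^ k) (h p) x)) \<partial>lborel) \<le>
        ennreal (C * (D + D1) * ?\<epsilon> ^ DIM('a) * ?M ^ (2 * k))" .
    qed
  qed
  obtain C0 k where C0: "0 \<le> C0"
    and sob: "\<And>(h :: 'a \<Rightarrow> complex) A A1 M. schwartz h \<Longrightarrow> 0 \<le> A \<Longrightarrow> 0 \<le> A1 \<Longrightarrow> 0 < M \<Longrightarrow>
      (\<And>j x. j \<in> {k, Suc k} \<Longrightarrow> norm ((helmholtz ^^ j) h x) \<le> A * M ^ (2 * j)) \<Longrightarrow>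
      (\<And>j. j \<in> {k, Suc k} \<Longrightarrow> (\<integral>\<^sup>+x. ennreal (norm ((helmholtz ^^ j) h x)) \<partial>lborel) \<le> ennreal (A1 * M ^ (2 * j))) \<Longrightarrow>
      sobolev_norm r s h \<le> ennreal (C0 * (A powr (1 - 1 / r) * A1 powr (1 / r)) * M powr s)"
    using sobolev_norm_upper_bound[OF r s, where ?'a = 'a] by blast
  obtain A B' where A: "A \<ge> 0" "\<And>p x. p \<in> chirp_params \<Longrightarrow> norm ((helmholtz ^^ k) (h p) x) \<le> A * (1 / (fst (snd p) * fst p)) ^ (2 * k)"
      "\<And>p. p \<in> chirp_params \<Longrightarrow> (\<integral>\<^sup>+x. ennreal (norm ((helmholtz ^^ k) (h p) x)) \<partial>lborel) \<le> ennreal (A * fst (snd p) ^ DIM('a) * (1 / (fst (snd p) * fst p)) ^ (2 * k))"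
    and B': "B' \<ge> 0" "\<And>p x. p \<in> chirp_params \<Longrightarrow> norm ((helmholtz ^^ Suc k) (h p) x) \<le> B' * (1 / (fst (snd p) * fst p)) ^ (2 * Suc k)"
      "\<And>p. p \<in> chirp_params \<Longrightarrow> (\<integral>\<^sup>+x. ennreal (norm ((helmholtz ^^ Suc k) (h p) x)) \<partial>lborel) \<le> ennreal (B' * fst (snd p) ^ DIM('a) * (1 / (fst (snd p) * fst p)) ^ (2 * Suc k))"
    using bounds[of k] bounds[of "Suc k"] by metis
  show ?thesis
  proof (intro exI[of _ "C0 * (A + B')"] conjI allI impI)
    show "0 \<le> C0 * (A + B')" using C0 A B' by simp
    fix N \<epsilon> \<tau> :: real assume N: "1 \<le> N" and \<epsilon>: "0 < \<epsilon>" "\<epsilon> \<le> 1" and \<tau>: "0 < \<tau>"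
    define p where "p = (1 / N, \<epsilon>, \<tau>)"
    have p: "p \<in> chirp_params" using N \<epsilon> \<tau> by (auto simp: p_def chirp_params_def)
    have M: "1 / (fst (snd p) * fst p) = N / \<epsilon>" and pe: "fst (snd p) = \<epsilon>" using N \<epsilon> by (auto simp: p_def)
    have Mp: "N / \<epsilon> > 0" using N \<epsilon> by simp
    have h_eq: "h p = (\<lambda>\<xi>. chirp Q N ((1 / \<epsilon>) *\<^sub>R (\<tau> *\<^sub>R \<xi> - a)) * complex_of_real (\<Psi> \<xi>))"
    proof
      fix \<xi>
      have e: "\<eta> p \<xi> = (1 / \<epsilon>) *\<^sub>R (\<tau> *\<^sub>R \<xi> - a)" "1 / fst p = N" by (simp_all add: \<eta>_def p_def)
      show "h p \<xi> = chirp Q N ((1 / \<epsilon>) *\<^sub>R (\<tau> *\<^sub>R \<xi> - a)) * complex_of_real (\<Psi> \<xi>)"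
        by (simp only: h_def E_def chirp_def e iter_deriv.simps) (rule mult.commute)
    qed
    have "sobolev_norm r s (h p) \<le> ennreal (C0 * ((A + B') powr (1 - 1 / r) * ((A + B') * \<epsilon> ^ DIM('a)) powr (1 / r)) * (N / \<epsilon>) powr s)"
    proof (rule sob[OF schwartz[OF p]])
      show "norm ((helmholtz ^^ j) (h p) x) \<le> (A + B') * (N / \<epsilon>) ^ (2 * j)" if j: "j \<in> {k, Suc k}" for j x
      proof -
        have le: "A * (N / \<epsilon>) ^ l \<le> (A + B') * (N / \<epsilon>) ^ l" "B' * (N / \<epsilon>) ^ l \<le> (A + B') * (N / \<epsilon>) ^ l" for l
          using A B' Mp by (auto intro!: mult_right_mono)
        consider "j = k" | "j = Suc k" using j by auto
        then show ?thesis
        proof cases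
          case 1
          show ?thesis unfolding 1 by (rule order_trans[OF A(2)[OF p, of x, unfolded M] le(1)])
        next
          case 2
          show ?thesis unfolding 2 by (rule order_trans[OF B'(2)[OF p, of x, unfolded M] le(2)])
        qed
      qed
      show "(\<integral>\<^sup>+x. ennreal (norm ((helmholtz ^^ j) (h p) x)) \<partial>lborel) \<le> ennreal ((A + B') * \<epsilon> ^ DIM('a) * (N / \<epsilon>) ^ (2 * j))" if j: "j \<in> {k, Suc k}" for j
      proof -
        have le: "ennreal (A * \<epsilon> ^ DIM('a) * (N / \<epsilon>) ^ l) \<le> ennreal ((A + B') * \<epsilon> ^ DIM('a) * (N / \<epsilon>) ^ l)"
          "ennreal (B' * \<epsilon> ^ DIM('a) * (N / \<epsilon>) ^ l) \<le> ennreal ((A + B') * \<epsilon> ^ DIM('a) * (N / \<epsilon>) ^ l)" for l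
          using A B' Mp \<epsilon> by (auto intro!: mult_right_mono ennreal_leI)
        consider "j = k" | "j = Suc k" using j by auto
        then show ?thesis
        proof cases
          case 1
          show ?thesis unfolding 1 by (rule order_trans[OF A(3)[OF p, unfolded M, unfolded pe] le(1)])
        next
          case 2
          show ?thesis unfolding 2 by (rule order_trans[OF B'(3)[OF p, unfolded M, unfolded pe] le(2)])
        qed
      qed
    qed (use A B' Mp \<epsilon> in auto)
    also have "C0 * ((A + B') powr (1 - 1 / r) * ((A + B') * \<epsilon> ^ DIM('a)) powr (1 / r)) * (N / \<epsilon>) powr s =
        C0 * (A + B') * (N / \<epsilon>) powr s * \<epsilon> powr (DIM('a) / r)"
    proof -
      have "((A + B') * \<epsilon> ^ DIM('a)) powr (1 / r) = (A + B') powr (1 / r) * \<epsilon> powr (DIM('a) / r)"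
        using A B' \<epsilon> by (simp add: powr_mult powr_realpow[symmetric] powr_powr)
      moreover have "(A + B') powr (1 - 1 / r) * (A + B') powr (1 / r) = A + B'"
        using A B' by (simp add: powr_add[symmetric])
      ultimately show ?thesis by (simp add: mult_ac)
    qed
    finally show "sobolev_norm r s (\<lambda>\<xi>. chirp Q N ((1 / \<epsilon>) *\<^sub>R (\<tau> *\<^sub>R \<xi> - a)) * complex_of_real (\<Psi> \<xi>)) \<le>
      ennreal (C0 * (A + B') * (N / \<epsilon>) powr s * \<epsilon> powr (DIM('a) / r))" by (simp only: h_eq)
  qed
qed

section \<open>Lower bounds for multiplier norms\<close>

text \<open>The image of a Gaussian measure under \<open>S\<close> is a multiple of a Gaussian measure. With \<open>J\<close> a right
inverse of \<open>S\<close> such that \<open>|\<xi>|\<^sup>2 - |S \<xi>|\<^sup>2 / m\<close> is invariant under translation by \<open>J t\<close>, averaging over these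
translations with a probability density \<open>\<rho>\<close> and two changes of variables separate \<open>t = S \<xi>\<close> from the rest.\<close>

lemma nn_integral_gaussian_pushforward:
  fixes S :: "'a::euclidean_space \<Rightarrow> 'b::euclidean_space" and J :: "'b \<Rightarrow> 'a" and m \<alpha> :: real
  assumes S: "linear S" and J: "linear J" and SJ: "\<And>t. S (J t) = t" and m: "m > 0"
    and inner: "\<And>\<xi> t. (\<xi> + J t) \<bullet> (\<xi> + J t) = \<xi> \<bullet> \<xi> + 2 * (S \<xi> \<bullet> t) / m + (t \<bullet> t) / m"
    and [measurable]: "f \<in> borel_measurable borel"
  shows "(\<integral>\<^sup>+\<xi>. ennreal (exp (- \<alpha> * (\<xi> \<bullet> \<xi>))) * f (S \<xi>) \<partial>lborel) =
    (\<integral>\<^sup>+\<xi>. ennreal (exp (- pi * (S \<xi> \<bullet> S \<xi>)) * exp (- \<alpha> * (\<xi> \<bullet> \<xi> - (S \<xi> \<bullet> S \<xi>) / m))) \<partial>lborel) *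
    (\<integral>\<^sup>+t. ennreal (exp (- \<alpha> * ((t \<bullet> t) / m))) * f t \<partial>lborel)"
proof -
  let ?w = "\<lambda>\<xi>::'a. ennreal (exp (- \<alpha> * (\<xi> \<bullet> \<xi>)))"
  let ?\<rho> = "\<lambda>t::'b. ennreal (exp (- pi * (t \<bullet> t)))"
  let ?v = "\<lambda>\<xi>. ennreal (exp (- \<alpha> * (\<xi> \<bullet> \<xi> - (S \<xi> \<bullet> S \<xi>) / m)))"
  let ?u = "\<lambda>t::'b. ennreal (exp (- \<alpha> * ((t \<bullet> t) / m)))"
  have [measurable]: "S \<in> borel_measurable borel" "J \<in> borel_measurable borel"
    using S J by (auto intro!: borel_measurable_continuous_onI linear_continuous_on simp: linear_conv_bounded_linear)
  \<comment> \<open>\<open>\<rho>\<close> averages over the translations by \<open>J t\<close>; the standard Gaussian has integral 1.\<close>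
  have \<rho>1: "(\<integral>\<^sup>+t. ?\<rho> t \<partial>lborel) = 1" using nn_integral_gaussian[of 1, where ?'a = 'b] by simp
  have "(\<integral>\<^sup>+\<xi>. ?w \<xi> * f (S \<xi>) \<partial>lborel) = (\<integral>\<^sup>+t. ?\<rho> t * (\<integral>\<^sup>+\<xi>. ?w \<xi> * f (S \<xi>) \<partial>lborel) \<partial>lborel)"
    by (subst nn_integral_multc) (auto simp: \<rho>1[simplified])
  also have "\<dots> = (\<integral>\<^sup>+t. (\<integral>\<^sup>+\<xi>. ?\<rho> t * (?w (\<xi> + J t) * f (S \<xi> + t)) \<partial>lborel) \<partial>lborel)"
  proof (rule nn_integral_cong)
    fix t
    have "(\<integral>\<^sup>+\<xi>. ?w \<xi> * f (S \<xi>) \<partial>lborel) = (\<integral>\<^sup>+\<xi>. ?w (\<xi> + J t) * f (S (\<xi> + J t)) \<partial>lborel)"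
      by (rule nn_integral_lborel_translate[symmetric]) measurable
    also have "\<dots> = (\<integral>\<^sup>+\<xi>. ?w (\<xi> + J t) * f (S \<xi> + t) \<partial>lborel)"
      by (simp only: linear_add[OF S] SJ)
    finally show "?\<rho> t * (\<integral>\<^sup>+\<xi>. ?w \<xi> * f (S \<xi>) \<partial>lborel) = (\<integral>\<^sup>+\<xi>. ?\<rho> t * (?w (\<xi> + J t) * f (S \<xi> + t)) \<partial>lborel)"
      by (simp only:) (rule nn_integral_cmult[symmetric], measurable)
  qed
  also have "\<dots> = (\<integral>\<^sup>+\<xi>. (\<integral>\<^sup>+t. ?\<rho> t * (?w (\<xi> + J t) * f (S \<xi> + t)) \<partial>lborel) \<partial>lborel)"
    by (rule lborel_pair.Fubini') measurable
  also have "\<dots> = (\<integral>\<^sup>+\<xi>. (\<integral>\<^sup>+t. ?\<rho> (t - S \<xi>) * ?v \<xi> * (?u t * f t) \<partial>lborel) \<partial>lborel)"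
  proof (rule nn_integral_cong)
    fix \<xi>
    have wv: "?w (\<xi> + J (t + - S \<xi>)) = ?v \<xi> * ?u t" for t
    proof -
      have "(\<xi> + J (t - S \<xi>)) \<bullet> (\<xi> + J (t - S \<xi>)) = (\<xi> \<bullet> \<xi> - (S \<xi> \<bullet> S \<xi>) / m) + (t \<bullet> t) / m"
        using m unfolding inner by (simp add: inner_diff_left inner_diff_right inner_commute field_simps)
      then show ?thesis
        by (simp only: diff_conv_add_uminus[symmetric] distrib_left exp_add) (simp add: ennreal_mult)
    qed
    have "(\<integral>\<^sup>+t. ?\<rho> t * (?w (\<xi> + J t) * f (S \<xi> + t)) \<partial>lborel) =
        (\<integral>\<^sup>+t. ?\<rho> (t + - S \<xi>) * (?w (\<xi> + J (t + - S \<xi>)) * f (S \<xi> + (t + - S \<xi>))) \<partial>lborel)"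
      by (rule nn_integral_lborel_translate[symmetric]) measurable
    also have "\<dots> = (\<integral>\<^sup>+t. ?\<rho> (t - S \<xi>) * ?v \<xi> * (?u t * f t) \<partial>lborel)"
      by (simp only: wv) (simp add: mult.assoc)
    finally show "(\<integral>\<^sup>+t. ?\<rho> t * (?w (\<xi> + J t) * f (S \<xi> + t)) \<partial>lborel) = \<dots>" .
  qed
  also have "\<dots> = (\<integral>\<^sup>+t. (\<integral>\<^sup>+\<xi>. ?\<rho> (t - S \<xi>) * ?v \<xi> * (?u t * f t) \<partial>lborel) \<partial>lborel)"
    by (rule lborel_pair.Fubini') measurable
  also have "\<dots> = (\<integral>\<^sup>+t. (\<integral>\<^sup>+\<xi>. ?\<rho> (S \<xi>) * ?v \<xi> \<partial>lborel) * (?u t * f t) \<partial>lborel)"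
  proof (rule nn_integral_cong)
    fix t
    have "(\<integral>\<^sup>+\<xi>. ?\<rho> (t - S \<xi>) * ?v \<xi> \<partial>lborel) = (\<integral>\<^sup>+\<xi>. ?\<rho> (t - S (\<xi> + J t)) * ?v (\<xi> + J t) \<partial>lborel)"
      by (rule nn_integral_lborel_translate[symmetric]) measurable
    also have "\<dots> = (\<integral>\<^sup>+\<xi>. ?\<rho> (S \<xi>) * ?v \<xi> \<partial>lborel)"
    proof (rule nn_integral_cong)
      fix \<xi>
      have "(\<xi> + J t) \<bullet> (\<xi> + J t) - (S (\<xi> + J t) \<bullet> S (\<xi> + J t)) / m = \<xi> \<bullet> \<xi> - (S \<xi> \<bullet> S \<xi>) / m"
        using m unfolding inner linear_add[OF S] SJ
        by (simp add: inner_add_left inner_add_right inner_commute field_simps)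
      then have "?v (\<xi> + J t) = ?v \<xi>" by (simp only:)
      then show "?\<rho> (t - S (\<xi> + J t)) * ?v (\<xi> + J t) = ?\<rho> (S \<xi>) * ?v \<xi>"
        by (simp only: linear_add[OF S] SJ) simp
    qed
    finally show "(\<integral>\<^sup>+\<xi>. ?\<rho> (t - S \<xi>) * ?v \<xi> * (?u t * f t) \<partial>lborel) = (\<integral>\<^sup>+\<xi>. ?\<rho> (S \<xi>) * ?v \<xi> \<partial>lborel) * (?u t * f t)"
      by (subst nn_integral_multc) auto
  qed
  also have "\<dots> = (\<integral>\<^sup>+\<xi>. ?\<rho> (S \<xi>) * ?v \<xi> \<partial>lborel) * (\<integral>\<^sup>+t. ?u t * f t \<partial>lborel)"
    by (rule nn_integral_cmult) measurable
  finally show ?thesis by (simp add: ennreal_mult)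
qed

text \<open>The constant is finite and positive because the two Gaussians have finite positive mass. An
equality of measures carries the identity over to complex integrands.\<close>

lemma gaussian_pushforward:
  fixes S :: "'a::euclidean_space \<Rightarrow> 'b::euclidean_space" and J :: "'b \<Rightarrow> 'a" and m \<alpha> :: real
  assumes S: "linear S" and J: "linear J" and SJ: "\<And>t. S (J t) = t" and m: "m > 0" and \<alpha>: "\<alpha> > 0"
    and inner: "\<And>\<xi> t. (\<xi> + J t) \<bullet> (\<xi> + J t) = \<xi> \<bullet> \<xi> + 2 * (S \<xi> \<bullet> t) / m + (t \<bullet> t) / m"
  shows "\<exists>K>0. \<forall>g :: 'b \<Rightarrow> complex. g \<in> borel_measurable borel \<longrightarrow>
    (LINT \<xi>|lborel. exp (- \<alpha> * (\<xi> \<bullet> \<xi>)) *\<^sub>R g (S \<xi>)) =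
    of_real K * (LINT t|lborel. exp (- \<alpha> * ((t \<bullet> t) / m)) *\<^sub>R g t)"
proof -
  let ?w = "\<lambda>\<xi>::'a. exp (- \<alpha> * (\<xi> \<bullet> \<xi>))"
  let ?u = "\<lambda>t::'b. exp (- \<alpha> * ((t \<bullet> t) / m))"
  let ?K = "\<integral>\<^sup>+\<xi>. ennreal (exp (- pi * (S \<xi> \<bullet> S \<xi>)) * exp (- \<alpha> * (\<xi> \<bullet> \<xi> - (S \<xi> \<bullet> S \<xi>) / m))) \<partial>lborel"
  note push = nn_integral_gaussian_pushforward[OF S J SJ m inner, where \<alpha> = \<alpha>]
  have [measurable]: "S \<in> borel_measurable borel"
    using S by (auto intro!: borel_measurable_continuous_onI linear_continuous_on simp: linear_conv_bounded_linear)
  have w: "(\<integral>\<^sup>+\<xi>. ennreal (?w \<xi>) \<partial>lborel) = ennreal ((\<alpha> / pi) powr (- real DIM('a) / 2))"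
    using nn_integral_gaussian[of "\<alpha> / pi", where ?'a = 'a] \<alpha> by simp
  have u: "(\<integral>\<^sup>+t. ennreal (?u t) \<partial>lborel) = ennreal ((\<alpha> / (pi * m)) powr (- real DIM('b) / 2))"
    using nn_integral_gaussian[of "\<alpha> / (pi * m)", where ?'a = 'b] \<alpha> m by (simp add: field_simps)
  have eq: "ennreal ((\<alpha> / pi) powr (- real DIM('a) / 2)) = ?K * ennreal ((\<alpha> / (pi * m)) powr (- real DIM('b) / 2))"
    using push[of "\<lambda>_. 1"] by (simp add: w[simplified] u[simplified])
  have "?K \<noteq> top"
    using eq \<alpha> m by (auto simp: ennreal_top_mult)
  moreover have "?K \<noteq> 0" using eq \<alpha> by auto
  ultimately obtain K where K: "?K = ennreal K" "K > 0"
    by (cases ?K) (auto simp: order.strict_iff_order)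
  have dist: "distr (density lborel (\<lambda>\<xi>. ennreal (?w \<xi>))) borel S = density lborel (\<lambda>t. ennreal (K * ?u t))"
  proof (rule measure_eqI)
    fix A assume "A \<in> sets (distr (density lborel (\<lambda>\<xi>. ennreal (?w \<xi>))) borel S)"
    then have [measurable]: "A \<in> sets borel" by simp
    have "emeasure (distr (density lborel (\<lambda>\<xi>. ennreal (?w \<xi>))) borel S) A =
        (\<integral>\<^sup>+\<xi>. ennreal (?w \<xi>) * indicator A (S \<xi>) \<partial>lborel)"
      by (simp add: emeasure_distr emeasure_density indicator_def vimage_def cong: if_cong)
    also have "\<dots> = ennreal K * (\<integral>\<^sup>+t. ennreal (?u t) * indicator A t \<partial>lborel)"
      using push[of "indicator A"] K by simp
    also have "\<dots> = (\<integral>\<^sup>+t. ennreal (K * ?u t) * indicator A t \<partial>lborel)"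
      using K by (subst nn_integral_cmult[symmetric]) (auto simp: ennreal_mult mult.assoc)
    finally show "emeasure (distr (density lborel (\<lambda>\<xi>. ennreal (?w \<xi>))) borel S) A =
        emeasure (density lborel (\<lambda>t. ennreal (K * ?u t))) A"
      by (simp add: emeasure_density)
  qed simp
  have "(LINT \<xi>|lborel. ?w \<xi> *\<^sub>R g (S \<xi>)) = of_real K * (LINT t|lborel. ?u t *\<^sub>R g t)"
    if [measurable]: "g \<in> borel_measurable borel" for g :: "'b \<Rightarrow> complex"
  proof -
    have "(LINT \<xi>|lborel. ?w \<xi> *\<^sub>R g (S \<xi>)) = (LINT \<xi>|density lborel (\<lambda>\<xi>. ennreal (?w \<xi>)). g (S \<xi>))"
      by (rule integral_density[symmetric]) auto
    also have "\<dots> = (LINT t|distr (density lborel (\<lambda>\<xi>. ennreal (?w \<xi>))) borel S. g t)"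
      by (rule integral_distr[symmetric]) auto
    also have "\<dots> = (LINT t|lborel. (K * ?u t) *\<^sub>R g t)"
      unfolding dist using K by (intro integral_density) auto
    also have "\<dots> = of_real K * (LINT t|lborel. ?u t *\<^sub>R g t)"
      by (simp add: scaleR_scaleR[symmetric] scaleR_conv_of_real mult.assoc del: scaleR_scaleR)
    finally show ?thesis .
  qed
  with K(2) show ?thesis by blast
qed

text \<open>Only the modulus is computed, which avoids the branch of the square root. Inversion at 0 gives
\<open>\<kappa>(w) \<kappa>(1/w) = 1\<close> for the integral \<open>\<kappa>\<close>; as \<open>1/w\<close> is a positive multiple of the conjugate of \<open>w\<close>, scaling
expresses \<open>\<kappa>(1/w)\<close> by the conjugate of \<open>\<kappa>(w)\<close>.\<close>

lemma norm_integral_gaussian: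
  assumes w: "Re w > 0"
  shows "norm (LINT x|lborel. gaussian w (x :: 'a::euclidean_space)) = norm w powr (- real DIM('a) / 2)"
proof -
  let ?\<kappa> = "\<lambda>w. LINT x|lborel. gaussian w (x :: 'a)"
  let ?c = "1 / (norm w)\<^sup>2"
  have w0: "w \<noteq> 0" using w by auto
  have c: "?c > 0" using w0 by simp
  have inv: "1 / w = of_real ?c * cnj w"
    using w0 by (simp add: complex_norm_square field_simps of_real_power[symmetric] del: of_real_power)
  have iw: "Re (1 / w) > 0" using w c unfolding inv by (simp add: Re_divide)
  have scale: "?\<kappa> (of_real ?c * cnj w) = of_real (norm w ^ DIM('a)) * ?\<kappa> (cnj w)"
  proof -
    have g: "gaussian (of_real ?c * cnj w) (norm w *\<^sub>R x) = gaussian (cnj w) x" for x :: 'a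
    proof -
      have "complex_of_real ?c * of_real ((norm w *\<^sub>R x) \<bullet> (norm w *\<^sub>R x)) = of_real (x \<bullet> x)"
        using w0 by (simp add: power2_eq_square)
      then have "of_real pi * (of_real ?c * cnj w) * of_real ((norm w *\<^sub>R x) \<bullet> (norm w *\<^sub>R x)) = of_real pi * cnj w * of_real (x \<bullet> x)"
        by (metis mult.assoc mult.commute)
      then show ?thesis by (simp only: gaussian_def)
    qed
    have "?\<kappa> (of_real ?c * cnj w) = of_real (norm w ^ DIM('a)) * (LINT x|lborel. gaussian (of_real ?c * cnj w) (0 + norm w *\<^sub>R (x :: 'a)))"
      using w0 by (intro integral_lborel_affine) auto
    then show ?thesis by (simp only: add_0 g)
  qed
  have cnj: "?\<kappa> (cnj w) = cnj (?\<kappa> w)"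
  proof -
    have "gaussian (cnj w) x = cnj (gaussian w x)" for x :: 'a
      by (simp add: gaussian_def exp_cnj)
    then show ?thesis by simp
  qed
  have sch: "schwartz (gaussian w :: 'a \<Rightarrow> complex)"
    using schwartz_modulated_gaussian[OF w, of "0 :: 'a"] by simp
  obtain B where B: "\<And>x. norm (gaussian w (x :: 'a)) \<le> B" using schwartz_bounded_by[OF sch] by blast
  have g0: "gaussian w (0 :: 'a) = 1" by (simp add: gaussian_def)
  have "gaussian w (0 :: 'a) = (LINT \<xi>|lborel. fourier (gaussian w) \<xi> * cis (2 * pi * ((0 :: 'a) \<bullet> \<xi>)))"
    by (rule fourier_inversion[OF integrable_gaussian[OF w] continuous_gaussian B integrable_fourier[OF sch]])
  also have "\<dots> = ?\<kappa> w * ?\<kappa> (1 / w)" by (simp add: fourier_gaussian[OF w])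
  finally have "?\<kappa> w * (of_real (norm w ^ DIM('a)) * cnj (?\<kappa> w)) = 1"
    unfolding inv scale cnj using g0 by simp
  then have "norm (?\<kappa> w * (of_real (norm w ^ DIM('a)) * cnj (?\<kappa> w))) = 1" by simp
  then have "(norm (?\<kappa> w))\<^sup>2 * norm w ^ DIM('a) = 1"
    by (simp add: norm_mult norm_power power2_eq_square mult_ac)
  then have "(norm (?\<kappa> w))\<^sup>2 = (norm w powr (- real DIM('a) / 2))\<^sup>2"
    using w0 by (simp add: powr_realpow[symmetric] powr_powr powr_minus field_simps flip: powr_numeral)
  then show ?thesis by (simp add: power2_eq_iff_nonneg)
qed

lemma Lp_norm_gaussian:
  fixes f :: "'a::euclidean_space \<Rightarrow> complex"
  assumes f: "\<And>x. norm (f x) = A * exp (- (pi * b * (x \<bullet> x)))" and "A > 0" "b > 0" "p > 0"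
  shows "Lp_norm p f = ennreal (A * (p * b) powr (- real DIM('a) / (2 * p)))"
proof -
  let ?J = "(p * b) powr (- real DIM('a) / 2)"
  have "ennreal (norm (f x) powr p) = ennreal (A powr p) * ennreal (exp (- (pi * (p * b) * (x \<bullet> x))))" for x
    using assms by (simp add: f powr_mult exp_powr_real ennreal_mult'[symmetric] mult_ac)
  then have "(\<integral>\<^sup>+x. ennreal (norm (f x) powr p) \<partial>lebesgue) =
      (\<integral>\<^sup>+x. ennreal (A powr p) * ennreal (exp (- (pi * (p * b) * ((x :: 'a) \<bullet> x)))) \<partial>lborel)"
    by (simp only: nn_integral_completion)
  also have "\<dots> = ennreal (A powr p) * (\<integral>\<^sup>+x. ennreal (exp (- (pi * (p * b) * ((x :: 'a) \<bullet> x)))) \<partial>lborel)"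
    by (rule nn_integral_cmult) measurable
  also have "\<dots> = ennreal (A powr p * ?J)"
    using assms by (simp add: nn_integral_gaussian ennreal_mult'[symmetric])
  finally have I: "(\<integral>\<^sup>+x. ennreal (norm (f x) powr p) \<partial>lebesgue) = ennreal (A powr p * ?J)" .
  have "(A powr p * ?J) powr (1 / p) = A * (p * b) powr (- real DIM('a) / (2 * p))"
    using assms by (simp add: powr_mult powr_powr)
  then show ?thesis by (simp add: Lp_norm_def I)
qed

definition vec_sum :: "real^'n^'m \<Rightarrow> real^'n" where
  "vec_sum \<xi> = (\<Sum>i\<in>UNIV. \<xi> $ i)"

text \<open>The quadratic form of this operator is \<open>|\<xi>|\<^sup>2 - |\<xi>\<^sub>1 + \<dots> + \<xi>\<^sub>m|\<^sup>2\<close>, that is, minus the sum of the products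
\<open>\<xi>\<^sub>i \<bullet> \<xi>\<^sub>j\<close> over \<open>i \<noteq> j\<close>.\<close>

definition off_diagonal :: "real^'n^'m \<Rightarrow> real^'n^'m" where
  "off_diagonal \<xi> = \<xi> - (\<chi> i. vec_sum \<xi>)"

lemma linear_vec_sum: "linear vec_sum"
  by (rule linearI) (simp_all add: vec_sum_def sum.distrib scaleR_sum_right)

lemma linear_off_diagonal: "linear off_diagonal"
  by (rule linearI)
    (simp_all add: off_diagonal_def vec_eq_iff linear_add[OF linear_vec_sum] linear_cmul[OF linear_vec_sum] algebra_simps)

lemma inner_off_diagonal: "\<xi> \<bullet> off_diagonal \<eta> = \<xi> \<bullet> \<eta> - vec_sum \<xi> \<bullet> vec_sum \<eta>"
  by (simp add: off_diagonal_def inner_diff_right inner_vec_def[of \<xi>] vec_sum_def inner_sum_left sum_subtractf)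

lemma off_diagonal_symmetric: "\<xi> \<bullet> off_diagonal \<eta> = off_diagonal \<xi> \<bullet> \<eta>"
  by (simp add: inner_off_diagonal inner_commute[of "off_diagonal \<xi>"] inner_commute)

text \<open>The right inverse spreads \<open>t\<close> evenly over the \<open>m\<close> components.\<close>

lemma vec_sum_pushforward:
  assumes "\<alpha> > 0"
  shows "\<exists>K>0. \<forall>g :: real^'n \<Rightarrow> complex. g \<in> borel_measurable borel \<longrightarrow>
    (LINT \<xi>|lborel. exp (- \<alpha> * (\<xi> \<bullet> \<xi>)) *\<^sub>R g (vec_sum (\<xi> :: real^'n^'m))) =
    of_real K * (LINT t|lborel. exp (- \<alpha> * ((t \<bullet> t) / CARD('m))) *\<^sub>R g t)"
proof (rule gaussian_pushforward[where J = "\<lambda>t. \<chi> i. (1 / CARD('m)) *\<^sub>R t"])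
  show "linear (\<lambda>t. (\<chi> i. (1 / CARD('m)) *\<^sub>R t) :: real^'n^'m)"
    by (rule linearI) (simp_all add: vec_eq_iff algebra_simps)
  show "vec_sum ((\<chi> i. (1 / CARD('m)) *\<^sub>R t) :: real^'n^'m) = t" for t :: "real^'n"
    by (simp only: vec_sum_def vec_lambda_beta sum_constant_scaleR) simp
  show "(\<xi> + (\<chi> i. (1 / CARD('m)) *\<^sub>R t)) \<bullet> (\<xi> + (\<chi> i. (1 / CARD('m)) *\<^sub>R t)) =
      \<xi> \<bullet> \<xi> + 2 * (vec_sum \<xi> \<bullet> t) / CARD('m) + (t \<bullet> t) / CARD('m)" for \<xi> :: "real^'n^'m" and t
  proof -
    have "(\<xi> + (\<chi> i. (1 / CARD('m)) *\<^sub>R t)) \<bullet> (\<xi> + (\<chi> i. (1 / CARD('m)) *\<^sub>R t)) =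
        (\<Sum>i\<in>UNIV. \<xi> $ i \<bullet> \<xi> $ i + 2 / CARD('m) * (\<xi> $ i \<bullet> t) + (t \<bullet> t) / (real CARD('m))\<^sup>2)"
      unfolding inner_vec_def[of "\<xi> + _"]
      by (intro sum.cong refl)
        (simp add: inner_add_left inner_add_right inner_commute power2_eq_square algebra_simps)
    also have "\<dots> = \<xi> \<bullet> \<xi> + 2 / CARD('m) * (vec_sum \<xi> \<bullet> t) + CARD('m) * ((t \<bullet> t) / (real CARD('m))\<^sup>2)"
      by (simp add: sum.distrib inner_vec_def[of \<xi>] vec_sum_def inner_sum_left sum_distrib_left)
    also have "CARD('m) * ((t \<bullet> t) / (real CARD('m))\<^sup>2) = (t \<bullet> t) / CARD('m)"
      by (simp add: power2_eq_square)
    finally show ?thesis by simp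
  qed
qed (use assms linear_vec_sum in auto)

lemma fourier_modulated:
  assumes [measurable]: "g \<in> borel_measurable borel"
  shows "fourier (\<lambda>x. g x * cis (2 * pi * (x \<bullet> b))) \<xi> = fourier g (\<xi> - b)"
proof -
  have "g x * cis (2 * pi * (x \<bullet> b)) * cis (- 2 * pi * (x \<bullet> \<xi>)) = g x * cis (- 2 * pi * (x \<bullet> (\<xi> - b)))" for x
    by (simp add: mult.assoc cis_mult inner_diff_right algebra_simps)
  then have "(LINT x|lborel. g x * cis (2 * pi * (x \<bullet> b)) * cis (- 2 * pi * (x \<bullet> \<xi>))) = fourier g (\<xi> - b)"
    by (simp only: fourier_lborel[OF assms])
  moreover have "fourier (\<lambda>x. g x * cis (2 * pi * (x \<bullet> b))) \<xi> =
      (LINT x|lborel. g x * cis (2 * pi * (x \<bullet> b)) * cis (- 2 * pi * (x \<bullet> \<xi>)))"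
    by (rule fourier_lborel) measurable
  ultimately show ?thesis by simp
qed

text \<open>Its Fourier transform is a multiple of \<open>exp (- \<pi> (1 + i N) |\<xi> - a\<^sub>i|\<^sup>2 / \<epsilon>\<^sup>2)\<close>.\<close>

definition test_chirp :: "real \<Rightarrow> real \<Rightarrow> real^'n^'m \<Rightarrow> 'm \<Rightarrow> real^'n \<Rightarrow> complex" where
  "test_chirp N \<epsilon> a i x = gaussian (of_real (\<epsilon>\<^sup>2) / (1 + \<i> * of_real N)) x * cis (2 * pi * (x \<bullet> a $ i))"

lemma Re_test_param: "Re (of_real (\<epsilon>\<^sup>2) / (1 + \<i> * of_real N)) = \<epsilon>\<^sup>2 / (1 + N\<^sup>2)"
  by (simp add: Re_divide)

lemma norm_test_param: "norm (of_real (\<epsilon>\<^sup>2) / (1 + \<i> * of_real N)) = \<epsilon>\<^sup>2 / sqrt (1 + N\<^sup>2)"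
proof -
  have "norm (1 + \<i> * complex_of_real N) = sqrt (1 + N\<^sup>2)" by (simp add: cmod_def)
  then show ?thesis by (simp add: norm_divide norm_power)
qed

lemma test_param_pos: "\<epsilon> > 0 \<Longrightarrow> \<epsilon>\<^sup>2 / (1 + N\<^sup>2) > (0::real)"
  by (intro divide_pos_pos) (auto intro: add_pos_nonneg)

lemma schwartz_test_chirp: "\<epsilon> > 0 \<Longrightarrow> schwartz (test_chirp N \<epsilon> a i)"
  unfolding test_chirp_def[abs_def]
  by (intro schwartz_modulated_gaussian) (simp only: Re_test_param test_param_pos)

text \<open>After the substitution \<open>\<xi> = a + \<epsilon> \<eta>\<close> the phases \<open>- \<pi> N |\<eta>\<^sub>i|\<^sup>2\<close> of the inputs cancel against the
multiplier, and the integrand depends on \<open>\<eta>\<close> only through \<open>|\<eta>|\<^sup>2\<close> and the sum of the components.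
Pushing forward along the sum leaves the Fourier transform of one Gaussian with parameter \<open>2/m + i N\<close>.\<close>

lemma multiplier_op_test_chirp:
  fixes a :: "real^'n^'m" and x :: "real^'n" and N \<epsilon> :: real
  assumes \<epsilon>: "\<epsilon> > 0"
    and K: "\<And>g :: real^'n \<Rightarrow> complex. g \<in> borel_measurable borel \<Longrightarrow>
      (LINT \<xi>|lborel. exp (- (2 * pi) * (\<xi> \<bullet> \<xi>)) *\<^sub>R g (vec_sum (\<xi> :: real^'n^'m))) =
      of_real K * (LINT t|lborel. exp (- (2 * pi) * ((t \<bullet> t) / CARD('m))) *\<^sub>R g t)"
  defines "W \<equiv> of_real (\<epsilon>\<^sup>2) / (1 + \<i> * of_real N)" and "z \<equiv> Complex (2 / CARD('m)) N"
  shows "multiplier_op (\<lambda>\<xi>. chirp off_diagonal N ((1 / \<epsilon>) *\<^sub>R (\<xi> - a))) (test_chirp N \<epsilon> a) x =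
    of_real (\<epsilon> ^ DIM(real^'n^'m)) * (LINT y|lborel. gaussian W (y :: real^'n)) ^ CARD('m) *
      cis (2 * pi * (x \<bullet> vec_sum a)) * (of_real K * ((LINT y|lborel. gaussian z (y :: real^'n)) * gaussian (1 / z) (\<epsilon> *\<^sub>R x)))"
proof -
  let ?\<kappa> = "LINT y|lborel. gaussian W (y :: real^'n)"
  have N1: "1 + \<i> * of_real N \<noteq> 0" by (auto simp: complex_eq_iff)
  have W: "Re W > 0" unfolding W_def Re_test_param by (rule test_param_pos[OF \<epsilon>])
  have iW: "1 / W = (1 + \<i> * of_real N) * of_real (1 / \<epsilon>\<^sup>2)" using \<epsilon> N1 by (simp add: W_def)
  have z: "Re z > 0" by (simp add: z_def)
  have ft: "fourier (test_chirp N \<epsilon> a i) \<zeta> = ?\<kappa> * gaussian (1 / W) (\<zeta> - a $ i)" for i \<zeta>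
    unfolding test_chirp_def[abs_def] W_def[symmetric]
    by (subst fourier_modulated) (simp_all add: fourier_gaussian[OF W])
  have prod: "(\<Prod>i\<in>UNIV. fourier (test_chirp N \<epsilon> a i) (\<xi> $ i)) =
      ?\<kappa> ^ CARD('m) * exp (- (of_real pi * (1 / W) * of_real ((\<xi> - a) \<bullet> (\<xi> - a))))" for \<xi>
  proof -
    have "(\<Prod>i\<in>UNIV. gaussian (1 / W) (\<xi> $ i - a $ i)) = exp (\<Sum>i\<in>UNIV. - (of_real pi * (1 / W) * of_real ((\<xi> $ i - a $ i) \<bullet> (\<xi> $ i - a $ i))))"
      unfolding gaussian_def by (rule exp_sum[symmetric]) simp
    also have "(\<Sum>i\<in>UNIV. - (of_real pi * (1 / W) * complex_of_real ((\<xi> $ i - a $ i) \<bullet> (\<xi> $ i - a $ i)))) =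
        - (of_real pi * (1 / W) * of_real ((\<xi> - a) \<bullet> (\<xi> - a)))"
      by (simp add: inner_vec_def[of "\<xi> - a"] sum_distrib_left sum_negf sum_divide_distrib)
    finally show ?thesis by (simp only: ft prod.distrib prod_constant)
  qed
  define g where "g t = exp (- \<i> * of_real (pi * N * (t \<bullet> t))) * cis (2 * pi * ((\<epsilon> *\<^sub>R x) \<bullet> t))" for t :: "real^'n"
  have [measurable]: "g \<in> borel_measurable borel"
    unfolding g_def[abs_def] by (intro borel_measurable_continuous_onI continuous_intros)
  let ?F = "\<lambda>\<xi>. chirp off_diagonal N ((1 / \<epsilon>) *\<^sub>R (\<xi> - a)) * (\<Prod>i\<in>UNIV. fourier (test_chirp N \<epsilon> a i) (\<xi> $ i)) *
    cis (2 * pi * (x \<bullet> (\<Sum>i\<in>UNIV. \<xi> $ i)))"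
  have "bounded_linear (off_diagonal :: real^'n^'m \<Rightarrow> _)" "bounded_linear (vec_sum :: real^'n^'m \<Rightarrow> _)"
    using linear_off_diagonal linear_vec_sum by (auto simp: linear_conv_bounded_linear)
  then have cont: "continuous_on UNIV (off_diagonal :: real^'n^'m \<Rightarrow> _)" "continuous_on UNIV (vec_sum :: real^'n^'m \<Rightarrow> _)"
    by (auto intro: linear_continuous_on)
  have [measurable]: "?F \<in> borel_measurable borel"
    unfolding prod chirp_def vec_sum_def[symmetric]
    by (intro borel_measurable_continuous_onI continuous_intros continuous_on_compose2[OF cont(1)] continuous_on_compose2[OF cont(2)]) auto
  have F: "?F (a + \<epsilon> *\<^sub>R \<eta>) = (?\<kappa> ^ CARD('m) * cis (2 * pi * (x \<bullet> vec_sum a))) * (exp (- (2 * pi) * (\<eta> \<bullet> \<eta>)) *\<^sub>R g (vec_sum \<eta>))" for \<eta>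
  proof -
    have 1: "(1 / \<epsilon>) *\<^sub>R (a + \<epsilon> *\<^sub>R \<eta> - a) = \<eta>" using \<epsilon> by simp
    have 2: "(1 / W) * of_real ((a + \<epsilon> *\<^sub>R \<eta> - a) \<bullet> (a + \<epsilon> *\<^sub>R \<eta> - a)) = (1 + \<i> * of_real N) * of_real (\<eta> \<bullet> \<eta>)"
      unfolding iW using \<epsilon> by (simp add: power2_eq_square)
    have 3: "cis (2 * pi * (x \<bullet> vec_sum (a + \<epsilon> *\<^sub>R \<eta>))) = cis (2 * pi * (x \<bullet> vec_sum a)) * cis (2 * pi * ((\<epsilon> *\<^sub>R x) \<bullet> vec_sum \<eta>))"
      by (simp add: linear_add[OF linear_vec_sum] linear_cmul[OF linear_vec_sum] inner_add_right cis_mult algebra_simps)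
    have 4: "chirp off_diagonal N \<eta> * exp (- (of_real pi * ((1 + \<i> * of_real N) * of_real (\<eta> \<bullet> \<eta>)))) =
        exp (of_real (- (2 * pi) * (\<eta> \<bullet> \<eta>))) * exp (- \<i> * of_real (pi * N * (vec_sum \<eta> \<bullet> vec_sum \<eta>)))"
      unfolding chirp_def inner_off_diagonal exp_add[symmetric]
      by (rule arg_cong[of _ _ exp]) (simp add: algebra_simps)
    have "?F (a + \<epsilon> *\<^sub>R \<eta>) = ?\<kappa> ^ CARD('m) * (chirp off_diagonal N \<eta> * exp (- (of_real pi * ((1 + \<i> * of_real N) * of_real (\<eta> \<bullet> \<eta>))))) *
        (cis (2 * pi * (x \<bullet> vec_sum a)) * cis (2 * pi * ((\<epsilon> *\<^sub>R x) \<bullet> vec_sum \<eta>)))"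
      by (simp only: prod 1 mult.assoc[of "complex_of_real pi" "1 / W"] 2 vec_sum_def[symmetric] 3) (simp only: mult_ac)
    then show ?thesis
      unfolding 4 exp_of_real g_def scaleR_conv_of_real by (simp only: mult_ac)
  qed
  have "multiplier_op (\<lambda>\<xi>. chirp off_diagonal N ((1 / \<epsilon>) *\<^sub>R (\<xi> - a))) (test_chirp N \<epsilon> a) x = (LINT \<xi>|lborel. ?F \<xi>)"
    unfolding multiplier_op_def by (rule integral_completion) measurable
  also have "\<dots> = of_real (\<epsilon> ^ DIM(real^'n^'m)) * (LINT \<eta>|lborel. ?F (a + \<epsilon> *\<^sub>R \<eta>))"
    by (rule integral_lborel_affine[OF _ \<epsilon>]) measurable
  also have "(LINT \<eta>|lborel. ?F (a + \<epsilon> *\<^sub>R \<eta>)) = (?\<kappa> ^ CARD('m) * cis (2 * pi * (x \<bullet> vec_sum a))) *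
      (LINT \<eta>|lborel. exp (- (2 * pi) * (\<eta> \<bullet> \<eta>)) *\<^sub>R g (vec_sum (\<eta> :: real^'n^'m)))"
    unfolding F by (rule integral_mult_right_zero)
  also have "(LINT \<eta>|lborel. exp (- (2 * pi) * (\<eta> \<bullet> \<eta>)) *\<^sub>R g (vec_sum (\<eta> :: real^'n^'m))) =
      of_real K * (LINT t|lborel. exp (- (2 * pi) * ((t \<bullet> t) / CARD('m))) *\<^sub>R g t)"
    by (rule K) measurable
  also have "(LINT t|lborel. exp (- (2 * pi) * ((t \<bullet> t) / CARD('m))) *\<^sub>R g t) = fourier (gaussian z) (- (\<epsilon> *\<^sub>R x))"
  proof -
    have "exp (- (2 * pi) * ((t \<bullet> t) / CARD('m))) *\<^sub>R g t = gaussian z t * cis (- 2 * pi * (t \<bullet> - (\<epsilon> *\<^sub>R x)))" for t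
    proof -
      have zz: "z = of_real (2 / CARD('m)) + \<i> * of_real N" by (simp add: z_def complex_eq_iff)
      have "complex_of_real (exp (- (2 * pi) * ((t \<bullet> t) / CARD('m)))) * exp (- \<i> * of_real (pi * N * (t \<bullet> t))) = gaussian z t"
        unfolding gaussian_def zz exp_of_real[symmetric] exp_add[symmetric]
        by (rule arg_cong[of _ _ exp]) (simp add: algebra_simps)
      then show ?thesis
        by (simp only: g_def scaleR_conv_of_real mult.assoc[symmetric]) (simp add: inner_commute)
    qed
    then show ?thesis by (simp add: fourier_lborel)
  qed
  also have "\<dots> = (LINT y|lborel. gaussian z (y :: real^'n)) * gaussian (1 / z) (\<epsilon> *\<^sub>R x)"
    by (simp add: fourier_gaussian[OF z] gaussian_def)
  finally show ?thesis by (simp only: mult.assoc)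
qed

text \<open>All norms are explicit powers of \<open>\<epsilon>\<close>, \<open>D = 1 + N\<^sup>2\<close> and \<open>Z = (2/m)\<^sup>2 + N\<^sup>2\<close>. The exponents of \<open>\<epsilon>\<close> agree on both sides
since \<open>1/p\<close> is the sum of the \<open>1/p\<^sub>i\<close>, and \<open>D\<close> and \<open>Z\<close> are comparable to \<open>N\<^sup>2\<close>. The strict bound by \<open>Y\<close> serves to
extract an admissible constant below \<open>Y\<close> from the infimum in the definition of the norm.\<close>

theorem multiplier_norm_chirp_lower_bound:
  fixes ps :: "'m::finite \<Rightarrow> real" and p :: real
  assumes ps: "\<And>i. 0 < ps i" and p: "p = inverse (\<Sum>i\<in>UNIV. 1 / ps i)"
  shows "\<exists>c>0. \<forall>N \<epsilon> Y. \<forall>a :: real^'n^'m. 1 \<le> N \<longrightarrow> 0 < \<epsilon> \<longrightarrow>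
    multiplier_norm ps p (\<lambda>\<xi>. chirp off_diagonal N ((1 / \<epsilon>) *\<^sub>R (\<xi> - a))) < ennreal Y \<longrightarrow>
    c * N powr ((real CARD('m) - 1) * real CARD('n) / 2) \<le> Y"
proof -
  let ?n = "real CARD('n)" and ?m = "real CARD('m)"
  have sum_pos: "(\<Sum>i\<in>UNIV. 1 / ps i) > 0" using ps by (intro sum_pos) auto
  have p0: "p > 0" using sum_pos by (simp add: p)
  have ip: "(\<Sum>i\<in>UNIV. 1 / ps i) = 1 / p" unfolding p by (simp add: divide_inverse)
  obtain K where K: "K > 0" and push: "\<And>g :: real^'n \<Rightarrow> complex. g \<in> borel_measurable borel \<Longrightarrow>
      (LINT \<xi>|lborel. exp (- (2 * pi) * (\<xi> \<bullet> \<xi>)) *\<^sub>R g (vec_sum (\<xi> :: real^'n^'m))) =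
      of_real K * (LINT t|lborel. exp (- (2 * pi) * ((t \<bullet> t) / CARD('m))) *\<^sub>R g t)"
    using vec_sum_pushforward[of "2 * pi"] by auto
  define e where "e = ?n / (2 * p)"
  define P0 where "P0 = (\<Prod>i\<in>UNIV. ps i powr (- ?n / (2 * ps i)))"
  have P0: "P0 > 0" unfolding P0_def using ps by (intro prod_pos) (auto simp: less_imp_neq[symmetric])
  define c1 where "c1 = K * (p * 2 / ?m) powr (- e) / P0"
  have c1: "c1 > 0" using K P0 p0 by (simp add: c1_def)
  define c where "c = c1 * 5 powr (- ?n / 4) * (1 / 2) powr e"
  have "c > 0" using c1 by (simp add: c_def)
  moreover have "c * N powr ((?m - 1) * ?n / 2) \<le> Y"
    if N: "1 \<le> N" and \<epsilon>: "0 < \<epsilon>" and Y: "multiplier_norm ps p (\<lambda>\<xi>. chirp off_diagonal N ((1 / \<epsilon>) *\<^sub>R (\<xi> - a))) < ennreal Y"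
    for N \<epsilon> Y and a :: "real^'n^'m"
  proof -
    let ?\<sigma> = "\<lambda>\<xi>. chirp off_diagonal N ((1 / \<epsilon>) *\<^sub>R (\<xi> - a))"
    let ?f = "test_chirp N \<epsilon> a"
    define W where "W = of_real (\<epsilon>\<^sup>2) / (1 + \<i> * of_real N)"
    define z where "z = Complex (2 / CARD('m)) N"
    \<comment> \<open>\<open>D\<close> is the squared modulus of \<open>1 + i N\<close>, and \<open>Z\<close> that of \<open>z\<close>; they measure the dispersion of the inputs
and of the output.\<close>
    define D where "D = 1 + N\<^sup>2"
    define Z where "Z = (2 / ?m)\<^sup>2 + N\<^sup>2"
    have D: "D > 0" by (simp add: D_def add_pos_nonneg)
    have Z: "Z > 0" using N by (simp add: Z_def add_nonneg_pos)
    have W: "Re W > 0" unfolding W_def Re_test_param by (rule test_param_pos[OF \<epsilon>])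
    have z: "Re z > 0" by (simp add: z_def)
    have nW: "norm W = \<epsilon>\<^sup>2 / sqrt D" unfolding W_def norm_test_param by (simp add: D_def)
    have nz: "norm z = sqrt Z" by (simp add: z_def Z_def cmod_def)
    have Rez: "Re (1 / z) = 2 / ?m / Z" by (simp add: z_def Z_def Re_divide)
    define A where "A = \<epsilon> ^ DIM(real^'n^'m) * (norm W powr (- ?n / 2)) ^ CARD('m) * K * norm z powr (- ?n / 2)"
    have A_pos: "A > 0" using \<epsilon> K D Z by (simp add: A_def nW nz)
    have normT: "norm (multiplier_op ?\<sigma> ?f x) = A * exp (- (pi * (2 / ?m / Z * \<epsilon>\<^sup>2) * (x \<bullet> x)))" for x
    proof -
      have "norm (gaussian (1 / z) (\<epsilon> *\<^sub>R x)) = exp (- (pi * (2 / ?m / Z * \<epsilon>\<^sup>2) * (x \<bullet> x)))"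
        unfolding norm_gaussian Rez by (simp add: power2_norm_eq_inner power_mult_distrib mult_ac)
      moreover have "norm (LINT y|lborel. gaussian W (y :: real^'n)) = norm W powr (- ?n / 2)"
        "norm (LINT y|lborel. gaussian z (y :: real^'n)) = norm z powr (- ?n / 2)"
        using norm_integral_gaussian[OF W, where ?'a = "real^'n"] norm_integral_gaussian[OF z, where ?'a = "real^'n"] by simp_all
      moreover have "multiplier_op ?\<sigma> ?f x =
          of_real (\<epsilon> ^ DIM(real^'n^'m)) * (LINT y|lborel. gaussian W (y :: real^'n)) ^ CARD('m) *
          cis (2 * pi * (x \<bullet> vec_sum a)) * (of_real K * ((LINT y|lborel. gaussian z (y :: real^'n)) * gaussian (1 / z) (\<epsilon> *\<^sub>R x)))"
        unfolding W_def z_def by (rule multiplier_op_test_chirp[OF \<epsilon> push])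
      ultimately show ?thesis
        using \<epsilon> K by (simp only: norm_mult norm_power norm_cis norm_of_real) (simp add: A_def mult_ac)
    qed
    have LT: "Lp_norm p (multiplier_op ?\<sigma> ?f) = ennreal (A * (p * (2 / ?m / Z * \<epsilon>\<^sup>2)) powr (- e))"
      using Lp_norm_gaussian[OF normT A_pos _ p0] Z \<epsilon> by (simp add: e_def)
    have Lf: "Lp_norm (ps i) (?f i) = ennreal ((ps i * (\<epsilon>\<^sup>2 / D)) powr (- ?n / (2 * ps i)))" for i
    proof -
      have "norm (?f i x) = 1 * exp (- (pi * (\<epsilon>\<^sup>2 / D) * (x \<bullet> x)))" for x
        by (simp add: test_chirp_def norm_mult norm_gaussian Re_test_param D_def power2_norm_eq_inner del: of_real_power)
      from Lp_norm_gaussian[OF this _ _ ps] show ?thesis using \<epsilon> D by simp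
    qed
    have prod_Lf: "(\<Prod>i\<in>UNIV. Lp_norm (ps i) (?f i)) = ennreal (P0 * (\<epsilon>\<^sup>2 / D) powr (- e))"
    proof -
      have "(\<Prod>i\<in>UNIV. Lp_norm (ps i) (?f i)) = ennreal (\<Prod>i\<in>UNIV. (ps i * (\<epsilon>\<^sup>2 / D)) powr (- ?n / (2 * ps i)))"
        unfolding Lf by (rule prod_ennreal) simp
      also have "(\<Prod>i\<in>UNIV. (ps i * (\<epsilon>\<^sup>2 / D)) powr (- ?n / (2 * ps i))) =
          P0 * (\<Prod>i\<in>UNIV. (\<epsilon>\<^sup>2 / D) powr (- ?n / (2 * ps i)))"
        unfolding P0_def prod.distrib[symmetric] using ps D
        by (intro prod.cong refl powr_mult)
      also have "(\<Prod>i\<in>UNIV. (\<epsilon>\<^sup>2 / D) powr (- ?n / (2 * ps i))) = (\<epsilon>\<^sup>2 / D) powr (\<Sum>i\<in>UNIV. - ?n / (2 * ps i))"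
        using \<epsilon> D by (intro powr_sum[symmetric]) auto
      also have "(\<Sum>i\<in>UNIV. - ?n / (2 * ps i)) = - ?n / 2 * (\<Sum>i\<in>UNIV. 1 / ps i)"
        by (simp add: sum_distrib_left)
      also have "\<dots> = - e" by (simp add: ip e_def)
      finally show ?thesis .
    qed
    obtain k where k: "\<And>f. (\<And>i. schwartz (f i)) \<Longrightarrow>
        Lp_norm p (multiplier_op ?\<sigma> f) \<le> k * (\<Prod>i\<in>UNIV. Lp_norm (ps i) (f i))" and kY: "k < ennreal Y"
      using Y unfolding multiplier_norm_def Inf_less_iff by blast
    have "Lp_norm p (multiplier_op ?\<sigma> ?f) \<le> k * (\<Prod>i\<in>UNIV. Lp_norm (ps i) (?f i))"
      by (intro k schwartz_test_chirp \<epsilon>)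
    also have "\<dots> \<le> ennreal Y * (\<Prod>i\<in>UNIV. Lp_norm (ps i) (?f i))"
      using kY by (intro mult_right_mono) auto
    finally have le: "ennreal (A * (p * (2 / ?m / Z * \<epsilon>\<^sup>2)) powr (- e)) \<le> ennreal (Y * (P0 * (\<epsilon>\<^sup>2 / D) powr (- e)))"
      unfolding LT prod_Lf using P0 by (subst ennreal_mult'') auto
    have Y0: "Y > 0" using kY by (metis ennreal_neg linorder_not_le not_less_zero)
    have "A * (p * (2 / ?m / Z * \<epsilon>\<^sup>2)) powr (- e) \<le> Y * (P0 * (\<epsilon>\<^sup>2 / D) powr (- e))"
      using le Y0 P0 by (subst (asm) ennreal_le_iff) auto
    moreover have "A * (p * (2 / ?m / Z * \<epsilon>\<^sup>2)) powr (- e) =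
        (D powr (?n * ?m / 4) * Z powr (- ?n / 4) * (Z / D) powr e * c1) * (P0 * (\<epsilon>\<^sup>2 / D) powr (- e))"
    proof -
      have A_eq: "A = K * D powr (?n * ?m / 4) * Z powr (- ?n / 4)"
      proof -
        have nW': "norm W = \<epsilon> powr 2 * D powr (- (1 / 2))"
        proof -
          have "D powr (- (1 / 2)) = inverse (sqrt D)"
            by (simp only: powr_minus powr_half_sqrt[OF less_imp_le[OF D]])
          then show ?thesis using \<epsilon> unfolding nW by (simp only: powr_numeral divide_inverse)
        qed
        have "norm W powr (- ?n / 2) = \<epsilon> powr (2 * (- ?n / 2)) * D powr (- (1 / 2) * (- ?n / 2))"
          by (simp only: nW' powr_mult powr_powr)
        then have "(norm W powr (- ?n / 2)) ^ CARD('m) = \<epsilon> powr (- (?n * ?m)) * D powr (?n * ?m / 4)"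
          using \<epsilon> D by (simp add: power_mult_distrib powr_power mult_ac)
        moreover have "\<epsilon> ^ DIM(real^'n^'m) = \<epsilon> powr (?n * ?m)"
          using powr_realpow[OF \<epsilon>, of "DIM(real^'n^'m)"] by (simp add: mult.commute)
        ultimately have "\<epsilon> ^ DIM(real^'n^'m) * (norm W powr (- ?n / 2)) ^ CARD('m) = D powr (?n * ?m / 4)"
          using \<epsilon> by (simp only: mult.assoc[symmetric] powr_add[symmetric]) simp
        moreover have "norm z powr (- ?n / 2) = Z powr (- ?n / 4)"
          using Z by (simp add: nz powr_half_sqrt[symmetric] powr_powr)
        ultimately show ?thesis by (simp add: A_def)
      qed
      have "p * (2 / ?m / Z * \<epsilon>\<^sup>2) = (p * 2 / ?m) * (\<epsilon>\<^sup>2 / D) * (D / Z)" using D Z by simp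
      moreover have "(D / Z) powr (- e) = (Z / D) powr e" by (simp add: powr_minus powr_divide)
      ultimately have "(p * (2 / ?m / Z * \<epsilon>\<^sup>2)) powr (- e) = (p * 2 / ?m) powr (- e) * (\<epsilon>\<^sup>2 / D) powr (- e) * (Z / D) powr e"
        by (simp only: powr_mult)
      then show ?thesis using P0 by (simp add: A_eq c1_def)
    qed
    ultimately have "D powr (?n * ?m / 4) * Z powr (- ?n / 4) * (Z / D) powr e * c1 \<le> Y"
      using P0 \<epsilon> D by (simp add: mult_le_cancel_right)
    moreover have "c * N powr ((?m - 1) * ?n / 2) \<le> D powr (?n * ?m / 4) * Z powr (- ?n / 4) * (Z / D) powr e * c1"
    proof -
      \<comment> \<open>The bounds \<open>N\<^sup>2 \<le> D\<close>, \<open>Z \<le> 5 N\<^sup>2\<close> and \<open>D \<le> 2 Z\<close> hold since \<open>N \<ge> 1\<close> and \<open>m \<ge> 1\<close>.\<close>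
      have N2: "N\<^sup>2 = N powr 2" using N by simp
      have d: "N powr (?n * ?m / 2) \<le> D powr (?n * ?m / 4)"
      proof -
        have "(N\<^sup>2) powr (?n * ?m / 4) \<le> D powr (?n * ?m / 4)" by (intro powr_mono2) (auto simp: D_def)
        moreover have "(N\<^sup>2) powr (?n * ?m / 4) = N powr (?n * ?m / 2)"
          by (simp only: N2 powr_powr) (simp add: mult.commute)
        ultimately show ?thesis by (simp only:)
      qed
      have zz: "5 powr (- ?n / 4) * N powr (- ?n / 2) \<le> Z powr (- ?n / 4)"
      proof -
        have "(2 / ?m)\<^sup>2 \<le> 2\<^sup>2" by (intro power_mono) (auto simp: field_simps)
        moreover have "1 \<le> N\<^sup>2" using N by simp
        ultimately have "Z \<le> 5 * N\<^sup>2" by (simp add: Z_def)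
        then have "(5 * N\<^sup>2) powr (- ?n / 4) \<le> Z powr (- ?n / 4)" using Z by (intro powr_mono2') auto
        moreover have "(5 * N\<^sup>2) powr (- ?n / 4) = 5 powr (- ?n / 4) * N powr (- ?n / 2)"
          by (simp only: N2 powr_mult powr_powr) simp
        ultimately show ?thesis by (simp only:)
      qed
      have zd: "(1 / 2) powr e \<le> (Z / D) powr e"
      proof (rule powr_mono2)
        have "1 \<le> N\<^sup>2" using N by simp
        moreover have "1 + u \<le> 2 * (q + u)" if "0 \<le> q" "1 \<le> u" for q u :: real
          using that unfolding distrib_left by linarith
        ultimately have "D \<le> 2 * Z" unfolding D_def Z_def by (meson zero_le_power2)
        then show "1 / 2 \<le> Z / D" using D by (simp add: field_simps)
      qed (use p0 in \<open>auto simp: e_def\<close>)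
      have "N powr ((?m - 1) * ?n / 2) = N powr (?n * ?m / 2) * N powr (- ?n / 2)"
        by (simp add: powr_add[symmetric] algebra_simps diff_divide_distrib)
      then have "c * N powr ((?m - 1) * ?n / 2) =
          N powr (?n * ?m / 2) * (5 powr (- ?n / 4) * N powr (- ?n / 2)) * (1 / 2) powr e * c1"
        by (simp add: c_def)
      also have "\<dots> \<le> D powr (?n * ?m / 4) * Z powr (- ?n / 4) * (Z / D) powr e * c1"
        using c1 d zz zd by (intro mult_right_mono mult_mono) auto
      finally show ?thesis .
    qed
    ultimately show ?thesis by linarith
  qed
  ultimately show ?thesis by blast
qed

section \<open>The necessary conditions on the smoothness\<close>

lemma powr_bounded_imp_nonpos:
  assumes "\<And>N::real. 1 \<le> N \<Longrightarrow> N powr \<delta> \<le> B"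
  shows "\<delta> \<le> 0"
proof (rule ccontr)
  assume "\<not> \<delta> \<le> 0"
  then have \<delta>: "\<delta> > 0" by simp
  have B: "B \<ge> 1" using assms[of 1] by simp
  have "((B + 1) powr (1 / \<delta>)) powr \<delta> \<le> B"
    using B \<delta> by (intro assms ge_one_powr_ge_zero) auto
  then show False using B \<delta> by (simp add: powr_powr)
qed

theorem theorem2:
  fixes \<Psi> :: "real^'n^'m \<Rightarrow> real"
    and ps :: "'m \<Rightarrow> real"
    and p r s :: real
  assumes "smooth \<Psi>"
    and "compact (support \<Psi>)"
    and "\<And>\<xi>. 0 \<le> \<Psi> \<xi>"
    and "support \<Psi> \<subseteq> {\<xi>. 1 / 2 \<le> norm \<xi> \<and> norm \<xi> \<le> 2}"
    and "\<And>\<xi>. \<xi> \<noteq> 0 \<Longrightarrow> ((\<lambda>j::int. \<Psi> ((2 powi (- j)) *\<^sub>R \<xi>)) has_sum 1) UNIV"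
    and "\<And>i. 0 < ps i"
    and "p = inverse (\<Sum>i\<in>UNIV. 1 / ps i)"
    and "1 < r"
    and "0 < s"
    and "\<exists>C::real. \<forall>\<sigma> :: real^'n^'m \<Rightarrow> complex.
           \<sigma> \<in> borel_measurable lebesgue \<longrightarrow> bounded (range \<sigma>) \<longrightarrow> sobolev_sup \<Psi> r s \<sigma> < \<infinity> \<longrightarrow>
             multiplier_norm ps p \<sigma> \<le> ennreal C * sobolev_sup \<Psi> r s \<sigma>"
  shows "s \<ge> max ((real CARD('m) - 1) * real CARD('n) / 2)
                 (real CARD('m) * real CARD('n) / r)"
proof -
  define \<beta> where "\<beta> = (real CARD('m) - 1) * real CARD('n) / 2"
  define \<gamma> where "\<gamma> = real CARD('m) * real CARD('n) / r"
  obtain a :: "real^'n^'m" where a: "norm a = 1" using vector_choose_size[of 1] by auto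
  obtain C where C: "\<And>\<sigma> :: real^'n^'m \<Rightarrow> complex. \<sigma> \<in> borel_measurable lebesgue \<Longrightarrow> bounded (range \<sigma>) \<Longrightarrow>
      sobolev_sup \<Psi> r s \<sigma> < \<infinity> \<Longrightarrow> multiplier_norm ps p \<sigma> \<le> ennreal C * sobolev_sup \<Psi> r s \<sigma>"
    using assms(10) by blast
  obtain C1 where C1: "C1 \<ge> 0" and upper: "\<And>N \<epsilon> \<tau>. 1 \<le> N \<Longrightarrow> 0 < \<epsilon> \<Longrightarrow> \<epsilon> \<le> 1 \<Longrightarrow> 0 < \<tau> \<Longrightarrow>
      sobolev_norm r s (\<lambda>\<xi>. chirp off_diagonal N ((1 / \<epsilon>) *\<^sub>R (\<tau> *\<^sub>R \<xi> - a)) * complex_of_real (\<Psi> \<xi>)) \<le>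
      ennreal (C1 * (N / \<epsilon>) powr s * \<epsilon> powr (DIM(real^'n^'m) / r))"
    using dyadic_chirp_sobolev[OF assms(1,2,4) linear_off_diagonal off_diagonal_symmetric a assms(8,9)] by blast
  obtain c where c: "c > 0" and lower: "\<And>N \<epsilon> Y. 1 \<le> N \<Longrightarrow> 0 < \<epsilon> \<Longrightarrow>
      multiplier_norm ps p (\<lambda>\<xi>. chirp off_diagonal N ((1 / \<epsilon>) *\<^sub>R (\<xi> - a))) < ennreal Y \<Longrightarrow> c * N powr \<beta> \<le> Y"
    using multiplier_norm_chirp_lower_bound[OF assms(6,7), where ?'n = 'n] unfolding \<beta>_def by blast
  \<comment> \<open>The summand 1 makes the bound on the multiplier norm strict.\<close>
  define C2 where "C2 = \<bar>C\<bar> * C1 + 1"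
  have main: "c * N powr \<beta> \<le> C2 * ((N / \<epsilon>) powr s * \<epsilon> powr \<gamma>)" if N: "1 \<le> N" and \<epsilon>: "0 < \<epsilon>" "\<epsilon> \<le> 1" for N \<epsilon>
  proof (rule lower[OF N \<epsilon>(1)])
    let ?\<sigma> = "\<lambda>\<xi>. chirp off_diagonal N ((1 / \<epsilon>) *\<^sub>R (\<xi> - a))"
    let ?X = "(N / \<epsilon>) powr s * \<epsilon> powr \<gamma>"
    have X: "?X > 0" using N \<epsilon> by simp
    have "continuous_on UNIV ?\<sigma>"
    proof -
      have cont: "continuous_on UNIV (off_diagonal :: real^'n^'m \<Rightarrow> _)"
        using linear_off_diagonal by (auto intro: linear_continuous_on simp: linear_conv_bounded_linear)
      then show ?thesis unfolding chirp_def by (intro continuous_intros continuous_on_compose2[OF cont]) auto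
    qed
    then have meas: "?\<sigma> \<in> borel_measurable lebesgue"
      by (intro measurable_completion) (simp add: borel_measurable_continuous_onI)
    have bdd: "bounded (range ?\<sigma>)"
      unfolding bounded_iff by (intro exI[of _ 1]) (auto simp: norm_chirp)
    have sup: "sobolev_sup \<Psi> r s ?\<sigma> \<le> ennreal (C1 * ?X)"
      unfolding sobolev_sup_def
    proof (rule SUP_least)
      fix j :: int
      have "dyadic_piece \<Psi> ?\<sigma> j = (\<lambda>\<xi>. chirp off_diagonal N ((1 / \<epsilon>) *\<^sub>R ((2 powi j) *\<^sub>R \<xi> - a)) * complex_of_real (\<Psi> \<xi>))"
        by (simp add: dyadic_piece_def fun_eq_iff)
      then show "sobolev_norm r s (dyadic_piece \<Psi> ?\<sigma> j) \<le> ennreal (C1 * ?X)"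
        using upper[OF N \<epsilon>, of "2 powi j"] by (simp add: \<gamma>_def mult.assoc)
    qed
    then have "sobolev_sup \<Psi> r s ?\<sigma> < \<infinity>" by (rule le_less_trans) simp
    then have "multiplier_norm ps p ?\<sigma> \<le> ennreal C * sobolev_sup \<Psi> r s ?\<sigma>"
      by (rule C[OF meas bdd])
    also have "\<dots> \<le> ennreal \<bar>C\<bar> * ennreal (C1 * ?X)"
      by (intro mult_mono ennreal_leI sup) auto
    also have "\<dots> = ennreal (\<bar>C\<bar> * C1 * ?X)" by (simp add: ennreal_mult'[symmetric] mult.assoc)
    also have "\<dots> < ennreal (C2 * ?X)"
      using X C1 by (intro ennreal_lessI) (auto simp: C2_def intro!: mult_strict_right_mono mult_pos_pos add_nonneg_pos)
    finally show "multiplier_norm ps p ?\<sigma> < ennreal (C2 * ?X)" .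
  qed
  have "\<beta> - s \<le> 0"
  proof (rule powr_bounded_imp_nonpos)
    fix N :: real assume N: "1 \<le> N"
    have "c * N powr \<beta> \<le> C2 * N powr s" using main[OF N, of 1] by simp
    then show "N powr (\<beta> - s) \<le> C2 / c" using c N by (simp add: powr_diff field_simps)
  qed
  \<comment> \<open>With \<open>\<epsilon> = 1/N\<close> the limit \<open>\<epsilon> \<rightarrow> 0\<close> becomes another growth condition in \<open>N\<close>.\<close>
  moreover have "\<gamma> - s \<le> 0"
  proof (rule powr_bounded_imp_nonpos)
    fix N :: real assume N: "1 \<le> N"
    have "c \<le> C2 * (N powr s * (1 / N) powr \<gamma>)" using main[of 1 "1 / N"] N by simp
    also have "N powr s * (1 / N) powr \<gamma> = 1 / N powr (\<gamma> - s)"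
      using N by (simp add: powr_divide powr_diff)
    finally show "N powr (\<gamma> - s) \<le> C2 / c" using c N by (simp add: field_simps)
  qed
  ultimately show ?thesis by (simp add: \<beta>_def \<gamma>_def)
qed

end
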